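(* Let $V$ be a 6-dimensional real vector space and consider the distributions $\mathcal D^{r,s}$ ($r+s=3$) on the open submanifold $U_+\subset\Lambda^3V^*$. The distributions $$\mathcal D^{3,0},\quad\mathcal D^{2,1},\quad\mathcal D^{1,2},\quad\mathcal D^{0,3},$$ $$\mathcal D^{3,0}\oplus\mathcal D^{2,1},\quad\mathcal D^{3,0}\oplus\mathcal D^{1,2},\quad\mathcal D^{3,0}\oplus\mathcal D^{0,3},\quad\mathcal D^{2,1}\oplus\mathcal D^{0,3},\quad\mathcal D^{1,2}\oplus\mathcal D^{0,3},$$ $$\mathcal D^{3,0}\oplus\mathcal D^{2,1}\oplus\mathcal D^{0,3},\quad\mathcal D^{3,0}\oplus\mathcal D^{1,2}\oplus\mathcal D^{0,3}$$ are integrable. The distributions $$\mathcal D^{2,1}\oplus\mathcal D^{1,2},\quad\mathcal D^{3,0}\oplus\mathcal D^{2,1}\oplus\mathcal D^{1,2},\quad\mathcal D^{2,1}\oplus\mathcal D^{1,2}\oplus\mathcal D^{0,3}$$ are not integrable.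
   Context: $V$ is a 6-dimensional real vector space. $U_+\subset\Lambda^3V^*$ is the (open) $GL(V)$-orbit, under pullback, of $\omega_+=\alpha_1\wedge\alpha_2\wedge\alpha_3+\alpha_4\wedge\alpha_5\wedge\alpha_6$, where $\alpha_1,\dots,\alpha_6$ is a basis of $V^*$; thus $T_\zeta U_+=\Lambda^3V^*$ for $\zeta\in U_+$. Fix a nonzero $\theta_0\in\Lambda^6V^*$. For each $\zeta\in U_+$ there are a unique 6-form $\theta(\zeta)=a\theta_0$ with $a>0$ and a unique automorphism $P(\zeta)$ of $V$ with $P(\zeta)^2=I$ such that $(\iota_v\zeta)\wedge\zeta=\iota_{P(\zeta)v}\theta(\zeta)$ for all $v\in V$; $P$ depends smoothly on $\zeta$ and both $V_1(\zeta)=\ker(P(\zeta)-I)$ and $V_2(\zeta)=\ker(P(\zeta)+I)$ are 3-dimensional, with $V=V_1(\zeta)\oplus V_2(\zeta)$. For $r+s=3$, $\mathcal D^{r,s}$ is the distribution on $U_+$ whose fibre at $\zeta$ is the space of 3-forms on $V$ of type $(r,s)$ with respect to this decomposition, i.e. forms $\Omega$ such that, for vectors each lying in $V_1(\zeta)$ or $V_2(\zeta)$, $\Omega(v_1,v_2,v_3)=0$ unless exactly $r$ of them are in $V_1(\zeta)$ and $s$ of them in $V_2(\zeta)$. Then $TU_+=\mathcal D^{3,0}\oplus\mathcal D^{2,1}\oplus\mathcal D^{1,2}\oplus\mathcal D^{0,3}$. Integrable is meant in the sense of Frobenius (equivalently, closed under Lie brackets of vector fields). *)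

theory Defs
  imports "HOL-Analysis.Analysis"
begin

section \<open>Exterior forms\<close>

text \<open>
  A \<open>k\<close>-form is a function on argument lists that vanishes off lists of length \<open>k\<close>,
  so that forms of all degrees share one type and equality of forms is equality of functions.
\<close>

definition kform :: "nat \<Rightarrow> ('v::real_vector list \<Rightarrow> real) \<Rightarrow> bool" where
  "kform k \<omega> \<longleftrightarrow>
     (\<forall>vs. length vs \<noteq> k \<longrightarrow> \<omega> vs = 0) \<and>
     (\<forall>vs i. length vs = k \<and> i < k \<longrightarrow> linear (\<lambda>x. \<omega> (vs[i := x]))) \<and>
     (\<forall>vs. length vs = k \<and> \<not> distinct vs \<longrightarrow> \<omega> vs = 0)"

text \<open>
  The wedge product as a sum over shuffles. For a \<open>p\<close>-form and a \<open>q\<close>-form only the index sets with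
  \<open>p\<close> elements (and argument lists of length \<open>p + q\<close>) contribute, and the exponent counts the
  inversions of the shuffle. The normalisation is
  \<open>(\<alpha>\<^sub>1 \<and> \<dots> \<and> \<alpha>\<^sub>k)(v\<^sub>1, \<dots>, v\<^sub>k) = det (\<alpha>\<^sub>i v\<^sub>j)\<close>.
\<close>

definition wedge :: "('v list \<Rightarrow> real) \<Rightarrow> ('v list \<Rightarrow> real) \<Rightarrow> 'v list \<Rightarrow> real"  (infixl "\<and>\<^sub>f" 70) where
  "(\<omega> \<and>\<^sub>f \<eta>) vs =
     (\<Sum>I \<in> Pow {..<length vs}.
        (-1) ^ card {(i, j). i \<in> I \<and> j \<in> {..<length vs} - I \<and> j < i} *
        \<omega> (nths vs I) * \<eta> (nths vs ({..<length vs} - I)))"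

definition interior_product :: "'v \<Rightarrow> ('v list \<Rightarrow> real) \<Rightarrow> 'v list \<Rightarrow> real"  ("\<iota>") where
  "\<iota> v \<omega> = (\<lambda>vs. \<omega> (v # vs))"

definition pullback :: "('v \<Rightarrow> 'w) \<Rightarrow> ('w list \<Rightarrow> real) \<Rightarrow> 'v list \<Rightarrow> real" where
  "pullback g \<omega> = (\<lambda>vs. \<omega> (map g vs))"

definition covector_form :: "('v::euclidean_space \<Rightarrow>\<^sub>L real) \<Rightarrow> 'v list \<Rightarrow> real" where
  "covector_form \<phi> = (\<lambda>vs. case vs of [v] \<Rightarrow> blinfun_apply \<phi> v | _ \<Rightarrow> 0)"


section \<open>The space of 3-forms as a normed space\<close>

typedef (overloaded) 'v form3 = "{\<omega> :: 'v::euclidean_space list \<Rightarrow> real. kform 3 \<omega>}"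
  morphisms form_of Form3
proof
  show "(\<lambda>_. 0) \<in> {\<omega> :: 'v list \<Rightarrow> real. kform 3 \<omega>}"
    by (simp add: kform_def linear_zero)
qed

setup_lifting type_definition_form3

lemma kform_add: "kform k \<omega> \<Longrightarrow> kform k \<eta> \<Longrightarrow> kform k (\<lambda>vs. \<omega> vs + \<eta> vs)"
  by (auto simp: kform_def intro!: linear_compose_add)

lemma kform_scale: "kform k \<omega> \<Longrightarrow> kform k (\<lambda>vs. c * \<omega> vs)"
  by (simp add: kform_def linear_iff distrib_left mult.left_commute)

lemma kform3_eq_0:
  fixes \<omega> :: "'v::euclidean_space list \<Rightarrow> real"
  assumes \<omega>: "kform 3 \<omega>"
    and zero: "\<And>a b c. a \<in> Basis \<Longrightarrow> b \<in> Basis \<Longrightarrow> c \<in> Basis \<Longrightarrow> \<omega> [a, b, c] = 0"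
  shows "\<omega> = (\<lambda>_. 0)"
proof -
  have lin: "linear (\<lambda>x. \<omega> ([u, v, w][i := x]))" if "i < 3" for u v w i
    using \<omega> that unfolding kform_def by (metis length_Cons list.size(3) numeral_3_eq_3)
  have L0: "linear (\<lambda>x. \<omega> [x, v, w])" for v w
    using lin[of 0 undefined v w] by simp
  have L1: "linear (\<lambda>x. \<omega> [u, x, w])" for u w
    using lin[of 1 u undefined w] by simp
  have L2: "linear (\<lambda>x. \<omega> [u, v, x])" for u v
    using lin[of 2 u v undefined] by (simp add: numeral_2_eq_2)
  have ext: "f x = 0" if "linear f" "\<And>b. b \<in> Basis \<Longrightarrow> f b = 0" for f :: "'v \<Rightarrow> real" and x
    using linear_eq_stdbasis[OF that(1) linear_zero] that(2) by metis
  have s2: "\<omega> [a, b, w] = 0" if "a \<in> Basis" "b \<in> Basis" for a b w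
    using ext[OF L2] zero that by blast
  have s1: "\<omega> [a, v, w] = 0" if "a \<in> Basis" for a v w
    using ext[OF L1] s2 that by blast
  have s0: "\<omega> [u, v, w] = 0" for u v w
    using ext[OF L0] s1 by blast
  show ?thesis
  proof
    fix vs :: "'v list"
    show "\<omega> vs = 0"
    proof (cases "length vs = 3")
      case True
      then obtain u v w where "vs = [u, v, w]"
        by (auto simp: numeral_3_eq_3 length_Suc_conv)
      then show ?thesis using s0 by simp
    next
      case False
      then show ?thesis using \<omega> by (simp add: kform_def)
    qed
  qed
qed

text \<open>
  The space of 3-forms is finite-dimensional, so the inner product below, which makes the standard
  basis forms \<open>e\<^sub>i \<and> e\<^sub>j \<and> e\<^sub>k\<close> orthogonal, serves only to provide its canonical topology and
  smooth structure.
\<close>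

instantiation form3 :: (euclidean_space) real_inner
begin

lift_definition zero_form3 :: "'a form3" is "\<lambda>_. 0"
  by (simp add: kform_def linear_zero)

lift_definition plus_form3 :: "'a form3 \<Rightarrow> 'a form3 \<Rightarrow> 'a form3" is "\<lambda>\<omega> \<eta> vs. \<omega> vs + \<eta> vs"
  by (rule kform_add)

lift_definition scaleR_form3 :: "real \<Rightarrow> 'a form3 \<Rightarrow> 'a form3" is "\<lambda>c \<omega> vs. c * \<omega> vs"
  by (rule kform_scale)

lift_definition uminus_form3 :: "'a form3 \<Rightarrow> 'a form3" is "\<lambda>\<omega> vs. - \<omega> vs"
  using kform_scale[of 3 _ "-1"] by simp

lift_definition minus_form3 :: "'a form3 \<Rightarrow> 'a form3 \<Rightarrow> 'a form3" is "\<lambda>\<omega> \<eta> vs. \<omega> vs - \<eta> vs"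
  using kform_add[OF _ kform_scale[of 3 _ "-1"]] by simp

lift_definition inner_form3 :: "'a form3 \<Rightarrow> 'a form3 \<Rightarrow> real" is
  "\<lambda>\<omega> \<eta>. \<Sum>a\<in>Basis. \<Sum>b\<in>Basis. \<Sum>c\<in>Basis. \<omega> [a, b, c] * \<eta> [a, b, c]" .

definition norm_form3 :: "'a form3 \<Rightarrow> real" where
  "norm_form3 \<omega> = sqrt (inner \<omega> \<omega>)"

definition sgn_form3 :: "'a form3 \<Rightarrow> 'a form3" where
  "sgn_form3 \<omega> = inverse (norm \<omega>) *\<^sub>R \<omega>"

definition dist_form3 :: "'a form3 \<Rightarrow> 'a form3 \<Rightarrow> real" where
  "dist_form3 \<omega> \<eta> = norm (\<omega> - \<eta>)"

definition uniformity_form3 :: "('a form3 \<times> 'a form3) filter" where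
  "uniformity_form3 = (INF e\<in>{0 <..}. principal {(x, y). dist x y < e})"

definition open_form3 :: "'a form3 set \<Rightarrow> bool" where
  "open_form3 U \<longleftrightarrow> (\<forall>x\<in>U. eventually (\<lambda>(x', y). x' = x \<longrightarrow> y \<in> U) uniformity)"

instance
proof
  fix x y z :: "'a form3" and r s :: real
  show "x + y + z = x + (y + z)" by transfer (simp add: add.assoc)
  show "x + y = y + x" by transfer (simp add: add.commute)
  show "0 + x = x" by transfer simp
  show "- x + x = 0" by transfer simp
  show "x - y = x + - y" by transfer simp
  show "r *\<^sub>R (x + y) = r *\<^sub>R x + r *\<^sub>R y" by transfer (simp add: distrib_left)
  show "(r + s) *\<^sub>R x = r *\<^sub>R x + s *\<^sub>R x" by transfer (simp add: distrib_right)
  show "r *\<^sub>R s *\<^sub>R x = (r * s) *\<^sub>R x" by transfer (simp add: mult.assoc)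
  show "1 *\<^sub>R x = x" by transfer simp
  show "dist x y = norm (x - y)" by (rule dist_form3_def)
  show "sgn x = inverse (norm x) *\<^sub>R x" by (rule sgn_form3_def)
  show "uniformity = (INF e\<in>{0 <..}. principal {(x::'a form3, y). dist x y < e})"
    by (rule uniformity_form3_def)
  show "open U \<longleftrightarrow> (\<forall>x\<in>U. eventually (\<lambda>(x', y). x' = x \<longrightarrow> y \<in> U) uniformity)"
    for U :: "'a form3 set" by (rule open_form3_def)
  show "inner x y = inner y x" by transfer (simp add: mult.commute)
  show "inner (x + y) z = inner x z + inner y z"
    by transfer (simp add: distrib_right sum.distrib)
  show "inner (r *\<^sub>R x) y = r * inner x y"
    by transfer (simp add: sum_distrib_left mult.assoc)
  show "0 \<le> inner x x" by transfer (simp add: sum_nonneg)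
  show "inner x x = 0 \<longleftrightarrow> x = 0"
  proof transfer
    fix \<omega> :: "'a list \<Rightarrow> real"
    assume \<omega>: "kform 3 \<omega>"
    show "(\<Sum>a\<in>Basis. \<Sum>b\<in>Basis. \<Sum>c\<in>Basis. \<omega> [a, b, c] * \<omega> [a, b, c]) = 0 \<longleftrightarrow> \<omega> = (\<lambda>_. 0)"
      using kform3_eq_0[OF \<omega>] by (auto simp: sum_nonneg_eq_0_iff sum_nonneg)
  qed
  show "norm x = sqrt (inner x x)" by (rule norm_form3_def)
qed

end


section \<open>The open orbit and its decomposition\<close>

definition dual_basis :: "(nat \<Rightarrow> 'v::euclidean_space \<Rightarrow>\<^sub>L real) \<Rightarrow> bool" where
  "dual_basis \<alpha> \<longleftrightarrow>
     inj_on \<alpha> {1..6} \<and> independent (\<alpha> ` {1..6}) \<and> span (\<alpha> ` {1..6}) = UNIV"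

definition omega_plus :: "(nat \<Rightarrow> 'v::euclidean_space \<Rightarrow>\<^sub>L real) \<Rightarrow> 'v list \<Rightarrow> real" where
  "omega_plus \<alpha> =
     (\<lambda>vs. (covector_form (\<alpha> 1) \<and>\<^sub>f covector_form (\<alpha> 2) \<and>\<^sub>f covector_form (\<alpha> 3)) vs
         + (covector_form (\<alpha> 4) \<and>\<^sub>f covector_form (\<alpha> 5) \<and>\<^sub>f covector_form (\<alpha> 6)) vs)"

definition U_plus :: "(nat \<Rightarrow> 'v::euclidean_space \<Rightarrow>\<^sub>L real) \<Rightarrow> 'v form3 set" where
  "U_plus \<alpha> = {\<zeta>. \<exists>g. linear g \<and> bij g \<and> form_of \<zeta> = pullback g (omega_plus \<alpha>)}"

text \<open>
  The 6-form \<open>a \<cdot> \<theta>0\<close> is the form \<open>\<theta>(\<zeta>)\<close>; for \<open>\<zeta>\<close> in \<open>U_plus \<alpha>\<close> both it and the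
  automorphism are unique.
\<close>

definition P_map :: "('v::euclidean_space list \<Rightarrow> real) \<Rightarrow> 'v form3 \<Rightarrow> 'v \<Rightarrow> 'v" where
  "P_map \<theta>0 \<zeta> =
     (THE P. linear P \<and> P \<circ> P = id \<and>
        (\<exists>a>0. \<forall>v. \<iota> v (form_of \<zeta>) \<and>\<^sub>f form_of \<zeta> = \<iota> (P v) (\<lambda>vs. a * \<theta>0 vs)))"

definition V1 :: "('v::euclidean_space list \<Rightarrow> real) \<Rightarrow> 'v form3 \<Rightarrow> 'v set" where
  "V1 \<theta>0 \<zeta> = {v. P_map \<theta>0 \<zeta> v - v = 0}"

definition V2 :: "('v::euclidean_space list \<Rightarrow> real) \<Rightarrow> 'v form3 \<Rightarrow> 'v set" where
  "V2 \<theta>0 \<zeta> = {v. P_map \<theta>0 \<zeta> v + v = 0}"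


section \<open>Distributions\<close>

text \<open>
  A distribution assigns to each point of the space of 3-forms a set of tangent vectors, tangent
  spaces being identified with the space itself; only the fibres over \<open>U_plus \<alpha>\<close> are relevant.
\<close>

type_synonym 'v distribution = "'v form3 \<Rightarrow> 'v form3 set"

text \<open>
  The zero vector lies in both \<open>V1\<close> and \<open>V2\<close>, but a form vanishes on every list containing it,
  so it does not disturb the counting.
\<close>

definition type_distribution ::
    "('v::euclidean_space list \<Rightarrow> real) \<Rightarrow> nat \<Rightarrow> nat \<Rightarrow> 'v distribution" where
  "type_distribution \<theta>0 r s \<zeta> =
     {\<Omega>. \<forall>vs. length vs = 3 \<and> set vs \<subseteq> V1 \<theta>0 \<zeta> \<union> V2 \<theta>0 \<zeta> \<and>
           \<not> (length (filter (\<lambda>v. v \<in> V1 \<theta>0 \<zeta>) vs) = r \<and>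
              length (filter (\<lambda>v. v \<in> V2 \<theta>0 \<zeta>) vs) = s)
         \<longrightarrow> form_of \<Omega> vs = 0}"

definition distribution_sum ::
    "'v::euclidean_space distribution \<Rightarrow> 'v distribution \<Rightarrow> 'v distribution"
    (infixl "\<oplus>" 65) where
  "(D \<oplus> E) \<zeta> = {x + y |x y. x \<in> D \<zeta> \<and> y \<in> E \<zeta>}"

text \<open>
  \<open>C\<^sup>k\<close> maps on an open set. Iterated directional derivatives are used because the full higher
  derivatives would live in types that change with the order.
\<close>

primrec Ck_on ::
    "nat \<Rightarrow> 'a::real_normed_vector set \<Rightarrow> ('a \<Rightarrow> 'b::real_normed_vector) \<Rightarrow> bool" where
  "Ck_on 0 S f \<longleftrightarrow> continuous_on S f"
| "Ck_on (Suc k) S f \<longleftrightarrow>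
     (\<forall>x\<in>S. f differentiable (at x)) \<and> (\<forall>v. Ck_on k S (\<lambda>x. frechet_derivative f (at x) v))"

definition smooth_on :: "'a::real_normed_vector set \<Rightarrow> ('a \<Rightarrow> 'b::real_normed_vector) \<Rightarrow> bool" where
  "smooth_on S f \<longleftrightarrow> (\<forall>k. Ck_on k S f)"

definition lie_bracket ::
    "('a::real_normed_vector \<Rightarrow> 'a) \<Rightarrow> ('a \<Rightarrow> 'a) \<Rightarrow> 'a \<Rightarrow> 'a" where
  "lie_bracket X Y x = frechet_derivative Y (at x) (X x) - frechet_derivative X (at x) (Y x)"

definition local_section ::
    "'v::euclidean_space distribution \<Rightarrow> 'v form3 set \<Rightarrow> ('v form3 \<Rightarrow> 'v form3) \<Rightarrow> bool" where
  "local_section D W X \<longleftrightarrow> smooth_on W X \<and> (\<forall>\<zeta>\<in>W. X \<zeta> \<in> D \<zeta>)"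

text \<open>
  Integrability in the sense of Frobenius: the Lie bracket of any two smooth local sections is
  again a section.
\<close>

definition integrable_distribution ::
    "'v::euclidean_space form3 set \<Rightarrow> 'v distribution \<Rightarrow> bool" where
  "integrable_distribution U D \<longleftrightarrow>
     (\<forall>W X Y. open W \<and> W \<subseteq> U \<and> local_section D W X \<and> local_section D W Y
        \<longrightarrow> (\<forall>\<zeta>\<in>W. lie_bracket X Y \<zeta> \<in> D \<zeta>))"

end

theory Submission
  imports Defs
begin

text \<open>
  Near a point of the orbit write \<open>V = V1 \<oplus> V2\<close> for the eigenspaces of \<open>P\<close>. Differentiating
  \<open>P o P = id\<close> and \<open>\<zeta>(P u, v, w) = \<zeta>(u, P v, w)\<close> shows that the derivative of
  \<open>P\<close> in the direction \<open>\<Omega>\<close> exchanges \<open>V1\<close> and \<open>V2\<close>, that its restriction to \<open>V1\<close> is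
  determined by the component of \<open>\<Omega>\<close> of type (1,2) and its restriction to \<open>V2\<close> by the component
  of type (2,1). Differentiating the equations that say that \<open>X\<close> and \<open>Y\<close> are sections therefore
  expresses the components of \<open>[X, Y]\<close> transversal to the distribution through the values of
  \<open>X\<close> and \<open>Y\<close> alone. They all vanish if the types (2,1) and (1,2) do not both occur; if
  both occur, a field of type (2,1) and one of type (1,2) have a bracket with nonzero components
  of types (3,0) and (0,3). Replacing \<open>P\<close> by \<open>-P\<close> exchanges the roles of \<open>V1\<close> and \<open>V2\<close>.
\<close>

subsection \<open>Alternating forms\<close>

text \<open>\<open>P_map\<close> is a definite description, so its regularity has to be earned.
  Solving the defining equation with a fixed 6-form in place of \<theta>(\<zeta>) gives an
  endomorphism \<open>K \<xi>\<close> that is quadratic in \<open>\<xi>\<close> and, on the orbit, a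
  positive multiple of \<open>P \<xi>\<close>; the square of the factor is polynomial in
  \<open>\<xi>\<close> too. Hence \<open>P\<close> is differentiable. The fields that refute
  integrability are built from \<open>K\<close> because polynomial fields are smooth and the factor
  does not affect types.

  A nonzero bracket component is not yet a refutation: over a set with empty interior every
  distribution is integrable for want of open sets. So a nonempty open subset of the orbit is
  produced, by showing that \<open>g \<mapsto> pull g \<omega>\<close> is a submersion at the
  identity.

  The sign of \<open>\<theta>0\<close> on an adapted basis decides which summand of the standard
  form belongs to which eigenvalue; it is normalised by exchanging the two triples of the
  basis.\<close>

lemma kform_linear:
  assumes "kform (length (xs @ x # ys)) \<omega>"
  shows "linear (\<lambda>x. \<omega> (xs @ x # ys))"
proof -
  have "linear (\<lambda>y. \<omega> ((xs @ x # ys)[length xs := y]))"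
    using assms[unfolded kform_def, THEN conjunct2, THEN conjunct1, rule_format, of "xs @ x # ys" "length xs"]
    by simp
  then show ?thesis by simp
qed

lemma kform_not_distinct: "kform k \<omega> \<Longrightarrow> \<not> distinct vs \<Longrightarrow> \<omega> vs = 0"
  by (cases "length vs = k") (simp_all add: kform_def)

lemma kform_length: "kform k \<omega> \<Longrightarrow> length vs \<noteq> k \<Longrightarrow> \<omega> vs = 0"
  by (simp add: kform_def)

lemma alternating_swap:
  fixes \<omega> :: "'a::real_vector list \<Rightarrow> real"
  assumes l1: "\<And>v. linear (\<lambda>u. \<omega> (xs @ u # ys @ v # zs))"
    and l2: "\<And>u. linear (\<lambda>v. \<omega> (xs @ u # ys @ v # zs))"
    and z: "\<And>u. \<omega> (xs @ u # ys @ u # zs) = 0"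
  shows "\<omega> (xs @ x # ys @ y # zs) = - \<omega> (xs @ y # ys @ x # zs)"
proof -
  have "0 = \<omega> (xs @ (x + y) # ys @ (x + y) # zs)" using z by simp
  also have "\<dots> = \<omega> (xs @ x # ys @ y # zs) + \<omega> (xs @ y # ys @ x # zs)"
    using linear_add[OF l1, of x y "x + y"] linear_add[OF l2, of x x y] linear_add[OF l2, of y x y]
      z[of x] z[of y] by simp
  finally show ?thesis by simp
qed

lemma kform_swap:
  assumes \<omega>: "kform k \<omega>"
  shows "\<omega> (xs @ x # ys @ y # zs) = - \<omega> (xs @ y # ys @ x # zs)"
proof (cases "length (xs @ x # ys @ y # zs) = k")
  case True
  show ?thesis
  proof (rule alternating_swap)
    show "linear (\<lambda>u. \<omega> (xs @ u # ys @ v # zs))" for v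
      using kform_linear[of xs undefined "ys @ v # zs" \<omega>] \<omega> True by simp
    show "linear (\<lambda>v. \<omega> (xs @ u # ys @ v # zs))" for u
      using kform_linear[of "xs @ u # ys" undefined zs \<omega>] \<omega> True by simp
    show "\<omega> (xs @ u # ys @ u # zs) = 0" for u
      using kform_not_distinct[OF \<omega>, of "xs @ u # ys @ u # zs"] by simp
  qed
next
  case False
  then show ?thesis using kform_length[OF \<omega>] by simp
qed

lemmas kform_swap_adjacent = kform_swap[where ys="[]", unfolded append_Nil]

text \<open>Absolute values discard the sign of the permutation, since the result serves only to
  show that values vanish. The prefix \<open>xs\<close> is arbitrary because the induction moves
  entries into it.\<close>

lemma kform_insort:
  assumes \<omega>: "kform k \<omega>"
  shows "\<bar>\<omega> (xs @ map e (insort i is))\<bar> = \<bar>\<omega> (xs @ e i # map e is)\<bar>"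
proof (induction "is" arbitrary: xs)
  case (Cons j js)
  show ?case
  proof (cases "i \<le> j")
    case False
    have "\<bar>\<omega> (xs @ map e (insort i (j # js)))\<bar> = \<bar>\<omega> ((xs @ [e j]) @ map e (insort i js))\<bar>"
      using False by simp
    also have "\<dots> = \<bar>\<omega> (xs @ e j # e i # map e js)\<bar>"
      by (subst Cons.IH) simp
    also have "\<dots> = \<bar>\<omega> (xs @ e i # e j # map e js)\<bar>"
      by (subst kform_swap_adjacent[OF \<omega>]) simp
    finally show ?thesis by simp
  qed simp
qed simp

lemma kform_sort:
  assumes \<omega>: "kform k \<omega>"
  shows "\<bar>\<omega> (xs @ map e (sort is))\<bar> = \<bar>\<omega> (xs @ map e is)\<bar>"
proof (induction "is" arbitrary: xs)
  case (Cons j js)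
  then show ?case
    using kform_insort[OF \<omega>, of xs e j "sort js"] Cons.IH[of "xs @ [e j]"] by simp
qed simp

text \<open>A basis with its coordinate functionals. These are plain functions, so that bounded
  functionals, their composites with a linear map and inner products all fit. Indices start at 0,
  whereas \<open>dual_basis\<close> counts from 1.\<close>

definition basis6 :: "(nat \<Rightarrow> 'v::real_vector \<Rightarrow> real) \<Rightarrow> (nat \<Rightarrow> 'v) \<Rightarrow> bool" where
  "basis6 \<beta> e \<longleftrightarrow> (\<forall>i<6. linear (\<beta> i)) \<and> (\<forall>i<6. \<forall>j<6. \<beta> i (e j) = (if i = j then 1 else 0)) \<and>
     (\<forall>x. x = (\<Sum>i<6. \<beta> i x *\<^sub>R e i))"

text \<open>Multilinearity reduces to basis vectors and alternation to strictly increasing indices,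
  so an identity between forms becomes finitely many evaluations.\<close>

lemma kform_eq_0_basis6:
  assumes \<omega>: "kform k \<omega>" and e: "basis6 \<beta> e"
    and zero: "\<And>is. length is = k \<Longrightarrow> sorted is \<Longrightarrow> distinct is \<Longrightarrow> set is \<subseteq> {..<6} \<Longrightarrow> \<omega> (map e is) = 0"
  shows "\<omega> vs = 0"
proof -
  have basis: "\<omega> (map e is) = 0" if "set is \<subseteq> {..<6}" for "is"
  proof (cases "distinct is \<and> length is = k")
    case True
    then have "\<omega> (map e (sort is)) = 0" using that by (intro zero) auto
    then show ?thesis using kform_sort[OF \<omega>, of "[]" e "is"] by simp
  next
    case False
    then show ?thesis
      using kform_not_distinct[OF \<omega>, of "map e is"] kform_length[OF \<omega>, of "map e is"]
      by (auto simp: distinct_map)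
  qed
  \<comment> \<open>The suffix \<open>map e is\<close> holds the arguments already replaced by basis
    vectors; the reverse induction moves the last entry of \<open>xs\<close> into it.\<close>
  have "\<omega> (xs @ map e is) = 0" if "set is \<subseteq> {..<6}" for xs "is"
    using that
  proof (induction xs arbitrary: "is" rule: rev_induct)
    case Nil
    then show ?case using basis by simp
  next
    case (snoc x xs)
    show ?case
    proof (cases "length (xs @ x # map e is) = k")
      case True
      then have lin: "linear (\<lambda>x. \<omega> (xs @ x # map e is))"
        using kform_linear[of xs x "map e is" \<omega>] \<omega> by simp
      have "x = (\<Sum>i<6. \<beta> i x *\<^sub>R e i)" using e by (simp add: basis6_def)
      then have "\<omega> (xs @ x # map e is) = \<omega> (xs @ (\<Sum>i<6. \<beta> i x *\<^sub>R e i) # map e is)" by simp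
      also have "\<dots> = (\<Sum>i<6. \<beta> i x *\<^sub>R \<omega> (xs @ e i # map e is))"
        by (simp add: linear_sum[OF lin] linear_scale[OF lin])
      also have "\<dots> = 0"
        using snoc.IH[of "i # is" for i] snoc.prems by (intro sum.neutral) auto
      finally show ?thesis by simp
    next
      case False
      then show ?thesis using kform_length[OF \<omega>] by simp
    qed
  qed
  from this[of "[]" vs] show ?thesis by simp
qed

lemma kform_diff: "kform k \<omega> \<Longrightarrow> kform k \<eta> \<Longrightarrow> kform k (\<lambda>vs. \<omega> vs - \<eta> vs)"
  using kform_add[OF _ kform_scale[of k _ "-1"]] by simp

text \<open>The only increasing list of six indices below 6 is \<open>[0..<6]\<close>, so this one
  value determines a 6-form.\<close>

lemma kform_6_nonzero:
  assumes \<theta>: "kform 6 \<theta>" "\<theta> \<noteq> (\<lambda>_. 0)" and e: "basis6 \<beta> e"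
  shows "\<theta> (map e [0..<6]) \<noteq> 0"
proof
  assume z: "\<theta> (map e [0..<6]) = 0"
  have "\<theta> vs = 0" for vs
  proof (rule kform_eq_0_basis6[OF \<theta>(1) e])
    fix "is" :: "nat list"
    assume a: "length is = 6" "sorted is" "distinct is" "set is \<subseteq> {..<6}"
    have "card (set is) = card {..<6::nat}"
      using a(1,3) by (simp add: distinct_card)
    then have "set is = set [0..<6]"
      using a(4) card_subset_eq[of "{..<6}" "set is"] by (simp add: atLeast0LessThan)
    then have "is = [0..<6]"
      using sorted_distinct_set_unique[OF a(2,3), of "[0..<6]"] by simp
    then show "\<theta> (map e is) = 0" using z by simp
  qed
  then show False using \<theta>(2) by (simp add: fun_eq_iff)
qed

subsection \<open>Evaluating 3-forms\<close>

lemma kform_form_of: "kform 3 (form_of \<Omega>)"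
  using form_of by auto

lemma form_of_linear:
  shows "linear (\<lambda>x. form_of \<Omega> [x, v, w])" "linear (\<lambda>x. form_of \<Omega> [u, x, w])"
    "linear (\<lambda>x. form_of \<Omega> [u, v, x])"
  using kform_linear[of "[]" undefined "[v, w]" "form_of \<Omega>"]
    kform_linear[of "[u]" undefined "[w]" "form_of \<Omega>"]
    kform_linear[of "[u, v]" undefined "[]" "form_of \<Omega>"] kform_form_of[of \<Omega>]
  by (simp_all add: numeral_3_eq_3)

lemmas form_of_add_arg [simp] = form_of_linear[THEN linear_add]
lemmas form_of_diff_arg [simp] = form_of_linear[THEN linear_diff]
lemmas form_of_neg_arg [simp] = form_of_linear[THEN linear_neg]
lemmas form_of_scale_arg [simp] = form_of_linear[THEN linear_scale]
lemmas form_of_0_arg [simp] = form_of_linear[THEN linear_0]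
lemmas form_of_sum_arg = form_of_linear[THEN linear_sum]

lemma form_of_alt [simp]:
  "form_of \<Omega> [x, x, y] = 0" "form_of \<Omega> [x, y, x] = 0" "form_of \<Omega> [y, x, x] = 0"
  by (simp_all add: kform_not_distinct[OF kform_form_of])

lemma form_of_swap:
  "form_of \<Omega> [y, x, z] = - form_of \<Omega> [x, y, z]"
  "form_of \<Omega> [x, z, y] = - form_of \<Omega> [x, y, z]"
  by (fact kform_swap_adjacent[OF kform_form_of, of \<Omega> "[]" y x "[z]", simplified append_Nil]
    kform_swap_adjacent[OF kform_form_of, of \<Omega> "[x]" z y "[]", simplified append_Cons append_Nil])+

lemma form_of_length: "length vs \<noteq> 3 \<Longrightarrow> form_of \<Omega> vs = 0"
  using kform_length[OF kform_form_of] .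

lemmas form_of_simps [simp] =
  zero_form3.rep_eq plus_form3.rep_eq minus_form3.rep_eq uminus_form3.rep_eq scaleR_form3.rep_eq

lemma form_of_sum: "form_of (\<Sum>i\<in>I. F i) vs = (\<Sum>i\<in>I. form_of (F i) vs)"
  by (induction I rule: infinite_finite_induct) auto

lemma length_3_iff: "length vs = 3 \<longleftrightarrow> (\<exists>x y z. vs = [x, y, z])"
  by (auto simp: numeral_3_eq_3 length_Suc_conv)

lemma form3_eqI:
  assumes "\<And>x y z. form_of \<Omega> [x, y, z] = form_of \<Phi> [x, y, z]"
  shows "\<Omega> = \<Phi>"
proof -
  have "form_of \<Omega> vs = form_of \<Phi> vs" for vs
    using assms form_of_length[of vs] length_3_iff[of vs] by (cases "length vs = 3") auto
  then show ?thesis by (intro form_of_inject[THEN iffD1] ext)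
qed

lemma form_of_expand:
  "form_of \<Omega> [u, v, w] =
    (\<Sum>a\<in>Basis. \<Sum>b\<in>Basis. \<Sum>c\<in>Basis. (u \<bullet> a) * (v \<bullet> b) * (w \<bullet> c) * form_of \<Omega> [a, b, c])"
proof -
  have "form_of \<Omega> [u, v, w] = form_of \<Omega> [\<Sum>a\<in>Basis. (u \<bullet> a) *\<^sub>R a, v, w]"
    by (simp add: euclidean_representation)
  also have "\<dots> = (\<Sum>a\<in>Basis. (u \<bullet> a) * form_of \<Omega> [a, v, w])"
    by (simp add: form_of_sum_arg)
  also have "\<dots> = (\<Sum>a\<in>Basis. (u \<bullet> a) * form_of \<Omega> [a, \<Sum>b\<in>Basis. (v \<bullet> b) *\<^sub>R b, w])"
    by (simp add: euclidean_representation)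
  also have "\<dots> = (\<Sum>a\<in>Basis. \<Sum>b\<in>Basis. (u \<bullet> a) * (v \<bullet> b) * form_of \<Omega> [a, b, w])"
    by (simp add: form_of_sum_arg sum_distrib_left mult.assoc)
  also have "\<dots> = (\<Sum>a\<in>Basis. \<Sum>b\<in>Basis. (u \<bullet> a) * (v \<bullet> b) *
      form_of \<Omega> [a, b, \<Sum>c\<in>Basis. (w \<bullet> c) *\<^sub>R c])"
    by (simp add: euclidean_representation)
  also have "\<dots> = (\<Sum>a\<in>Basis. \<Sum>b\<in>Basis. \<Sum>c\<in>Basis.
      (u \<bullet> a) * (v \<bullet> b) * (w \<bullet> c) * form_of \<Omega> [a, b, c])"
    by (simp add: form_of_sum_arg sum_distrib_left mult.assoc)
  finally show ?thesis .
qed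

lemma form_of_basis_bound:
  assumes "a \<in> Basis" "b \<in> Basis" "c \<in> Basis"
  shows "\<bar>form_of \<Omega> [a, b, c]\<bar> \<le> norm \<Omega>"
proof -
  let ?g = "\<lambda>a b c. form_of \<Omega> [a, b, c] * form_of \<Omega> [a, b, c]"
  have "?g a b c \<le> (\<Sum>c\<in>Basis. ?g a b c)"
    using assms by (intro member_le_sum) auto
  also have "\<dots> \<le> (\<Sum>b\<in>Basis. \<Sum>c\<in>Basis. ?g a b c)"
    using assms by (intro member_le_sum[where f="\<lambda>b. \<Sum>c\<in>Basis. ?g a b c"]) (auto intro: sum_nonneg)
  also have "\<dots> \<le> (\<Sum>a\<in>Basis. \<Sum>b\<in>Basis. \<Sum>c\<in>Basis. ?g a b c)"
    using assms by (intro member_le_sum[where f="\<lambda>a. \<Sum>b\<in>Basis. \<Sum>c\<in>Basis. ?g a b c"])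
      (auto intro!: sum_nonneg)
  also have "\<dots> = (norm \<Omega>)\<^sup>2"
    by (simp add: power2_norm_eq_inner inner_form3.rep_eq)
  finally show ?thesis
    by (metis abs_le_square_iff abs_norm_cancel power2_eq_square)
qed

lemma bounded_linear_form_of [intro]: "bounded_linear (\<lambda>\<Omega>. form_of \<Omega> vs)"
proof (cases "length vs = 3")
  case True
  then obtain u v w where vs: "vs = [u, v, w]" by (auto simp: length_3_iff)
  have "bounded_linear (\<lambda>\<Omega>. form_of \<Omega> [a, b, c])" if "a \<in> Basis" "b \<in> Basis" "c \<in> Basis" for a b c :: 'a
    using form_of_basis_bound[OF that] by (intro bounded_linear_intro[where K=1]) auto
  then show ?thesis
    unfolding vs by (subst form_of_expand)
      (auto intro!: bounded_linear_sum bounded_linear_const_mult)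
next
  case False
  then show ?thesis by (simp add: form_of_length[OF False] bounded_linear_zero)
qed

section \<open>Coordinate expansion of 3-forms and differentiation in coordinates\<close>

lift_definition det_form :: "'v::euclidean_space \<Rightarrow> 'v \<Rightarrow> 'v \<Rightarrow> 'v form3" is
  "\<lambda>a b c vs. if length vs = 3 then
      (vs ! 0 \<bullet> a) * ((vs ! 1 \<bullet> b) * (vs ! 2 \<bullet> c) - (vs ! 2 \<bullet> b) * (vs ! 1 \<bullet> c))
    - (vs ! 1 \<bullet> a) * ((vs ! 0 \<bullet> b) * (vs ! 2 \<bullet> c) - (vs ! 2 \<bullet> b) * (vs ! 0 \<bullet> c))
    + (vs ! 2 \<bullet> a) * ((vs ! 0 \<bullet> b) * (vs ! 1 \<bullet> c) - (vs ! 1 \<bullet> b) * (vs ! 0 \<bullet> c)) else 0"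
proof -
  fix a b c :: 'v
  show "?thesis a b c"
    unfolding kform_def
  proof (intro conjI allI impI)
    fix vs :: "'v list" and i :: nat assume "length vs = 3 \<and> i < 3"
    then obtain x y z where "vs = [x, y, z]" by (auto simp: length_3_iff)
    moreover have "i = 0 \<or> i = 1 \<or> i = 2" using \<open>length vs = 3 \<and> i < 3\<close> by auto
    ultimately show "linear (\<lambda>u. if length (vs[i := u]) = 3 then
      (vs[i := u] ! 0 \<bullet> a) * ((vs[i := u] ! 1 \<bullet> b) * (vs[i := u] ! 2 \<bullet> c) - (vs[i := u] ! 2 \<bullet> b) * (vs[i := u] ! 1 \<bullet> c))
    - (vs[i := u] ! 1 \<bullet> a) * ((vs[i := u] ! 0 \<bullet> b) * (vs[i := u] ! 2 \<bullet> c) - (vs[i := u] ! 2 \<bullet> b) * (vs[i := u] ! 0 \<bullet> c))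
    + (vs[i := u] ! 2 \<bullet> a) * ((vs[i := u] ! 0 \<bullet> b) * (vs[i := u] ! 1 \<bullet> c) - (vs[i := u] ! 1 \<bullet> b) * (vs[i := u] ! 0 \<bullet> c)) else 0)"
      by (auto simp: linear_iff inner_add_left algebra_simps numeral_2_eq_2)
  qed (auto simp: length_3_iff algebra_simps)
qed

lemma form_of_det_form:
  "form_of (det_form a b c) [x, y, z] =
      (x \<bullet> a) * ((y \<bullet> b) * (z \<bullet> c) - (z \<bullet> b) * (y \<bullet> c))
    - (y \<bullet> a) * ((x \<bullet> b) * (z \<bullet> c) - (z \<bullet> b) * (x \<bullet> c))
    + (z \<bullet> a) * ((x \<bullet> b) * (y \<bullet> c) - (y \<bullet> b) * (x \<bullet> c))"
  by (simp add: det_form.rep_eq)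

text \<open>The sum runs over all ordered triples of basis vectors. A permutation changes the
  coefficient and the decomposable form by the same sign, so each contribution is counted six
  times.\<close>

lemma form3_expand:
  "\<Omega> = (\<Sum>a\<in>Basis. \<Sum>b\<in>Basis. \<Sum>c\<in>Basis. (form_of \<Omega> [a, b, c] / 6) *\<^sub>R det_form a b c)"
proof (rule form3_eqI)
  fix x y z
  let ?S = "\<lambda>u v w. (\<Sum>a\<in>Basis. \<Sum>b\<in>Basis. \<Sum>c\<in>Basis. (u \<bullet> a) * (v \<bullet> b) * (w \<bullet> c) * form_of \<Omega> [a, b, c])"
  have "6 * form_of \<Omega> [x, y, z] = form_of \<Omega> [x, y, z] - form_of \<Omega> [x, z, y] - form_of \<Omega> [y, x, z]
    + form_of \<Omega> [y, z, x] + form_of \<Omega> [z, x, y] - form_of \<Omega> [z, y, x]"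
    using form_of_swap[of \<Omega>] by (smt (verit))
  also have "\<dots> = ?S x y z - ?S x z y - ?S y x z + ?S y z x + ?S z x y - ?S z y x"
    by (simp only: form_of_expand[symmetric])
  also have "\<dots> = 6 * form_of (\<Sum>a\<in>Basis. \<Sum>b\<in>Basis. \<Sum>c\<in>Basis. (form_of \<Omega> [a, b, c] / 6) *\<^sub>R det_form a b c) [x, y, z]"
    unfolding form_of_sum form_of_simps form_of_det_form sum_distrib_left
      sum.distrib[symmetric] sum_subtractf[symmetric]
    by (intro sum.cong refl) (simp add: algebra_simps)
  finally show "form_of \<Omega> [x, y, z] =
    form_of (\<Sum>a\<in>Basis. \<Sum>b\<in>Basis. \<Sum>c\<in>Basis. (form_of \<Omega> [a, b, c] / 6) *\<^sub>R det_form a b c) [x, y, z]"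
    by simp
qed

text \<open>The expansion into the finitely many forms \<open>det_form a b c\<close> writes
  \<open>f\<close> as a sum of fixed vectors with bounded evaluations as coefficients.\<close>

lemma linear_form3_bounded:
  fixes f :: "'v::euclidean_space form3 \<Rightarrow> 'b::real_normed_vector"
  assumes "linear f"
  shows "bounded_linear f"
proof -
  have "f \<Omega> = (\<Sum>a\<in>Basis. \<Sum>b\<in>Basis. \<Sum>c\<in>Basis. (form_of \<Omega> [a, b, c] / 6) *\<^sub>R f (det_form a b c))" for \<Omega>
    using arg_cong[OF form3_expand, of f \<Omega>] by (simp only: linear_sum[OF assms] linear_scale[OF assms])
  then have "f = (\<lambda>\<Omega>. \<Sum>a\<in>Basis. \<Sum>b\<in>Basis. \<Sum>c\<in>Basis. (form_of \<Omega> [a, b, c] / 6) *\<^sub>R f (det_form a b c))"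
    by (rule ext)
  moreover have "bounded_linear \<dots>"
    by (intro bounded_linear_sum bounded_linear_scaleR_const bounded_linear_divide[THEN bounded_linear_compose] bounded_linear_form_of)
  ultimately show ?thesis by (rule ssubst[where P=bounded_linear])
qed

lemma has_derivative_form3:
  fixes f :: "'a::real_normed_vector \<Rightarrow> 'v::euclidean_space form3"
  assumes "\<And>a b c. ((\<lambda>x. form_of (f x) [a, b, c]) has_derivative (\<lambda>h. form_of (f' h) [a, b, c])) F"
  shows "(f has_derivative f') F"
proof -
  have "((\<lambda>x. \<Sum>a\<in>Basis. \<Sum>b\<in>Basis. \<Sum>c\<in>Basis. (form_of (f x) [a, b, c] / 6) *\<^sub>R det_form a b c) has_derivative
    (\<lambda>h. \<Sum>a\<in>Basis. \<Sum>b\<in>Basis. \<Sum>c\<in>Basis. (form_of (f' h) [a, b, c] / 6) *\<^sub>R det_form a b c)) F"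
    by (intro has_derivative_sum has_derivative_scaleR_left
      bounded_linear.has_derivative[OF bounded_linear_divide] assms)
  then show ?thesis by (simp only: form3_expand[symmetric])
qed

text \<open>In coordinates the value is linear in the form and in each of the three arguments, so
  the product rule yields four terms.\<close>

lemma has_derivative_form_of:
  fixes F :: "'a::real_normed_vector \<Rightarrow> 'v::euclidean_space form3"
  assumes F: "(F has_derivative F') (at x)" and U: "(U has_derivative U') (at x)"
    and V: "(V has_derivative V') (at x)" and W: "(W has_derivative W') (at x)"
  shows "((\<lambda>x. form_of (F x) [U x, V x, W x]) has_derivative
    (\<lambda>h. form_of (F' h) [U x, V x, W x] + form_of (F x) [U' h, V x, W x]
       + form_of (F x) [U x, V' h, W x] + form_of (F x) [U x, V x, W' h])) (at x)"
proof -
  have D: "((\<lambda>x. form_of (F x) vs) has_derivative (\<lambda>h. form_of (F' h) vs)) (at x)" for vs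
    by (rule bounded_linear.has_derivative[OF bounded_linear_form_of F])
  have I: "((\<lambda>x. U x \<bullet> a) has_derivative (\<lambda>h. U' h \<bullet> a)) (at x)"
    "((\<lambda>x. V x \<bullet> a) has_derivative (\<lambda>h. V' h \<bullet> a)) (at x)"
    "((\<lambda>x. W x \<bullet> a) has_derivative (\<lambda>h. W' h \<bullet> a)) (at x)" for a
    by (intro has_derivative_inner_left U V W)+
  have "((\<lambda>x. \<Sum>a\<in>Basis. \<Sum>b\<in>Basis. \<Sum>c\<in>Basis. (U x \<bullet> a) * (V x \<bullet> b) * (W x \<bullet> c) * form_of (F x) [a, b, c])
    has_derivative (\<lambda>h. \<Sum>a\<in>Basis. \<Sum>b\<in>Basis. \<Sum>c\<in>Basis.
       (U x \<bullet> a) * (V x \<bullet> b) * (W x \<bullet> c) * form_of (F' h) [a, b, c]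
      + (U' h \<bullet> a) * (V x \<bullet> b) * (W x \<bullet> c) * form_of (F x) [a, b, c]
      + (U x \<bullet> a) * (V' h \<bullet> b) * (W x \<bullet> c) * form_of (F x) [a, b, c]
      + (U x \<bullet> a) * (V x \<bullet> b) * (W' h \<bullet> c) * form_of (F x) [a, b, c])) (at x)"
    by (intro has_derivative_sum has_derivative_eq_rhs[OF has_derivative_mult[OF has_derivative_mult[OF
      has_derivative_mult[OF I(1,2)] I(3)] D]]) (simp add: algebra_simps)
  then show ?thesis
    by (simp only: sum.distrib form_of_expand[symmetric])
qed

subsection \<open>Wedge products\<close>

lemma wedge_length:
  assumes "\<And>us. length us \<noteq> p \<Longrightarrow> \<omega> us = 0" "\<And>us. length us \<noteq> q \<Longrightarrow> \<eta> us = 0"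
    and "length vs \<noteq> p + q"
  shows "(\<omega> \<and>\<^sub>f \<eta>) vs = 0"
  unfolding wedge_def
proof (intro sum.neutral ballI)
  fix I assume I: "I \<in> Pow {..<length vs}"
  have "length (nths vs I) = card I"
    using I by (auto simp: length_nths intro!: arg_cong[where f=card])
  moreover have "length (nths vs ({..<length vs} - I)) = card ({..<length vs} - I)"
    by (auto simp: length_nths intro!: arg_cong[where f=card])
  moreover have "card ({..<length vs} - I) = length vs - card I" "card I \<le> length vs"
    using I card_mono[of "{..<length vs}" I] by (auto simp: card_Diff_subset finite_subset)
  ultimately have "length (nths vs I) \<noteq> p \<or> length (nths vs ({..<length vs} - I)) \<noteq> q"
    using assms(3) by linarith
  then show "(- 1) ^ card {(i, j). i \<in> I \<and> j \<in> {..<length vs} - I \<and> j < i} * \<omega> (nths vs I) *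
      \<eta> (nths vs ({..<length vs} - I)) = 0"
    using assms(1,2) by auto
qed

text \<open>Vanishing on equal neighbours gives the sign change under adjacent exchanges, and these
  bring any two equal entries together.\<close>

lemma kformI_adjacent:
  assumes len: "\<And>vs. length vs \<noteq> k \<Longrightarrow> \<omega> vs = 0"
    and lin: "\<And>xs x ys. length (xs @ x # ys) = k \<Longrightarrow> linear (\<lambda>x. \<omega> (xs @ x # ys))"
    and adj: "\<And>xs x ys. length (xs @ x # x # ys) = k \<Longrightarrow> \<omega> (xs @ x # x # ys) = 0"
  shows "kform k \<omega>"
proof -
  have swap: "\<omega> (xs @ x # y # ys) = - \<omega> (xs @ y # x # ys)" for xs x y ys
  proof (cases "length (xs @ x # y # ys) = k")
    case True
    have "linear (\<lambda>u. \<omega> (xs @ u # [] @ v # ys))" for v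
      using lin[of xs undefined "v # ys"] True by simp
    moreover have "linear (\<lambda>v. \<omega> (xs @ u # [] @ v # ys))" for u
      using lin[of "xs @ [u]" undefined ys] True by simp
    moreover have "\<omega> (xs @ u # [] @ u # ys) = 0" for u
      using adj[of xs u ys] True by simp
    ultimately show ?thesis
      using alternating_swap[of \<omega> xs "[]" ys x y] by simp
  next
    case False
    then show ?thesis by (simp add: len)
  qed
  have alt: "\<omega> (xs @ x # ys @ x # zs) = 0" for xs x ys zs
  proof (induction ys arbitrary: xs)
    case Nil
    show ?case using adj len by (cases "length (xs @ x # x # zs) = k") auto
  next
    case (Cons y ys)
    have "\<omega> (xs @ x # (y # ys) @ x # zs) = - \<omega> ((xs @ [y]) @ x # ys @ x # zs)"
      using swap[of xs x y "ys @ x # zs"] by simp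
    then show ?case using Cons.IH[of "xs @ [y]"] by simp
  qed
  show ?thesis
    unfolding kform_def
  proof (intro conjI allI impI)
    fix vs :: "'a list" and i assume *: "length vs = k \<and> i < k"
    then have "linear (\<lambda>x. \<omega> (take i vs @ x # drop (Suc i) vs))"
      by (intro lin) auto
    then show "linear (\<lambda>x. \<omega> (vs[i := x]))"
      using * by (simp add: upd_conv_take_nth_drop)
  next
    fix vs :: "'a list" assume *: "length vs = k \<and> \<not> distinct vs"
    then show "\<omega> vs = 0"
      using not_distinct_decomp[of vs] alt by auto
  qed (use len in auto)
qed

lemma nths_doubleton:
  assumes "i < j" "j < length vs"
  shows "nths vs {i, j} = [vs ! i, vs ! j]"
  using assms
proof (induction vs arbitrary: i j)
  case (Cons v vs)
  have [simp]: "{k. Suc k = m} = (case m of 0 \<Rightarrow> {} | Suc l \<Rightarrow> {l})" for m :: nat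
    by (auto split: nat.splits)
  have single: "nths ws {k} = [ws ! k]" if "k < length ws" for k and ws :: "'a list"
    using that
  proof (induction ws arbitrary: k)
    case (Cons w ws)
    then show ?case
      by (cases k) (auto simp: nths_Cons cong: if_cong)
  qed simp
  obtain j' where j: "j = Suc j'" using Cons.prems by (cases j) auto
  show ?case
  proof (cases i)
    case 0
    have "{k. Suc k = i \<or> Suc k = j} = {j'}" using j 0 by auto
    then show ?thesis using 0 j single[of j' vs] Cons.prems by (simp add: nths_Cons)
  next
    case (Suc i')
    have "{k. Suc k = i \<or> Suc k = j} = {i', j'}" using j Suc by auto
    then show ?thesis using Suc j Cons.IH[of i' j'] Cons.prems by (simp add: nths_Cons)
  qed
qed simp

lemma nths_singleton:
  "i < length vs \<Longrightarrow> nths vs {i} = [vs ! i]"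
proof (induction vs arbitrary: i)
  case (Cons v vs)
  have "{k. Suc k = i} = (case i of 0 \<Rightarrow> {} | Suc l \<Rightarrow> {l})"
    by (auto split: nat.splits)
  then show ?case using Cons by (cases i) (auto simp: nths_Cons)
qed simp

lemma wedge_1:
  assumes \<omega>: "\<And>us. length us \<noteq> 1 \<Longrightarrow> \<omega> us = 0"
  shows "(\<omega> \<and>\<^sub>f \<eta>) vs =
    (\<Sum>i<length vs. (-1) ^ i * \<omega> [vs ! i] * \<eta> (nths vs ({..<length vs} - {i})))"
proof -
  let ?n = "length vs"
  let ?t = "\<lambda>I. (-1) ^ card {(i, j). i \<in> I \<and> j \<in> {..<?n} - I \<and> j < i} *
        \<omega> (nths vs I) * \<eta> (nths vs ({..<?n} - I))"
  have inj: "inj_on (\<lambda>i. {i}) {..<?n}" by simp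
  have "(\<omega> \<and>\<^sub>f \<eta>) vs = sum ?t ((\<lambda>i. {i}) ` {..<?n})"
    unfolding wedge_def
  proof (rule sum.mono_neutral_right)
    show "\<forall>I\<in>Pow {..<?n} - (\<lambda>i. {i}) ` {..<?n}. ?t I = 0"
    proof
      fix I assume I: "I \<in> Pow {..<?n} - (\<lambda>i. {i}) ` {..<?n}"
      have "length (nths vs I) = card I"
        using I by (auto simp: length_nths intro!: arg_cong[where f=card])
      moreover have "card I \<noteq> 1" using I by (auto simp: card_1_singleton_iff)
      ultimately show "?t I = 0" using \<omega> by simp
    qed
  qed auto
  also have "\<dots> = (\<Sum>i<?n. (-1) ^ i * \<omega> [vs ! i] * \<eta> (nths vs ({..<?n} - {i})))"
    unfolding sum.reindex[OF inj] o_def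
  proof (rule sum.cong)
    fix i assume i: "i \<in> {..<?n}"
    have "{(k, j). k \<in> {i} \<and> j \<in> {..<?n} - {i} \<and> j < k} = {i} \<times> {..<i}" using i by auto
    then show "?t {i} = (-1) ^ i * \<omega> [vs ! i] * \<eta> (nths vs ({..<?n} - {i}))"
      using i by (simp add: nths_singleton card_cartesian_product)
  qed simp
  finally show ?thesis .
qed

text \<open>A 2-form selects the index sets with two elements. For \<open>i < j\<close> the
  inversions are the \<open>i\<close> positions below \<open>i\<close> and the \<open>j - 1\<close>
  positions below \<open>j\<close> other than \<open>i\<close>, which explains the exponent.\<close>

lemma wedge_2:
  assumes \<omega>: "\<And>us. length us \<noteq> 2 \<Longrightarrow> \<omega> us = 0"
  shows "(\<omega> \<and>\<^sub>f \<eta>) vs =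
    (\<Sum>j<length vs. \<Sum>i<j. (-1) ^ (i + j - 1) * \<omega> [vs ! i, vs ! j] *
       \<eta> (nths vs ({..<length vs} - {i, j})))"
proof -
  let ?n = "length vs"
  let ?t = "\<lambda>I. (-1) ^ card {(i, j). i \<in> I \<and> j \<in> {..<?n} - I \<and> j < i} *
        \<omega> (nths vs I) * \<eta> (nths vs ({..<?n} - I))"
  let ?A = "SIGMA j:{..<?n}. {..<j}"
  have inj: "inj_on (\<lambda>(j, i). {i, j}) ?A" by (auto simp: inj_on_def doubleton_eq_iff)
  have "(\<omega> \<and>\<^sub>f \<eta>) vs = sum ?t ((\<lambda>(j, i). {i, j}) ` ?A)"
    unfolding wedge_def
  proof (rule sum.mono_neutral_right)
    show "\<forall>I\<in>Pow {..<?n} - (\<lambda>(j, i). {i, j}) ` ?A. ?t I = 0"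
    proof
      fix I assume I: "I \<in> Pow {..<?n} - (\<lambda>(j, i). {i, j}) ` ?A"
      have "length (nths vs I) = card I"
        using I by (auto simp: length_nths intro!: arg_cong[where f=card])
      moreover have "card I \<noteq> 2"
      proof
        assume "card I = 2"
        then obtain x y where "I = {x, y}" "x \<noteq> y" by (auto simp: card_2_iff)
        then obtain i j where ij: "I = {i, j}" "i < j"
          by (metis insert_commute linorder_neqE_nat)
        then have "I = (\<lambda>(j, i). {i, j}) (j, i)" "(j, i) \<in> ?A" using I by auto
        then show False using I by blast
      qed
      ultimately show "?t I = 0" using \<omega> by simp
    qed
  qed auto
  also have "\<dots> = (\<Sum>(j, i)\<in>?A. (-1) ^ (i + j - 1) * \<omega> [vs ! i, vs ! j] *
       \<eta> (nths vs ({..<?n} - {i, j})))"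
    unfolding sum.reindex[OF inj] o_def
  proof (rule sum.cong)
    fix p assume "p \<in> ?A"
    then obtain i j where p: "p = (j, i)" "i < j" "j < ?n" by auto
    have "{(k, l). k \<in> {i, j} \<and> l \<in> {..<?n} - {i, j} \<and> l < k} =
        {i} \<times> {..<i} \<union> {j} \<times> ({..<j} - {i})" using p by auto
    moreover have "card \<dots> = i + j - 1"
      using p by (subst card_Un_disjoint) (auto simp: card_cartesian_product card_Diff_singleton_if)
    ultimately have "card {(k, l). k \<in> {i, j} \<and> l \<in> {..<?n} - {i, j} \<and> l < k} = i + j - 1"
      by simp
    then show "?t (case p of (j, i) \<Rightarrow> {i, j}) = (case p of (j, i) \<Rightarrow>
        (-1) ^ (i + j - 1) * \<omega> [vs ! i, vs ! j] * \<eta> (nths vs ({..<?n} - {i, j})))"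
      using p by (simp add: nths_doubleton)
  qed simp
  also have "\<dots> = (\<Sum>j<?n. \<Sum>i<j. (-1) ^ (i + j - 1) * \<omega> [vs ! i, vs ! j] *
       \<eta> (nths vs ({..<?n} - {i, j})))"
    by (subst sum.Sigma) auto
  finally show ?thesis .
qed

definition det3 :: "('v \<Rightarrow> real) \<Rightarrow> ('v \<Rightarrow> real) \<Rightarrow> ('v \<Rightarrow> real) \<Rightarrow> 'v \<Rightarrow> 'v \<Rightarrow> 'v \<Rightarrow> real" where
  "det3 f g h x y z = f x * (g y * h z - g z * h y) - f y * (g x * h z - g z * h x)
     + f z * (g x * h y - g y * h x)"

lemma covector_form_length: "length vs \<noteq> 1 \<Longrightarrow> covector_form \<phi> vs = 0"
  by (auto simp: covector_form_def split: list.splits)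

lemma covector_form_single [simp]: "covector_form \<phi> [x] = \<phi> x"
  by (simp add: covector_form_def)

lemma wedge_covectors_2:
  "(covector_form \<phi> \<and>\<^sub>f covector_form \<psi>) [x, y] = \<phi> x * \<psi> y - \<phi> y * \<psi> x"
  by (subst wedge_1[OF covector_form_length]) (simp_all add: nths_Cons)

lemma wedge_covectors_2_length:
  "length vs \<noteq> 2 \<Longrightarrow> (covector_form \<phi> \<and>\<^sub>f covector_form \<psi>) vs = 0"
  by (rule wedge_length[OF covector_form_length covector_form_length]) auto

lemma wedge_covectors_3:
  "(covector_form \<phi> \<and>\<^sub>f covector_form \<psi> \<and>\<^sub>f covector_form \<rho>) [x, y, z] = det3 \<phi> \<psi> \<rho> x y z"
  by (subst wedge_2[OF wedge_covectors_2_length])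
    (simp_all add: nths_Cons wedge_covectors_2 det3_def numeral_2_eq_2 algebra_simps)

lemma wedge_covectors_3_length:
  "length vs \<noteq> 3 \<Longrightarrow> (covector_form \<phi> \<and>\<^sub>f covector_form \<psi> \<and>\<^sub>f covector_form \<rho>) vs = 0"
  by (rule wedge_length[OF wedge_covectors_2_length covector_form_length]) auto

lemma omega_plus_eq:
  "omega_plus \<alpha> [x, y, z] = det3 (\<alpha> 1) (\<alpha> 2) (\<alpha> 3) x y z + det3 (\<alpha> 4) (\<alpha> 5) (\<alpha> 6) x y z"
  "length vs \<noteq> 3 \<Longrightarrow> omega_plus \<alpha> vs = 0"
  by (simp_all add: omega_plus_def wedge_covectors_3 wedge_covectors_3_length)

lemma wedge_interior_form_of:
  "(\<iota> v (form_of \<zeta>) \<and>\<^sub>f form_of \<zeta>) [a, b, c, d, e] =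
     form_of \<zeta> [v, a, b] * form_of \<zeta> [c, d, e] - form_of \<zeta> [v, a, c] * form_of \<zeta> [b, d, e]
   + form_of \<zeta> [v, a, d] * form_of \<zeta> [b, c, e] - form_of \<zeta> [v, a, e] * form_of \<zeta> [b, c, d]
   + form_of \<zeta> [v, b, c] * form_of \<zeta> [a, d, e] - form_of \<zeta> [v, b, d] * form_of \<zeta> [a, c, e]
   + form_of \<zeta> [v, b, e] * form_of \<zeta> [a, c, d] + form_of \<zeta> [v, c, d] * form_of \<zeta> [a, b, e]
   - form_of \<zeta> [v, c, e] * form_of \<zeta> [a, b, d] + form_of \<zeta> [v, d, e] * form_of \<zeta> [a, b, c]"
  by (subst wedge_2) (simp_all add: interior_product_def form_of_length nths_Cons numeral_2_eq_2)

lemma wedge_interior_form_of_length: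
  assumes "length vs \<noteq> 5"
  shows "(\<iota> v (form_of \<zeta>) \<and>\<^sub>f form_of \<zeta>) vs = 0"
  by (rule wedge_length[of 2 _ 3]) (use assms in \<open>auto simp: interior_product_def form_of_length\<close>)

text \<open>Linearity and alternation are read off from the ten-term expansion, one term for each
  choice of two of the five arguments, by cases on the position of the varying entry.\<close>

lemma kform_wedge_interior:
  "kform 5 (\<iota> v (form_of \<zeta>) \<and>\<^sub>f form_of \<zeta>)"
proof (rule kformI_adjacent)
  fix xs ys :: "'a list" and x
  assume "length (xs @ x # ys) = 5"
  then have "length xs = 0 \<and> length ys = 4 \<or> length xs = 1 \<and> length ys = 3 \<or>
      length xs = 2 \<and> length ys = 2 \<or> length xs = 3 \<and> length ys = 1 \<or> length xs = 4 \<and> length ys = 0"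
    unfolding length_append length_Cons by presburger
  then show "linear (\<lambda>x. (\<iota> v (form_of \<zeta>) \<and>\<^sub>f form_of \<zeta>) (xs @ x # ys))"
    by (auto simp: eval_nat_numeral length_Suc_conv wedge_interior_form_of linear_iff algebra_simps)
next
  fix xs ys :: "'a list" and x
  assume "length (xs @ x # x # ys) = 5"
  then have "length xs = 0 \<and> length ys = 3 \<or> length xs = 1 \<and> length ys = 2 \<or>
      length xs = 2 \<and> length ys = 1 \<or> length xs = 3 \<and> length ys = 0"
    unfolding length_append length_Cons by presburger
  then show "(\<iota> v (form_of \<zeta>) \<and>\<^sub>f form_of \<zeta>) (xs @ x # x # ys) = 0"
    by (auto simp: eval_nat_numeral length_Suc_conv wedge_interior_form_of)
qed (simp add: wedge_interior_form_of_length)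

subsection \<open>Adapted bases\<close>

lemma linear_scaleR_const: "linear f \<Longrightarrow> linear (\<lambda>x. f x *\<^sub>R v)"
  by (simp add: linear_iff scaleR_add_left)

lemma mult_delta: "x * (if b then 1 else 0) = (if b then x else (0::real))"
  by simp

lemma inner_enum_Basis:
  assumes "bij_betw b {..<6} Basis" "j < 6" "i < (6::nat)"
  shows "b j \<bullet> b i = (if j = i then 1 else 0)"
  using assms bij_betwE[OF assms(1)] inj_on_eq_iff[OF bij_betw_imp_inj_on[OF assms(1)], of j i]
  by (auto simp: inner_Basis)

lemma basis6D:
  assumes "basis6 \<beta> e"
  shows "i < 6 \<Longrightarrow> linear (\<beta> i)" "i < 6 \<Longrightarrow> j < 6 \<Longrightarrow> \<beta> i (e j) = (if i = j then 1 else 0)"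
    "x = (\<Sum>i<6. \<beta> i x *\<^sub>R e i)"
  using assms by (auto simp: basis6_def)

text \<open>The map \<open>\<Phi>\<close>, whose coordinates in an orthonormal basis are the
  functionals \<open>\<alpha>\<close>, is injective because these span, hence bijective. The
  preimages of the orthonormal basis are dual to \<open>\<alpha>\<close>.\<close>

lemma basis6_dual:
  fixes \<alpha> :: "nat \<Rightarrow> 'v::euclidean_space \<Rightarrow>\<^sub>L real"
  assumes dim: "DIM('v) = 6" and \<alpha>: "dual_basis \<alpha>"
  obtains e where "basis6 (\<lambda>i. \<alpha> (Suc i)) e"
proof -
  obtain b :: "nat \<Rightarrow> 'v" where b: "bij_betw b {..<6} Basis"
    using ex_bij_betw_nat_finite[of "Basis :: 'v set"] dim by (auto simp: atLeast0LessThan)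
  define \<Phi> where "\<Phi> x = (\<Sum>i<6. \<alpha> (Suc i) x *\<^sub>R b i)" for x
  have lin: "linear \<Phi>"
    unfolding \<Phi>_def
    by (intro linear_compose_sum ballI linear_scaleR_const)
      (rule bounded_linear.linear[OF blinfun.bounded_linear_right])
  have coord: "\<Phi> x \<bullet> b i = \<alpha> (Suc i) x" if "i < 6" for x i
  proof -
    have "b j \<bullet> b i = (if j = i then 1 else 0)" if "j < 6" for j
      by (rule inner_enum_Basis[OF b that \<open>i < 6\<close>])
    then have "\<Phi> x \<bullet> b i = (\<Sum>j<6. \<alpha> (Suc j) x * (if j = i then 1 else 0))"
      unfolding \<Phi>_def by (simp add: inner_sum_left)
    then show ?thesis using that by (simp add: mult_delta)
  qed
  have "inj \<Phi>"
    unfolding linear_injective_0[OF lin]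
  proof (intro allI impI)
    fix x assume "\<Phi> x = 0"
    then have z: "\<alpha> (Suc i) x = 0" if "i < 6" for i
      using coord[OF that, of x] by simp
    have "blinfun_apply \<phi> x = 0" if "\<phi> \<in> span (\<alpha> ` {1..6})" for \<phi>
      using that
    proof (induction rule: span_induct_alt)
      case (step c y z')
      then obtain k where k: "k \<in> {1..6}" "y = \<alpha> k" by blast
      then have "k - 1 < 6" "y = \<alpha> (Suc (k - 1))" by auto
      then show ?case using step z by (simp add: blinfun.add_left blinfun.scaleR_left)
    qed simp
    \<comment> \<open>The inner product with \<open>x\<close> lies in the span too, hence vanishes
      at \<open>x\<close>, where its value is the squared norm.\<close>
    moreover have "blinfun_inner_left x \<in> span (\<alpha> ` {1..6})"
      using \<alpha> by (simp only: dual_basis_def UNIV_I)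
    ultimately have "blinfun_apply (blinfun_inner_left x) x = 0" by blast
    then show "x = 0" by simp
  qed
  then have "surj \<Phi>" using linear_injective_imp_surjective[OF lin] by blast
  then have "\<forall>i. \<exists>x. \<Phi> x = b i" by (metis surjD)
  then obtain e where e: "\<Phi> (e i) = b i" for i by metis
  have dual: "\<alpha> (Suc i) (e j) = (if i = j then 1 else 0)" if "i < 6" "j < 6" for i j
    using coord[OF that(1), of "e j"] inner_enum_Basis[OF b that(2,1)] by (auto simp: e)
  have "x = (\<Sum>i<6. \<alpha> (Suc i) x *\<^sub>R e i)" for x
  proof -
    have "\<Phi> (\<Sum>i<6. \<alpha> (Suc i) x *\<^sub>R e i) = \<Phi> x"
      by (simp add: linear_sum[OF lin] linear_scale[OF lin] e) (simp add: \<Phi>_def)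
    then show ?thesis using injD[OF \<open>inj \<Phi>\<close>] by metis
  qed
  moreover have "linear (\<alpha> (Suc i))" for i
    by (rule bounded_linear.linear[OF blinfun.bounded_linear_right])
  ultimately have "basis6 (\<lambda>i. \<alpha> (Suc i)) e"
    unfolding basis6_def using dual by blast
  then show thesis by (rule that)
qed

text \<open>The coframe \<open>\<beta>\<close> puts \<open>\<zeta>\<close> into the standard form.
  It replaces the group element in the definition of the orbit: the next two lemmas show that such a
  coframe exists exactly at the points of \<open>U_plus \<alpha>\<close>.\<close>

definition adapted :: "(nat \<Rightarrow> 'v::euclidean_space \<Rightarrow> real) \<Rightarrow> (nat \<Rightarrow> 'v) \<Rightarrow> 'v form3 \<Rightarrow> bool" where
  "adapted \<beta> e \<zeta> \<longleftrightarrow> basis6 \<beta> e \<and> (\<forall>x y z. form_of \<zeta> [x, y, z] =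
     det3 (\<beta> 0) (\<beta> 1) (\<beta> 2) x y z + det3 (\<beta> 3) (\<beta> 4) (\<beta> 5) x y z)"

lemma adapted_if_U_plus:
  fixes \<alpha> :: "nat \<Rightarrow> 'v::euclidean_space \<Rightarrow>\<^sub>L real"
  assumes dim: "DIM('v) = 6" and \<alpha>: "dual_basis \<alpha>" and \<zeta>: "\<zeta> \<in> U_plus \<alpha>"
  obtains \<beta> e where "adapted \<beta> e \<zeta>"
proof -
  obtain g where g: "linear g" "bij g" "form_of \<zeta> = pullback g (omega_plus \<alpha>)"
    using \<zeta> by (auto simp: U_plus_def)
  obtain e where e: "basis6 (\<lambda>i. \<alpha> (Suc i)) e"
    by (rule basis6_dual[OF dim \<alpha>])
  have gi: "g (inv g x) = x" for x
    using g(2) by (simp add: bij_def surj_f_inv_f)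
  have "x = (\<Sum>i<6. \<alpha> (Suc i) (g x) *\<^sub>R inv g (e i))" for x
  proof -
    have "g x = g (\<Sum>i<6. \<alpha> (Suc i) (g x) *\<^sub>R inv g (e i))"
      using basis6D(3)[OF e, of "g x"] by (simp add: linear_sum[OF g(1)] linear_scale[OF g(1)] gi)
    then show ?thesis using g(2) by (simp add: bij_def inj_eq)
  qed
  moreover have "linear (\<lambda>x. \<alpha> (Suc i) (g x))" if "i < 6" for i
    using linear_compose[OF g(1) basis6D(1)[OF e that]] by (simp add: o_def)
  ultimately have "basis6 (\<lambda>i x. \<alpha> (Suc i) (g x)) (\<lambda>i. inv g (e i))"
    unfolding basis6_def using basis6D(2)[OF e] by (simp only: gi) blast
  then have "adapted (\<lambda>i x. \<alpha> (Suc i) (g x)) (\<lambda>i. inv g (e i)) \<zeta>"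
    by (simp add: adapted_def g(3) pullback_def omega_plus_eq det3_def numeral_eq_Suc)
  then show thesis by (rule that)
qed

lemma U_plus_if_adapted:
  fixes \<alpha> :: "nat \<Rightarrow> 'v::euclidean_space \<Rightarrow>\<^sub>L real"
  assumes dim: "DIM('v) = 6" and \<alpha>: "dual_basis \<alpha>" and \<zeta>: "adapted \<beta> e \<zeta>"
  shows "\<zeta> \<in> U_plus \<alpha>"
proof -
  obtain d where d: "basis6 (\<lambda>i. \<alpha> (Suc i)) d"
    by (rule basis6_dual[OF dim \<alpha>])
  have e: "basis6 \<beta> e" using \<zeta> by (simp add: adapted_def)
  define g where "g x = (\<Sum>i<6. \<beta> i x *\<^sub>R d i)" for x
  have lin: "linear g"
    unfolding g_def by (intro linear_compose_sum ballI linear_scaleR_const basis6D(1)[OF e]) simp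
  have coord: "\<alpha> (Suc i) (g x) = \<beta> i x" if "i < 6" for i x
    using that by (simp add: g_def blinfun.sum_right blinfun.scaleR_right basis6D(2)[OF d] mult_delta)
  have "inj g"
    unfolding linear_injective_0[OF lin]
  proof (intro allI impI)
    fix x assume "g x = 0"
    then have "\<beta> i x = 0" if "i < 6" for i using coord[OF that, of x] by simp
    then show "x = 0" using basis6D(3)[OF e, of x] by simp
  qed
  then have "bij g" using linear_injective_imp_surjective[OF lin] by (simp add: bij_def)
  moreover have "form_of \<zeta> vs = pullback g (omega_plus \<alpha>) vs" for vs
  proof (cases "length vs = 3")
    case True
    then obtain x y z where "vs = [x, y, z]" by (auto simp: length_3_iff)
    moreover have "\<alpha> 1 (g u) = \<beta> 0 u" "\<alpha> 2 (g u) = \<beta> 1 u" "\<alpha> 3 (g u) = \<beta> 2 u"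
      "\<alpha> 4 (g u) = \<beta> 3 u" "\<alpha> 5 (g u) = \<beta> 4 u" "\<alpha> 6 (g u) = \<beta> 5 u" for u
      using coord[of _ u] by (simp_all add: numeral_eq_Suc)
    ultimately show ?thesis
      using \<zeta> by (simp add: adapted_def pullback_def omega_plus_eq det3_def)
  next
    case False
    then show ?thesis by (simp add: form_of_length pullback_def omega_plus_eq)
  qed
  ultimately show ?thesis using lin by (auto simp: U_plus_def)
qed

section \<open>The automorphism \<open>P\<close> of a form in standard form\<close>

definition reflection6 :: "(nat \<Rightarrow> 'v::real_vector \<Rightarrow> real) \<Rightarrow> (nat \<Rightarrow> 'v) \<Rightarrow> 'v \<Rightarrow> 'v" where
  "reflection6 \<beta> e x = (\<Sum>i<6. ((if i < 3 then 1 else -1) * \<beta> i x) *\<^sub>R e i)"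

lemma reflection6:
  assumes "basis6 \<beta> e"
  shows "linear (reflection6 \<beta> e)"
    and "i < 6 \<Longrightarrow> \<beta> i (reflection6 \<beta> e x) = (if i < 3 then 1 else -1) * \<beta> i x"
    and "reflection6 \<beta> e (reflection6 \<beta> e x) = x"
proof -
  show "linear (reflection6 \<beta> e)"
    unfolding reflection6_def[abs_def]
    by (intro linear_compose_sum ballI linear_scaleR_const linear_compose_scale_right[where 'b=real, unfolded real_scaleR_def]
        basis6D(1)[OF assms]) simp
  have *: "\<beta> i (reflection6 \<beta> e x) = (if i < 3 then 1 else -1) * \<beta> i x" if "i < 6" for i x
    using that by (simp add: reflection6_def linear_sum[OF basis6D(1)[OF assms]]
      linear_scale[OF basis6D(1)[OF assms]] basis6D(2)[OF assms] mult_delta)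
  then show "i < 6 \<Longrightarrow> \<beta> i (reflection6 \<beta> e x) = (if i < 3 then 1 else -1) * \<beta> i x" .
  have "reflection6 \<beta> e (reflection6 \<beta> e x) = (\<Sum>i<6. \<beta> i x *\<^sub>R e i)"
    unfolding reflection6_def[of _ _ "reflection6 \<beta> e x"] by (intro sum.cong) (auto simp: *)
  then show "reflection6 \<beta> e (reflection6 \<beta> e x) = x"
    using basis6D(3)[OF assms, of x] by simp
qed

lemma kform_linear_first:
  assumes "kform (Suc k) \<omega>"
  shows "linear (\<lambda>x. \<omega> (x # vs))"
proof (cases "length vs = k")
  case True
  then show ?thesis using kform_linear[of "[]" undefined vs \<omega>] assms by simp
next
  case False
  then show ?thesis using kform_length[OF assms] by (simp add: linear_zero)
qed

lemma kform_6_sorted: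
  assumes \<theta>: "kform 6 \<theta>"
  shows "\<theta> [b, a, c, d, e, f] = - \<theta> [a, b, c, d, e, f]"
    "\<theta> [c, a, b, d, e, f] = \<theta> [a, b, c, d, e, f]"
    "\<theta> [d, a, b, c, e, f] = - \<theta> [a, b, c, d, e, f]"
    "\<theta> [e, a, b, c, d, f] = \<theta> [a, b, c, d, e, f]"
    "\<theta> [f, a, b, c, d, e] = - \<theta> [a, b, c, d, e, f]"
proof -
  note sw = kform_swap[OF \<theta>, where xs="[]" and ys="[]", unfolded append_Nil]
    kform_swap[OF \<theta>, where xs="[u]" and ys="[]" for u, unfolded append_Nil append_Cons]
    kform_swap[OF \<theta>, where xs="[u, v]" and ys="[]" for u v, unfolded append_Nil append_Cons]
    kform_swap[OF \<theta>, where xs="[u, v, w]" and ys="[]" for u v w, unfolded append_Nil append_Cons]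
    kform_swap[OF \<theta>, where xs="[u, v, w, x]" and ys="[]" for u v w x, unfolded append_Nil append_Cons]
  show 1: "\<theta> [b, a, c, d, e, f] = - \<theta> [a, b, c, d, e, f]" for a b c d e f by (rule sw)
  show 2: "\<theta> [c, a, b, d, e, f] = \<theta> [a, b, c, d, e, f]" for a b c d e f
    using 1[of c a b d e f] sw(2)[of a c b "[d, e, f]"] by simp
  show 3: "\<theta> [d, a, b, c, e, f] = - \<theta> [a, b, c, d, e, f]" for a b c d e f
    using 2[of d a b c e f] sw(3)[of a b d c "[e, f]"] by simp
  show 4: "\<theta> [e, a, b, c, d, f] = \<theta> [a, b, c, d, e, f]" for a b c d e f
    using 3[of e a b c d f] sw(4)[of a b c e d "[f]"] by simp
  show "\<theta> [f, a, b, c, d, e] = - \<theta> [a, b, c, d, e, f]"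
    using 4[of f a b c d e] sw(5)[of a b c d f e "[]"] by simp
qed

lemma sorted_5_below_6:
  assumes "length is = 5" "sorted is" "distinct is" "set is \<subseteq> {..<6::nat}"
  shows "\<exists>i<6. is = filter (\<lambda>j. j \<noteq> i) [0..<6]"
proof -
  have "card ({..<6} - set is) = 1"
    using assms by (simp add: card_Diff_subset distinct_card)
  then obtain i where i: "{..<6} - set is = {i}" by (auto simp: card_1_singleton_iff)
  then have "i < 6" by auto
  have "set is = set (filter (\<lambda>j. j \<noteq> i) [0..<6])"
    using i assms(4) by auto
  then have "is = filter (\<lambda>j. j \<noteq> i) [0..<6]"
    using assms(2,3) by (intro sorted_distinct_set_unique)
      (auto simp: sorted_wrt_filter)
  then show ?thesis using \<open>i < 6\<close> by blast
qed

lemma upt_0_6: "[0..<6] = [0, 1, 2, 3, 4, 5]"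
  by (simp add: upt_conv_Cons)

lemma less_6_cases: "i < 6 \<Longrightarrow> i = 0 \<or> i = 1 \<or> i = 2 \<or> i = 3 \<or> i = 4 \<or> i = (5::nat)"
  by auto

lemma form_of_adapted_basis:
  assumes "adapted \<beta> e \<zeta>"
  shows "form_of \<zeta> [v, e i, e j] =
     det3 (\<beta> 0) (\<beta> 1) (\<beta> 2) v (e i) (e j) + det3 (\<beta> 3) (\<beta> 4) (\<beta> 5) v (e i) (e j)"
  using assms by (simp add: adapted_def)

text \<open>The form \<open>\<theta>\<close> is its value on the basis times the product of the six
  \<open>\<beta> i\<close>. Both sides are 5-forms in \<open>vs\<close>, so they are compared on the
  six increasing lists omitting one index \<open>i\<close>, where only \<open>\<beta> i v\<close>
  survives. The sign for \<open>3 \<le> i\<close> arises because contracting the product of all six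
  with \<open>e i\<close> passes three covectors, whereas the factors of degrees 2 and 3 on the left
  commute.\<close>

lemma adapted_wedge:
  assumes \<zeta>: "adapted \<beta> e \<zeta>" and \<theta>: "kform 6 \<theta>"
  shows "\<theta> (map e [0..<6]) * (\<iota> v (form_of \<zeta>) \<and>\<^sub>f form_of \<zeta>) vs = \<theta> (reflection6 \<beta> e v # vs)"
proof -
  have e: "basis6 \<beta> e" using \<zeta> by (simp add: adapted_def)
  let ?t = "\<theta> (map e [0..<6])"
  let ?\<omega> = "\<lambda>vs. ?t * (\<iota> v (form_of \<zeta>) \<and>\<^sub>f form_of \<zeta>) vs - \<theta> (reflection6 \<beta> e v # vs)"
  have k: "kform 5 (\<lambda>vs. \<theta> (x # vs))" for x
    unfolding kform_def
  proof (intro conjI allI impI)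
    fix vs :: "'a list" and i :: nat assume *: "length vs = 5 \<and> i < 5"
    then have "length (x # vs) = 6 \<and> Suc i < 6" by simp
    then have "linear (\<lambda>y. \<theta> ((x # vs)[Suc i := y]))"
      using \<theta> unfolding kform_def by blast
    then show "linear (\<lambda>y. \<theta> (x # vs[i := y]))" by simp
  qed (auto simp: kform_length[OF \<theta>] kform_not_distinct[OF \<theta>])
  have "?\<omega> vs = 0"
  proof (rule kform_eq_0_basis6[where \<omega>="?\<omega>" and k=5, OF _ e])
    show "kform 5 ?\<omega>"
      by (intro kform_diff kform_scale kform_wedge_interior k)
    fix "is" :: "nat list"
    assume "length is = 5" "sorted is" "distinct is" "set is \<subseteq> {..<6}"
    then obtain i where i: "i < 6" "is = filter (\<lambda>j. j \<noteq> i) [0..<6]"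
      using sorted_5_below_6 by blast
    have lin0: "linear (\<lambda>x. \<theta> (x # map e is))"
      using kform_linear_first[of 5 \<theta>] \<theta> by simp
    have "\<theta> (reflection6 \<beta> e v # map e is) =
        (\<Sum>j<6. (if j < 3 then 1 else -1) * \<beta> j v * \<theta> (e j # map e is))"
      by (simp add: reflection6_def linear_sum[OF lin0] linear_scale[OF lin0])
    also have "\<dots> = (\<Sum>j<6. if j = i then (if i < 3 then 1 else -1) * \<beta> i v * \<theta> (e i # map e is) else 0)"
    proof (intro sum.cong refl)
      fix j assume "j \<in> {..<6::nat}"
      then have "j \<noteq> i \<Longrightarrow> \<not> distinct (e j # map e is)" by (auto simp: i)
      then show "(if j < 3 then 1 else -1) * \<beta> j v * \<theta> (e j # map e is) =
        (if j = i then (if i < 3 then 1 else -1) * \<beta> i v * \<theta> (e i # map e is) else 0)"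
        using kform_not_distinct[OF \<theta>] by auto
    qed
    also have "\<dots> = (if i < 3 then 1 else -1) * \<beta> i v * \<theta> (e i # map e is)"
      using i(1) by simp
    also have "\<dots> = ?t * (\<iota> v (form_of \<zeta>) \<and>\<^sub>f form_of \<zeta>) (map e is)"
      using less_6_cases[OF i(1)] unfolding i(2) upt_0_6
      by (elim disjE) (simp_all add: wedge_interior_form_of form_of_adapted_basis[OF \<zeta>] det3_def
        basis6D(2)[OF e] kform_6_sorted[OF \<theta>, where a="e 0" and b="e 1" and c="e 2" and d="e 3" and e="e 4" and f="e 5"]
        del: One_nat_def)
    finally show "?\<omega> (map e is) = 0" by simp
  qed
  then show ?thesis by simp
qed

lemma kform_move:
  assumes \<omega>: "kform k \<omega>"
  shows "\<bar>\<omega> (xs @ x # ys)\<bar> = \<bar>\<omega> (x # xs @ ys)\<bar>"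
proof (induction xs arbitrary: ys rule: rev_induct)
  case (snoc z xs)
  have "\<bar>\<omega> ((xs @ [z]) @ x # ys)\<bar> = \<bar>\<omega> (xs @ x # z # ys)\<bar>"
    using kform_swap_adjacent[OF \<omega>, of xs z x ys] by simp
  also have "\<dots> = \<bar>\<omega> (x # xs @ z # ys)\<bar>" by (rule snoc.IH)
  finally show ?case by simp
qed simp

text \<open>Putting \<open>x\<close> in the place of the omitted \<open>e i\<close> leaves
  \<open>\<beta> i x\<close> times the value of \<open>\<theta>\<close> on the whole basis, which is
  nonzero.\<close>

lemma kform_6_nondegenerate:
  assumes \<theta>: "kform 6 \<theta>" "\<theta> \<noteq> (\<lambda>_. 0)" and e: "basis6 \<beta> e"
    and zero: "\<And>i. i < 6 \<Longrightarrow> \<theta> (x # map e (filter (\<lambda>j. j \<noteq> i) [0..<6])) = 0"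
  shows "x = 0"
proof -
  have "\<beta> i x = 0" if i: "i < 6" for i
  proof -
    let ?L = "\<lambda>y. map e [0..<i] @ y # map e [Suc i..<6]"
    have L: "?L (e i) = map e [0..<6]"
      using i upt_add_eq_append[of 0 i "6 - i"] by (simp add: upt_conv_Cons)
    have lin: "linear (\<lambda>y. \<theta> (?L y))"
      using kform_linear[of "map e [0..<i]" undefined "map e [Suc i..<6]" \<theta>] \<theta> i by simp
    have "filter (\<lambda>j. j \<noteq> i) [0..<6] = [0..<i] @ [Suc i..<6]"
    proof -
      have "[0..<6] = [0..<i] @ i # [Suc i..<6]"
        using i upt_add_eq_append[of 0 i "6 - i"] by (simp add: upt_conv_Cons)
      then have "filter (\<lambda>j. j \<noteq> i) [0..<6] = filter (\<lambda>j. j \<noteq> i) ([0..<i] @ i # [Suc i..<6])"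
        by (rule arg_cong)
      moreover have "filter (\<lambda>j. j \<noteq> i) [0..<i] = [0..<i]" "filter (\<lambda>j. j \<noteq> i) [Suc i..<6] = [Suc i..<6]"
        by (auto simp: filter_id_conv)
      ultimately show ?thesis by simp
    qed
    then have "\<theta> (?L x) = 0"
      using kform_move[OF \<theta>(1), of "map e [0..<i]" x "map e [Suc i..<6]"] zero[OF i] by simp
    moreover have "\<theta> (?L x) = (\<Sum>j<6. \<beta> j x * \<theta> (?L (e j)))"
    proof -
      have "\<theta> (?L x) = \<theta> (?L (\<Sum>j<6. \<beta> j x *\<^sub>R e j))"
        using basis6D(3)[OF e, of x] by simp
      then show ?thesis by (simp add: linear_sum[OF lin] linear_scale[OF lin])
    qed
    moreover have "(\<Sum>j<6. \<beta> j x * \<theta> (?L (e j))) = (\<Sum>j<6. if j = i then \<beta> i x * \<theta> (?L (e i)) else 0)"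
    proof (intro sum.cong refl)
      fix j assume "j \<in> {..<6::nat}"
      then have "j \<in> {0..<i} \<union> {Suc i..<6}" if "j \<noteq> i" using that by auto
      then have "j \<noteq> i \<Longrightarrow> \<not> distinct (?L (e j))" by auto
      then show "\<beta> j x * \<theta> (?L (e j)) = (if j = i then \<beta> i x * \<theta> (?L (e i)) else 0)"
        using kform_not_distinct[OF \<theta>(1)] by auto
    qed
    ultimately show ?thesis
      using i L kform_6_nonzero[OF \<theta> e] by simp
  qed
  then show ?thesis using basis6D(3)[OF e, of x] by simp
qed

text \<open>Nondegeneracy of \<open>\<theta>\<close> makes every competitor a multiple of the
  reflection, with \<open>c\<close> the ratio of the two volume factors. Both maps are involutions,
  so \<open>c * c = 1\<close>, and positivity of both factors excludes -1.\<close>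

lemma P_map_adapted:
  assumes \<zeta>: "adapted \<beta> e \<zeta>" and \<theta>: "kform 6 \<theta>" and pos: "\<theta> (map e [0..<6]) > 0"
  shows "P_map \<theta> \<zeta> = reflection6 \<beta> e"
    and "\<iota> v (form_of \<zeta>) \<and>\<^sub>f form_of \<zeta> =
      \<iota> (reflection6 \<beta> e v) (\<lambda>vs. 1 / \<theta> (map e [0..<6]) * \<theta> vs)"
proof -
  let ?R = "reflection6 \<beta> e"
  let ?a = "1 / \<theta> (map e [0..<6])"
  have e: "basis6 \<beta> e" using \<zeta> by (simp add: adapted_def)
  have ne: "\<theta> \<noteq> (\<lambda>_. 0)" using pos by force
  have lin: "linear (\<lambda>x. \<theta> (x # vs))" for vs
    using kform_linear_first[of 5 \<theta>] \<theta> by simp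
  have R: "\<iota> v (form_of \<zeta>) \<and>\<^sub>f form_of \<zeta> = \<iota> (?R v) (\<lambda>vs. ?a * \<theta> vs)" for v
    using adapted_wedge[OF \<zeta> \<theta>, of v] pos by (auto simp: interior_product_def field_simps)
  then show "\<iota> v (form_of \<zeta>) \<and>\<^sub>f form_of \<zeta> = \<iota> (?R v) (\<lambda>vs. ?a * \<theta> vs)" .
  show "P_map \<theta> \<zeta> = ?R"
    unfolding P_map_def
  proof (rule the_equality)
    show "linear ?R \<and> ?R \<circ> ?R = id \<and>
        (\<exists>a>0. \<forall>v. \<iota> v (form_of \<zeta>) \<and>\<^sub>f form_of \<zeta> = \<iota> (?R v) (\<lambda>vs. a * \<theta> vs))"
      using reflection6(1,3)[OF e] R pos by (intro conjI exI[of _ ?a]) auto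
    fix Q assume "linear Q \<and> Q \<circ> Q = id \<and>
        (\<exists>a>0. \<forall>v. \<iota> v (form_of \<zeta>) \<and>\<^sub>f form_of \<zeta> = \<iota> (Q v) (\<lambda>vs. a * \<theta> vs))"
    then obtain a where Q: "linear Q" "\<And>x. Q (Q x) = x" "a > 0"
      "\<And>v. \<iota> v (form_of \<zeta>) \<and>\<^sub>f form_of \<zeta> = \<iota> (Q v) (\<lambda>vs. a * \<theta> vs)"
      by (auto simp: fun_eq_iff)
    define c where "c = ?a / a"
    have "c > 0" using pos Q(3) by (simp add: c_def)
    have QR: "Q v = c *\<^sub>R ?R v" for v
    proof -
      have "\<theta> ((Q v - c *\<^sub>R ?R v) # vs) = 0" for vs
        using fun_cong[OF trans[OF R[of v, symmetric] Q(4)[of v]], of vs] Q(3)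
        by (simp add: interior_product_def linear_diff[OF lin] linear_scale[OF lin] c_def field_simps pos[THEN less_imp_neq, symmetric])
      then have "Q v - c *\<^sub>R ?R v = 0"
        by (intro kform_6_nondegenerate[OF \<theta> ne e])
      then show ?thesis by simp
    qed
    have "e 0 = (c * c) *\<^sub>R e 0"
      using Q(2)[of "e 0"] linear_scale[OF reflection6(1)[OF e], of c "?R (e 0)"]
      by (simp add: QR reflection6(3)[OF e])
    then have "\<beta> 0 (e 0) = \<beta> 0 ((c * c) *\<^sub>R e 0)" by (rule arg_cong)
    then have "c * c = 1"
      by (simp add: linear_scale[OF basis6D(1)[OF e]] basis6D(2)[OF e])
    then have "c = 1" using \<open>c > 0\<close> square_eq_1_iff[of c] by auto
    then show "Q = ?R" using QR by (simp add: fun_eq_iff)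
  qed
qed

text \<open>The standard form is symmetric in its two summands. Exchanging them exchanges the two
  triples of basis vectors by three transpositions, which changes the sign of
  \<open>\<theta>\<close>.\<close>

lemma adapted_positive:
  assumes \<zeta>: "adapted \<beta> e \<zeta>" and \<theta>: "kform 6 \<theta>" "\<theta> \<noteq> (\<lambda>_. 0)"
  obtains \<beta>' e' where "adapted \<beta>' e' \<zeta>" "\<theta> (map e' [0..<6]) > 0"
proof (cases "\<theta> (map e [0..<6]) > 0")
  case True
  then show ?thesis using \<zeta> that by blast
next
  case False
  have e: "basis6 \<beta> e" using \<zeta> by (simp add: adapted_def)
  let ?s = "\<lambda>i::nat. if i < 3 then i + 3 else i - 3"
  let ?e = "\<lambda>i. e (?s i)" and ?\<beta> = "\<lambda>i. \<beta> (?s i)"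
  have "x = (\<Sum>i<6. ?\<beta> i x *\<^sub>R ?e i)" for x
  proof -
    have "(\<Sum>i<6. \<beta> i x *\<^sub>R e i) = (\<Sum>i<6. ?\<beta> i x *\<^sub>R ?e i)"
      by (rule sum.reindex_bij_witness[of _ ?s ?s]) auto
    then show ?thesis using basis6D(3)[OF e, of x] by (rule trans[rotated])
  qed
  moreover have "linear (?\<beta> i)" "\<forall>j<6. ?\<beta> i (?e j) = (if i = j then 1 else 0)" if "i < 6" for i
    using that by (auto simp: basis6D(1,2)[OF e])
  ultimately have "basis6 ?\<beta> ?e" unfolding basis6_def by blast
  then have "adapted ?\<beta> ?e \<zeta>"
    using \<zeta> by (simp add: adapted_def)
  moreover have "\<theta> (map ?e [0..<6]) = - \<theta> (map e [0..<6])"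
    using kform_swap[OF \<theta>(1), of "[]" "e 3" "[e 4, e 5]" "e 0" "[e 1, e 2]"]
      kform_swap[OF \<theta>(1), of "[e 0]" "e 4" "[e 5, e 3]" "e 1" "[e 2]"]
      kform_swap[OF \<theta>(1), of "[e 0, e 1]" "e 5" "[e 3, e 4]" "e 2" "[]"]
    by (simp add: upt_0_6)
  ultimately show ?thesis
    using that[of ?\<beta> ?e] False kform_6_nonzero[OF \<theta> e] by linarith
qed

subsection \<open>Forms of given types\<close>

text \<open>The set \<open>J\<close> holds the admissible numbers \<open>r\<close> of arguments from
  the +1 eigenspace; with a set as index, sums of distributions become unions. Listing the +1
  arguments before the others loses nothing, as forms are alternating.\<close>

definition typed_forms :: "('v::euclidean_space \<Rightarrow> 'v) \<Rightarrow> nat set \<Rightarrow> 'v form3 set" where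
  "typed_forms P J = {\<Omega>. \<forall>x y z.
     (3 \<notin> J \<longrightarrow> P x = x \<longrightarrow> P y = y \<longrightarrow> P z = z \<longrightarrow> form_of \<Omega> [x, y, z] = 0) \<and>
     (2 \<notin> J \<longrightarrow> P x = x \<longrightarrow> P y = y \<longrightarrow> P z = - z \<longrightarrow> form_of \<Omega> [x, y, z] = 0) \<and>
     (1 \<notin> J \<longrightarrow> P x = x \<longrightarrow> P y = - y \<longrightarrow> P z = - z \<longrightarrow> form_of \<Omega> [x, y, z] = 0) \<and>
     (0 \<notin> J \<longrightarrow> P x = - x \<longrightarrow> P y = - y \<longrightarrow> P z = - z \<longrightarrow> form_of \<Omega> [x, y, z] = 0)}"

lemma typed_formsD:
  assumes "\<Omega> \<in> typed_forms P J"
  shows "3 \<notin> J \<Longrightarrow> P x = x \<Longrightarrow> P y = y \<Longrightarrow> P z = z \<Longrightarrow> form_of \<Omega> [x, y, z] = 0"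
    and "2 \<notin> J \<Longrightarrow> P x = x \<Longrightarrow> P y = y \<Longrightarrow> P z = - z \<Longrightarrow> form_of \<Omega> [x, y, z] = 0"
    and "1 \<notin> J \<Longrightarrow> P x = x \<Longrightarrow> P y = - y \<Longrightarrow> P z = - z \<Longrightarrow> form_of \<Omega> [x, y, z] = 0"
    and "0 \<notin> J \<Longrightarrow> P x = - x \<Longrightarrow> P y = - y \<Longrightarrow> P z = - z \<Longrightarrow> form_of \<Omega> [x, y, z] = 0"
  using assms unfolding typed_forms_def by blast+

lemma typed_forms_mono: "J \<subseteq> J' \<Longrightarrow> typed_forms P J \<subseteq> typed_forms P J'"
  unfolding typed_forms_def by blast

lemma typed_forms_add:
  "\<Omega> \<in> typed_forms P J \<Longrightarrow> \<Phi> \<in> typed_forms P J \<Longrightarrow> \<Omega> + \<Phi> \<in> typed_forms P J"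
  by (simp add: typed_forms_def)

lemma form_of_rotate: "form_of \<Omega> [y, z, x] = form_of \<Omega> [x, y, z]"
  using form_of_swap(2)[of \<Omega> y z x] form_of_swap(1)[of \<Omega> y x z] by simp

text \<open>Cyclic rotation restores the order of arguments after the eigenspaces are exchanged. The
  bound \<open>i \<le> 3\<close> keeps truncated subtraction from adding indices above 3, so that
  flipping twice gives back any \<open>J\<close> within \<open>{..3}\<close>.\<close>

lemma typed_forms_neg:
  "typed_forms (\<lambda>x. - P x) J = typed_forms P {i. i \<le> 3 \<and> 3 - i \<in> J}"
proof -
  have n: "- P x = x \<longleftrightarrow> P x = - x" "- P x = - x \<longleftrightarrow> P x = x" for x
    by (auto simp: minus_equation_iff)
  have r: "form_of \<Omega> [y, z, x] = 0 \<longleftrightarrow> form_of \<Omega> [x, y, z] = 0" for \<Omega> :: "'a form3" and x y z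
    by (simp only: form_of_rotate)
  have m: "3 \<in> {i. i \<le> 3 \<and> 3 - i \<in> J} \<longleftrightarrow> 0 \<in> J" "2 \<in> {i. i \<le> 3 \<and> 3 - i \<in> J} \<longleftrightarrow> 1 \<in> J"
    "1 \<in> {i. i \<le> 3 \<and> 3 - i \<in> J} \<longleftrightarrow> 2 \<in> J" "0 \<in> {i. i \<le> 3 \<and> 3 - i \<in> J} \<longleftrightarrow> 3 \<in> J"
    by (simp_all add: numeral_eq_Suc)
  show ?thesis
  proof (intro set_eqI iffI)
    fix \<Omega> assume "\<Omega> \<in> typed_forms (\<lambda>x. - P x) J"
    note D = typed_formsD[OF this, unfolded n]
    show "\<Omega> \<in> typed_forms P {i. i \<le> 3 \<and> 3 - i \<in> J}"
      unfolding typed_forms_def m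
    proof (intro CollectI allI conjI impI)
      fix x y z
      { assume "1 \<notin> J" "P x = x" "P y = y" "P z = - z"
        then show "form_of \<Omega> [x, y, z] = 0" using D(3)[of z x y] r[where \<Omega>=\<Omega> and x=z and y=x and z=y] by blast }
      { assume "2 \<notin> J" "P x = x" "P y = - y" "P z = - z"
        then show "form_of \<Omega> [x, y, z] = 0" using D(2)[of y z x] r[where \<Omega>=\<Omega> and x=x and y=y and z=z] by blast }
    qed (use D(1,4) in blast)+
  next
    fix \<Omega> assume "\<Omega> \<in> typed_forms P {i. i \<le> 3 \<and> 3 - i \<in> J}"
    note D = typed_formsD[OF this, unfolded m]
    show "\<Omega> \<in> typed_forms (\<lambda>x. - P x) J"
      unfolding typed_forms_def n
    proof (intro CollectI allI conjI impI)
      fix x y z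
      { assume "2 \<notin> J" "P x = - x" "P y = - y" "P z = z"
        then show "form_of \<Omega> [x, y, z] = 0" using D(3)[of z x y] r[where \<Omega>=\<Omega> and x=z and y=x and z=y] by blast }
      { assume "1 \<notin> J" "P x = - x" "P y = y" "P z = z"
        then show "form_of \<Omega> [x, y, z] = 0" using D(2)[of y z x] r[where \<Omega>=\<Omega> and x=x and y=y and z=z] by blast }
    qed (use D(1,4) in blast)+
  qed
qed

text \<open>Only the zero vector is counted for both eigenspaces, and every form vanishes there. For
  other arguments the number from \<open>V1\<close> fixes the number from \<open>V2\<close>, and
  rotations bring them into the order used in \<open>typed_forms\<close>.\<close>

lemma type_distribution_eq:
  assumes rs: "r + s = 3"
  shows "type_distribution \<theta> r s \<zeta> = typed_forms (P_map \<theta> \<zeta>) {r}"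
proof -
  let ?P = "P_map \<theta> \<zeta>"
  have V: "v \<in> V1 \<theta> \<zeta> \<longleftrightarrow> ?P v = v" "v \<in> V2 \<theta> \<zeta> \<longleftrightarrow> ?P v = - v" for v
    by (auto simp: V1_def V2_def eq_neg_iff_add_eq_0)
  have pm: "v = - v \<longleftrightarrow> v = 0" "- v = v \<longleftrightarrow> v = 0" for v :: 'a
    using scaleR_2[of v] by (auto simp: eq_neg_iff_add_eq_0 neg_eq_iff_add_eq_0)
  show ?thesis
  proof (intro set_eqI iffI)
    fix \<Omega> assume \<Omega>: "\<Omega> \<in> type_distribution \<theta> r s \<zeta>"
    have *: "form_of \<Omega> [x, y, z] = 0"
      if "?P x = x \<or> ?P x = - x" "?P y = y \<or> ?P y = - y" "?P z = z \<or> ?P z = - z"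
        "length (filter (\<lambda>v. ?P v = v) [x, y, z]) \<noteq> r" for x y z
    proof -
      have "set [x, y, z] \<subseteq> V1 \<theta> \<zeta> \<union> V2 \<theta> \<zeta>" using that(1-3) by (simp add: V)
      moreover have "length [x, y, z] = 3" by simp
      ultimately show ?thesis
        using \<Omega> that(4) unfolding type_distribution_def mem_Collect_eq V by blast
    qed
    show "\<Omega> \<in> typed_forms ?P {r}"
      unfolding typed_forms_def
    proof (intro CollectI allI conjI impI)
      fix x y z
      { assume "3 \<notin> {r}" "?P x = x" "?P y = y" "?P z = z"
        then show "form_of \<Omega> [x, y, z] = 0" using *[of x y z] by simp }
      { assume "2 \<notin> {r}" "?P x = x" "?P y = y" "?P z = - z"
        then show "form_of \<Omega> [x, y, z] = 0"
          using *[of x y z] by (cases "z = 0") (simp_all add: pm) }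
      { assume "1 \<notin> {r}" "?P x = x" "?P y = - y" "?P z = - z"
        then show "form_of \<Omega> [x, y, z] = 0"
          using *[of x y z] by (cases "y = 0 \<or> z = 0") (auto simp: pm) }
      { assume "0 \<notin> {r}" "?P x = - x" "?P y = - y" "?P z = - z"
        then show "form_of \<Omega> [x, y, z] = 0"
          using *[of x y z] by (cases "x = 0 \<or> y = 0 \<or> z = 0") (auto simp: pm) }
    qed
  next
    fix \<Omega> assume \<Omega>: "\<Omega> \<in> typed_forms ?P {r}"
    have "form_of \<Omega> [x, y, z] = 0"
      if h: "?P x = x \<or> ?P x = - x" "?P y = y \<or> ?P y = - y" "?P z = z \<or> ?P z = - z"
        "\<not> (length (filter (\<lambda>v. ?P v = v) [x, y, z]) = r \<and>
            length (filter (\<lambda>v. ?P v = - v) [x, y, z]) = s)" for x y z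
    proof (cases "x = 0 \<or> y = 0 \<or> z = 0")
      case False
      note D = typed_formsD[OF \<Omega>]
      have rr: "form_of \<Omega> [x, y, z] = form_of \<Omega> [y, z, x]" "form_of \<Omega> [x, y, z] = form_of \<Omega> [z, x, y]"
        using form_of_rotate[of \<Omega>] by auto
      from False h show ?thesis
        using rs D(1)[of x y z] D(2)[of x y z] D(3)[of x y z] D(4)[of x y z]
          D(2)[of y z x] D(3)[of y z x] D(2)[of z x y] D(3)[of z x y] rr
        by (auto simp: pm split: if_splits)
    qed auto
    then show "\<Omega> \<in> type_distribution \<theta> r s \<zeta>"
      unfolding type_distribution_def V by (auto simp: length_3_iff V)
  qed
qed

text \<open>The case distinction makes the operation total: pulling back along a map that is not
  linear need not give a form.\<close>

lift_definition pull :: "('v::euclidean_space \<Rightarrow> 'v) \<Rightarrow> 'v form3 \<Rightarrow> 'v form3" is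
  "\<lambda>f \<omega> vs. if linear f then \<omega> (map f vs) else 0"
proof -
  fix f :: "'v \<Rightarrow> 'v" and \<omega> :: "'v list \<Rightarrow> real"
  assume \<omega>: "kform 3 \<omega>"
  show "kform 3 (\<lambda>vs. if linear f then \<omega> (map f vs) else 0)"
  proof (cases "linear f")
    case True
    have "linear (\<lambda>x. \<omega> (map f (vs[i := x])))" if "length vs = 3" "i < 3" for vs i
    proof -
      have "linear (\<lambda>y. \<omega> ((map f vs)[i := y]))"
        using \<omega> that unfolding kform_def by simp
      from linear_compose[OF True this] show ?thesis by (simp add: o_def map_update)
    qed
    then show ?thesis
      using True kform_not_distinct[OF \<omega>] kform_length[OF \<omega>] by (auto simp: kform_def distinct_map)
  qed (simp add: kform_def linear_zero)
qed

lemma form_of_pull [simp]: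
  "linear f \<Longrightarrow> form_of (pull f \<Omega>) [x, y, z] = form_of \<Omega> [f x, f y, f z]"
  by (simp add: pull.rep_eq)

text \<open>Pulling back along the projections \<open>p\<close> and \<open>q\<close> isolates the
  types (3,0) and (0,3). Pulling back along \<open>P\<close> multiplies type (r,s) by (-1)^s, so
  half the sum with \<open>\<Omega>\<close> holds the types (3,0) and (1,2), half the difference the
  types (2,1) and (0,3); removing the extreme types leaves \<open>c1\<close> and
  \<open>c2\<close>.\<close>

lemma typed_forms_split:
  assumes P: "linear P" "\<And>x. P (P x) = x" and \<Omega>: "\<Omega> \<in> typed_forms P (J \<union> J')"
  shows "\<exists>\<Phi> \<Psi>. \<Phi> \<in> typed_forms P J \<and> \<Psi> \<in> typed_forms P J' \<and> \<Omega> = \<Phi> + \<Psi>"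
proof -
  define p q where "p x = (1/2) *\<^sub>R (x + P x)" and "q x = (1/2) *\<^sub>R (x - P x)" for x
  have lin: "linear p" "linear q"
    unfolding p_def[abs_def] q_def[abs_def]
    by (intro linear_compose_scale_right linear_compose_add linear_compose_sub linear_ident P(1))+
  have pq: "P x = x \<Longrightarrow> p x = x" "P x = x \<Longrightarrow> q x = 0" "P x = - x \<Longrightarrow> p x = 0" "P x = - x \<Longrightarrow> q x = x" for x
    by (simp_all add: p_def q_def flip: scaleR_2)
  define c3 c0 where "c3 = pull p \<Omega>" and "c0 = pull q \<Omega>"
  define c2 c1 where "c2 = (1/2) *\<^sub>R (\<Omega> - pull P \<Omega>) - c0" and "c1 = (1/2) *\<^sub>R (\<Omega> + pull P \<Omega>) - c3"
  note c = c3_def c2_def c1_def c0_def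
  define \<Phi> where "\<Phi> = (if 3 \<in> J then c3 else 0) + (if 2 \<in> J then c2 else 0)
    + (if 1 \<in> J then c1 else 0) + (if 0 \<in> J then c0 else 0)"
  have \<Phi>: "form_of \<Phi> [x, y, z] = (if 3 \<in> J then form_of c3 [x, y, z] else 0)
    + (if 2 \<in> J then form_of c2 [x, y, z] else 0) + (if 1 \<in> J then form_of c1 [x, y, z] else 0)
    + (if 0 \<in> J then form_of c0 [x, y, z] else 0)" for x y z
    by (simp add: \<Phi>_def)
  have v3: "form_of \<Phi> [x, y, z] = (if 3 \<in> J then form_of \<Omega> [x, y, z] else 0)"
    if "P x = x" "P y = y" "P z = z" for x y z
    unfolding \<Phi> c using that by (simp add: pq lin P(1))
  have v2: "form_of \<Phi> [x, y, z] = (if 2 \<in> J then form_of \<Omega> [x, y, z] else 0)"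
    if "P x = x" "P y = y" "P z = - z" for x y z
    unfolding \<Phi> c using that by (simp add: pq lin P(1))
  have v1: "form_of \<Phi> [x, y, z] = (if 1 \<in> J then form_of \<Omega> [x, y, z] else 0)"
    if "P x = x" "P y = - y" "P z = - z" for x y z
    unfolding \<Phi> c using that by (simp add: pq lin P(1))
  have v0: "form_of \<Phi> [x, y, z] = (if 0 \<in> J then form_of \<Omega> [x, y, z] else 0)"
    if "P x = - x" "P y = - y" "P z = - z" for x y z
    unfolding \<Phi> c using that by (simp add: pq lin P(1))
  have "\<Phi> \<in> typed_forms P J"
    unfolding typed_forms_def by (auto simp: v3 v2 v1 v0)
  moreover have "\<Omega> - \<Phi> \<in> typed_forms P J'"
    unfolding typed_forms_def using typed_formsD[OF \<Omega>] by (auto simp: v3 v2 v1 v0)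
  ultimately show ?thesis by (intro exI[of _ \<Phi>] exI[of _ "\<Omega> - \<Phi>"]) simp
qed

lemma distribution_sum_typed:
  assumes P: "linear P" "\<And>x. P (P x) = x"
    and D: "D \<zeta> = typed_forms P J" "E \<zeta> = typed_forms P J'"
  shows "(D \<oplus> E) \<zeta> = typed_forms P (J \<union> J')"
proof
  show "(D \<oplus> E) \<zeta> \<subseteq> typed_forms P (J \<union> J')"
    using typed_forms_mono[of J "J \<union> J'" P] typed_forms_mono[of J' "J \<union> J'" P]
    by (auto simp: distribution_sum_def D intro!: typed_forms_add)
  show "typed_forms P (J \<union> J') \<subseteq> (D \<oplus> E) \<zeta>"
    using typed_forms_split[OF P] by (fastforce simp: distribution_sum_def D)
qed

subsection \<open>Lie brackets of sections\<close>

text \<open>What the bracket computations use of \<open>P\<close>. The symmetry condition says that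
  \<open>\<xi>\<close> vanishes on arguments from different eigenspaces, the last two conditions
  that contraction with \<open>\<xi>\<close> is injective on each eigenspace. All of it is invariant
  under \<open>P \<mapsto> -P\<close>, so each computation is carried out for one sign only.\<close>

definition para_structure ::
    "'v::euclidean_space form3 set \<Rightarrow> ('v form3 \<Rightarrow> 'v \<Rightarrow>\<^sub>L 'v) \<Rightarrow> bool" where
  "para_structure W P \<longleftrightarrow> (\<forall>\<xi>\<in>W. P differentiable (at \<xi>) \<and> (\<forall>x. P \<xi> (P \<xi> x) = x) \<and>
     (\<forall>u v w. form_of \<xi> [P \<xi> u, v, w] = form_of \<xi> [u, P \<xi> v, w]) \<and>
     (\<forall>x. P \<xi> x = x \<longrightarrow> (\<forall>u w. P \<xi> u = u \<longrightarrow> P \<xi> w = w \<longrightarrow> form_of \<xi> [x, u, w] = 0) \<longrightarrow> x = 0) \<and>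
     (\<forall>x. P \<xi> x = - x \<longrightarrow> (\<forall>u w. P \<xi> u = - u \<longrightarrow> P \<xi> w = - w \<longrightarrow> form_of \<xi> [x, u, w] = 0) \<longrightarrow> x = 0))"

lemma para_structureD:
  assumes "para_structure W P" "\<xi> \<in> W"
  shows "P differentiable (at \<xi>)" "P \<xi> (P \<xi> x) = x"
    "form_of \<xi> [P \<xi> u, v, w] = form_of \<xi> [u, P \<xi> v, w]"
    "P \<xi> x = x \<Longrightarrow> (\<And>u w. P \<xi> u = u \<Longrightarrow> P \<xi> w = w \<Longrightarrow> form_of \<xi> [x, u, w] = 0) \<Longrightarrow> x = 0"
    "P \<xi> x = - x \<Longrightarrow> (\<And>u w. P \<xi> u = - u \<Longrightarrow> P \<xi> w = - w \<Longrightarrow> form_of \<xi> [x, u, w] = 0) \<Longrightarrow> x = 0"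
  using assms unfolding para_structure_def by blast+

lemma para_structure_neg:
  assumes "para_structure W P"
  shows "para_structure W (\<lambda>\<xi>. - P \<xi>)"
proof -
  have n: "- blinfun_apply f x = x \<longleftrightarrow> f x = - x" "- blinfun_apply f x = - x \<longleftrightarrow> f x = x"
    for f :: "'a \<Rightarrow>\<^sub>L 'a" and x by (auto simp: minus_equation_iff)
  show ?thesis
    unfolding para_structure_def
  proof (intro ballI conjI allI impI)
    fix \<xi> assume \<xi>: "\<xi> \<in> W"
    note D = para_structureD[OF assms \<xi>]
    show "(\<lambda>\<xi>. - P \<xi>) differentiable at \<xi>" using D(1) by simp
    show "(- P \<xi>) ((- P \<xi>) x) = x" for x by (simp add: blinfun.minus_left blinfun.minus_right D(2))
    show "form_of \<xi> [(- P \<xi>) u, v, w] = form_of \<xi> [u, (- P \<xi>) v, w]" for u v w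
      by (simp add: blinfun.minus_left D(3))
    show "x = 0" if "(- P \<xi>) x = x" "\<forall>u w. (- P \<xi>) u = u \<longrightarrow> (- P \<xi>) w = w \<longrightarrow> form_of \<xi> [x, u, w] = 0" for x
      using D(5)[of x] that by (simp add: blinfun.minus_left n)
    show "x = 0" if "(- P \<xi>) x = - x" "\<forall>u w. (- P \<xi>) u = - u \<longrightarrow> (- P \<xi>) w = - w \<longrightarrow> form_of \<xi> [x, u, w] = 0" for x
      using D(4)[of x] that by (simp add: blinfun.minus_left n)
  qed
qed

lemma has_derivative_blinfun_apply:
  assumes "(P has_derivative P') (at \<xi>)"
  shows "((\<lambda>\<xi>. blinfun_apply (P \<xi>) x) has_derivative (\<lambda>h. P' h x)) (at \<xi>)"
  by (rule bounded_linear.has_derivative[OF blinfun.bounded_linear_left assms])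

lemma has_derivative_zero_on:
  assumes "(f has_derivative f') (at x)" "open W" "x \<in> W" "\<And>y. y \<in> W \<Longrightarrow> f y = 0"
  shows "f' h = 0"
proof -
  have "((\<lambda>_. 0) has_derivative f') (at x)"
    by (rule has_derivative_transform_within_open[OF assms(1-3)]) (use assms(4) in auto)
  then have "f' = (\<lambda>_. 0)" by (intro has_derivative_unique[OF _ has_derivative_const])
  then show ?thesis by simp
qed

lemma para_structure_deriv:
  assumes P: "para_structure W P" and W: "open W" "\<xi> \<in> W" and P': "(P has_derivative P') (at \<xi>)"
  shows "P \<xi> (P' h x) = - P' h (P \<xi> x)"
    and "form_of h [P \<xi> u, v, w] + form_of \<xi> [P' h u, v, w] =
      form_of h [u, P \<xi> v, w] + form_of \<xi> [u, P' h v, w]"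
proof -
  from has_derivative_zero_on[OF has_derivative_diff[OF
      bounded_bilinear.FDERIV[OF bounded_bilinear_blinfun_compose P' P'] has_derivative_const[of id_blinfun]] W, of h]
  have "(P \<xi> o\<^sub>L P' h) + (P' h o\<^sub>L P \<xi>) = 0"
    using para_structureD(2)[OF P] by (simp add: blinfun_eqI)
  then have "((P \<xi> o\<^sub>L P' h) + (P' h o\<^sub>L P \<xi>)) x = 0" by simp
  then show "P \<xi> (P' h x) = - P' h (P \<xi> x)"
    by (simp add: blinfun.add_left eq_neg_iff_add_eq_0)
  have "((\<lambda>\<xi>. form_of \<xi> [P \<xi> u, v, w] - form_of \<xi> [u, P \<xi> v, w]) has_derivative
      (\<lambda>h. (form_of h [P \<xi> u, v, w] + form_of \<xi> [P' h u, v, w] + form_of \<xi> [P \<xi> u, 0, w]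
          + form_of \<xi> [P \<xi> u, v, 0])
        - (form_of h [u, P \<xi> v, w] + form_of \<xi> [0, P \<xi> v, w] + form_of \<xi> [u, P' h v, w]
          + form_of \<xi> [u, P \<xi> v, 0]))) (at \<xi>)"
    by (intro has_derivative_diff has_derivative_form_of has_derivative_ident has_derivative_const
        has_derivative_blinfun_apply P')
  from has_derivative_zero_on[OF this W, of h]
  show "form_of h [P \<xi> u, v, w] + form_of \<xi> [P' h u, v, w] =
      form_of h [u, P \<xi> v, w] + form_of \<xi> [u, P' h v, w]"
    using para_structureD(3)[OF P] by simp
qed

text \<open>Differentiate the identity saying that \<open>X\<close> vanishes on the projections of
  \<open>x, y, z\<close> to the moving eigenspaces.\<close>

lemma section_deriv:
  assumes P: "para_structure W P" and W: "open W" "\<xi> \<in> W" and P': "(P has_derivative P') (at \<xi>)"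
    and X: "(X has_derivative X') (at \<xi>)"
    and \<sigma>: "\<sigma> * \<sigma> = 1" "\<tau> * \<tau> = 1" "\<rho> * \<rho> = (1::real)"
    and zero: "\<And>\<xi> x y z. \<xi> \<in> W \<Longrightarrow> P \<xi> x = \<sigma> *\<^sub>R x \<Longrightarrow> P \<xi> y = \<tau> *\<^sub>R y \<Longrightarrow> P \<xi> z = \<rho> *\<^sub>R z \<Longrightarrow>
      form_of (X \<xi>) [x, y, z] = 0"
    and xyz: "P \<xi> x = \<sigma> *\<^sub>R x" "P \<xi> y = \<tau> *\<^sub>R y" "P \<xi> z = \<rho> *\<^sub>R z"
  shows "2 * form_of (X' h) [x, y, z] + \<sigma> * form_of (X \<xi>) [P' h x, y, z]
    + \<tau> * form_of (X \<xi>) [x, P' h y, z] + \<rho> * form_of (X \<xi>) [x, y, P' h z] = 0"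
proof -
  let ?p = "\<lambda>\<sigma> x \<xi>. x + \<sigma> *\<^sub>R blinfun_apply (P \<xi>) x"
  have proj: "P \<xi> (?p \<sigma> x \<xi>) = \<sigma> *\<^sub>R ?p \<sigma> x \<xi>" if "\<xi> \<in> W" "\<sigma> * \<sigma> = 1" for \<xi> \<sigma> x
    using that by (simp add: blinfun.add_right blinfun.scaleR_right para_structureD(2)[OF P] scaleR_add_right)
  have p2: "?p \<sigma> x \<xi> = 2 *\<^sub>R x" if "P \<xi> x = \<sigma> *\<^sub>R x" "\<sigma> * \<sigma> = 1" for \<sigma> x
    using that by (simp add: scaleR_2)
  have d: "(?p \<sigma> x has_derivative (\<lambda>h. 0 + \<sigma> *\<^sub>R P' h x)) (at \<xi>)" for \<sigma> x
    by (intro has_derivative_add has_derivative_const has_derivative_scaleR_right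
        has_derivative_blinfun_apply P')
  have "form_of (X \<eta>) [?p \<sigma> x \<eta>, ?p \<tau> y \<eta>, ?p \<rho> z \<eta>] = 0" if "\<eta> \<in> W" for \<eta>
    using that \<sigma> by (intro zero proj)
  from has_derivative_zero_on[OF has_derivative_form_of[OF X d d d] W this, of h]
  have "8 * form_of (X' h) [x, y, z] + 4 * (\<sigma> * form_of (X \<xi>) [P' h x, y, z])
    + 4 * (\<tau> * form_of (X \<xi>) [x, P' h y, z]) + 4 * (\<rho> * form_of (X \<xi>) [x, y, P' h z]) = 0"
    unfolding p2[OF xyz(1) \<sigma>(1)] p2[OF xyz(2) \<sigma>(2)] p2[OF xyz(3) \<sigma>(3)] by simp
  then show ?thesis by linarith
qed

lemma smooth_on_differentiable:
  assumes "smooth_on W X" "\<xi> \<in> W"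
  shows "(X has_derivative frechet_derivative X (at \<xi>)) (at \<xi>)"
  using assms Ck_on.simps(2)[of 0 W X] by (auto simp: smooth_on_def frechet_derivative_works[symmetric])

text \<open>The absence of type (2,1) makes the derivative of \<open>P\<close> along
  \<open>X \<xi>\<close> and \<open>Y \<xi>\<close> vanish on the -1 eigenspace. Then the terms of
  \<open>section_deriv\<close> vanish one by one for the types (3,0), (1,2) and (0,3) whenever these
  are excluded; only type (2,1) needs a cancellation between the two halves of the bracket.\<close>

lemma bracket_typed:
  assumes P: "para_structure W P" and W: "open W"
    and X: "smooth_on W X" "\<And>\<xi>. \<xi> \<in> W \<Longrightarrow> X \<xi> \<in> typed_forms (P \<xi>) J"
    and Y: "smooth_on W Y" "\<And>\<xi>. \<xi> \<in> W \<Longrightarrow> Y \<xi> \<in> typed_forms (P \<xi>) J"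
    and J: "2 \<notin> J" and \<xi>: "\<xi> \<in> W"
  shows "lie_bracket X Y \<xi> \<in> typed_forms (P \<xi>) J"
proof -
  obtain P' where P': "(P has_derivative P') (at \<xi>)"
    using para_structureD(1)[OF P \<xi>] by (auto simp: differentiable_def)
  note X' = smooth_on_differentiable[OF X(1) \<xi>] and Y' = smooth_on_differentiable[OF Y(1) \<xi>]
  let ?P = "blinfun_apply (P \<xi>)"
  have anti: "?P (P' h x) = - P' h x" if "?P x = x" for h x
    using para_structure_deriv(1)[OF P W \<xi> P', of h x] that by simp
  have anti': "?P (P' h x) = P' h x" if "?P x = - x" for h x
    using para_structure_deriv(1)[OF P W \<xi> P', of h x] that by (simp add: blinfun.minus_right)
  note rel = para_structure_deriv(2)[OF P W \<xi> P']
  have mixed: "form_of \<xi> [x, v, w] = 0" if "?P x = x" "?P v = - v" for x v w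
    using para_structureD(3)[OF P \<xi>, of x v w] that by simp
  \<comment> \<open>The differentiated symmetry relation contains two terms in \<open>\<xi>\<close>.
    One has arguments from different eigenspaces and drops out; the eigenspace of \<open>w\<close>
    decides which.\<close>
  have E1: "2 * form_of h [x, v, w] = form_of \<xi> [x, P' h v, w]"
    if "?P x = x" "?P v = - v" "?P w = w" for h x v w
  proof -
    have "form_of \<xi> [P' h x, v, w] = 0"
      using mixed[OF that(3), of "P' h x" v] anti[OF that(1), of h] by (simp add: form_of_rotate)
    then show ?thesis using rel[of h x v w] that by simp
  qed
  have E2: "2 * form_of h [x, v, w] = - form_of \<xi> [P' h x, v, w]"
    if "?P x = x" "?P v = - v" "?P w = - w" for h x v w
  proof -
    have "form_of \<xi> [x, P' h v, w] = 0"
      using mixed[OF that(1,3), of "P' h v"] form_of_swap(2)[of \<xi> x w "P' h v"] by simp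
    then show ?thesis using rel[of h x v w] that by simp
  qed
  \<comment> \<open>\<open>P' h z\<close> lies in the +1 eigenspace, where \<open>\<xi>\<close> is
    nondegenerate, and by \<open>E1\<close> its contractions are values of \<open>h\<close> of type
    (2,1).\<close>
  have van: "P' h z = 0" if h: "h \<in> typed_forms ?P J" and z: "?P z = - z" for h z
  proof (rule para_structureD(4)[OF P \<xi> anti'[OF z]])
    fix u w assume u: "?P u = u" and w: "?P w = w"
    have "form_of h [u, z, w] = 0"
      using typed_formsD(2)[OF h J u w z] form_of_swap(2)[of h u z w] by simp
    then have "form_of \<xi> [u, P' h z, w] = 0" using E1[OF u z w, of h] by simp
    then show "form_of \<xi> [P' h z, u, w] = 0" using form_of_swap(1)[of \<xi> u "P' h z" w] by simp
  qed
  have van1: "P' h x = 0" if h: "h \<in> typed_forms ?P J" and "1 \<notin> J" and x: "?P x = x" for h x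
  proof (rule para_structureD(5)[OF P \<xi> anti[OF x]])
    fix u w assume u: "?P u = - u" and w: "?P w = - w"
    show "form_of \<xi> [P' h x, u, w] = 0"
      using typed_formsD(3)[OF h \<open>1 \<notin> J\<close> x u w] E2[OF x u w, of h] by simp
  qed
  note XJ = X(2)[OF \<xi>] and YJ = Y(2)[OF \<xi>]
  note DX = section_deriv[OF P W \<xi> P' X', of _ _ _ _ _ _ "Y \<xi>"]
    and DY = section_deriv[OF P W \<xi> P' Y', of _ _ _ _ _ _ "X \<xi>"]
  let ?X' = "frechet_derivative X (at \<xi>) (Y \<xi>)" and ?Y' = "frechet_derivative Y (at \<xi>) (X \<xi>)"
  have br: "form_of (lie_bracket X Y \<xi>) [x, y, z] = form_of ?Y' [x, y, z] - form_of ?X' [x, y, z]" for x y z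
    by (simp add: lie_bracket_def)
  show ?thesis
    unfolding typed_forms_def
  proof (intro CollectI allI conjI impI)
    fix x y z
    { assume J3: "3 \<notin> J" and xyz: "?P x = x" "?P y = y" "?P z = z"
      have t: "form_of \<Omega> [P' h x, y, z] = 0" "form_of \<Omega> [x, P' h y, z] = 0" "form_of \<Omega> [x, y, P' h z] = 0"
        if "\<Omega> \<in> typed_forms ?P J" for h \<Omega>
        using typed_formsD(2)[OF that J xyz(2,3) anti[OF xyz(1)], of h]
          typed_formsD(2)[OF that J xyz(3,1) anti[OF xyz(2)], of h]
          typed_formsD(2)[OF that J xyz(1,2) anti[OF xyz(3)], of h]
        by (simp_all only: form_of_rotate[of _ y z] form_of_rotate[of _ x "P' h y" z])
      show "form_of (lie_bracket X Y \<xi>) [x, y, z] = 0"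
        using DX[of 1 1 1 x y z] DY[of 1 1 1 x y z] typed_formsD(1)[OF X(2) J3] typed_formsD(1)[OF Y(2) J3]
          xyz t[OF XJ] t[OF YJ] by (simp add: br) }
    \<comment> \<open>Here neither derivative need vanish. Moving an argument turns the fields into
      their values of type (1,2), which \<open>E2\<close> expresses through the derivatives of
      \<open>P\<close> along both fields. The result is the same for \<open>X\<close> and
      \<open>Y\<close>, so the difference is zero.\<close>
    { assume xyz: "?P x = x" "?P y = y" "?P z = - z"
      have z0: "P' (X \<xi>) z = 0" "P' (Y \<xi>) z = 0" using van XJ YJ xyz by blast+
      have e: "2 * form_of h [x, P' k y, z] = - form_of \<xi> [P' h x, P' k y, z]"
        "2 * form_of h [P' k x, y, z] = form_of \<xi> [P' h y, P' k x, z]" for h k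
        using E2[OF xyz(1) anti[OF xyz(2)] xyz(3), of h k] E2[OF xyz(2) anti[OF xyz(1)] xyz(3), of h k]
          form_of_swap(1)[of h "P' k x" y z] by simp_all
      show "form_of (lie_bracket X Y \<xi>) [x, y, z] = 0"
        using DX[of 1 1 "-1" x y z] DY[of 1 1 "-1" x y z] typed_formsD(2)[OF X(2) J] typed_formsD(2)[OF Y(2) J]
          xyz z0 e[of "X \<xi>" "Y \<xi>"] e[of "Y \<xi>" "X \<xi>"]
          form_of_swap(1)[of \<xi> "P' (X \<xi>) x" "P' (Y \<xi>) y" z]
          form_of_swap(1)[of \<xi> "P' (Y \<xi>) x" "P' (X \<xi>) y" z]
        by (simp add: br) }
    { assume J1: "1 \<notin> J" and xyz: "?P x = x" "?P y = - y" "?P z = - z"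
      show "form_of (lie_bracket X Y \<xi>) [x, y, z] = 0"
        using DX[of 1 "-1" "-1" x y z] DY[of 1 "-1" "-1" x y z]
          typed_formsD(3)[OF X(2) J1] typed_formsD(3)[OF Y(2) J1] xyz
          van[OF XJ] van[OF YJ] van1[OF XJ J1] van1[OF YJ J1] by (simp add: br) }
    { assume J0: "0 \<notin> J" and xyz: "?P x = - x" "?P y = - y" "?P z = - z"
      show "form_of (lie_bracket X Y \<xi>) [x, y, z] = 0"
        using DX[of "-1" "-1" "-1" x y z] DY[of "-1" "-1" "-1" x y z]
          typed_formsD(4)[OF X(2) J0] typed_formsD(4)[OF Y(2) J0] xyz van[OF XJ] van[OF YJ]
        by (simp add: br) }
  qed
qed

subsection \<open>Polynomial vector fields\<close>

lemma real_polynomial_function_has_derivative: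
  assumes "real_polynomial_function p"
  shows "\<exists>p'. (\<forall>x. (p has_derivative p' x) (at x)) \<and> (\<forall>v. real_polynomial_function (\<lambda>x. p' x v))"
  using assms
proof (induction p rule: real_polynomial_function.induct)
  case (linear f)
  then show ?case
    by (intro exI[of _ "\<lambda>_. f"]) (auto intro: bounded_linear_imp_has_derivative)
next
  case (const c)
  show ?case by (intro exI[of _ "\<lambda>_ _. 0"]) auto
next
  case (add f g)
  then obtain f' g' where
    "\<And>x. (f has_derivative f' x) (at x)" "\<And>v. real_polynomial_function (\<lambda>x. f' x v)"
    "\<And>x. (g has_derivative g' x) (at x)" "\<And>v. real_polynomial_function (\<lambda>x. g' x v)" by blast
  then show ?case
    by (intro exI[of _ "\<lambda>x h. f' x h + g' x h"]) (auto intro: has_derivative_add)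
next
  case (mult f g)
  then obtain f' g' where *:
    "\<And>x. (f has_derivative f' x) (at x)" "\<And>v. real_polynomial_function (\<lambda>x. f' x v)"
    "\<And>x. (g has_derivative g' x) (at x)" "\<And>v. real_polynomial_function (\<lambda>x. g' x v)" by blast
  show ?case
    by (intro exI[of _ "\<lambda>x h. f x * g' x h + f' x h * g x"] conjI allI has_derivative_mult *
        real_polynomial_function.intros(3,4) mult.hyps)
qed

text \<open>Directional derivatives of a field with polynomial coordinates have polynomial
  coordinates again, so the property reproduces itself at each order of the iteration in
  \<open>Ck_on\<close>.\<close>

lemma smooth_on_if_polynomial:
  fixes F :: "'a::real_normed_vector \<Rightarrow> 'v::euclidean_space form3"
  assumes "\<And>a b c. real_polynomial_function (\<lambda>x. form_of (F x) [a, b, c])"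
  shows "smooth_on S F"
proof -
  have main: "\<exists>F'. (\<forall>x. (F has_derivative F' x) (at x)) \<and>
      (\<forall>v a b c. real_polynomial_function (\<lambda>x. form_of (F' x v) [a, b, c]))"
    if F: "\<And>a b c. real_polynomial_function (\<lambda>x. form_of (F x) [a, b, c])" for F :: "'a \<Rightarrow> 'v form3"
  proof -
    have "\<forall>a b c. \<exists>p'. (\<forall>x. ((\<lambda>x. form_of (F x) [a, b, c]) has_derivative p' x) (at x)) \<and>
        (\<forall>v. real_polynomial_function (\<lambda>x. p' x v))"
      using real_polynomial_function_has_derivative[OF F] by blast
    then obtain p where p: "\<And>a b c x. ((\<lambda>x. form_of (F x) [a, b, c]) has_derivative p a b c x) (at x)"
      "\<And>a b c v. real_polynomial_function (\<lambda>x. p a b c x v)"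
      unfolding choice_iff by blast
    define F' where "F' x h = (\<Sum>a\<in>Basis. \<Sum>b\<in>Basis. \<Sum>c\<in>Basis. (p a b c x h / 6) *\<^sub>R det_form a b c)"
      for x h
    have "((\<lambda>x. \<Sum>a\<in>Basis. \<Sum>b\<in>Basis. \<Sum>c\<in>Basis. (form_of (F x) [a, b, c] / 6) *\<^sub>R det_form a b c)
        has_derivative F' x) (at x)" for x
      unfolding F'_def
      by (intro has_derivative_sum has_derivative_scaleR_left
        bounded_linear.has_derivative[OF bounded_linear_divide] p(1))
    then have "(F has_derivative F' x) (at x)" for x by (simp only: form3_expand[symmetric])
    moreover have "real_polynomial_function (\<lambda>x. form_of (F' x v) [a, b, c])" for v a b c
      unfolding F'_def form_of_sum form_of_simps
      by (intro real_polynomial_function_sum real_polynomial_function.intros(4) real_polynomial_function.intros(2)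
          real_polynomial_function_divide p(2) finite_Basis)
    ultimately show ?thesis by blast
  qed
  have "Ck_on k S F" if "\<And>a b c. real_polynomial_function (\<lambda>x. form_of (F x) [a, b, c])" for k and F :: "'a \<Rightarrow> 'v form3"
    using that
  proof (induction k arbitrary: F)
    case 0
    obtain F' where "\<And>x. (F has_derivative F' x) (at x)" using main[OF 0] by blast
    then show ?case
      by (auto intro!: continuous_at_imp_continuous_on has_derivative_continuous)
  next
    case (Suc k)
    obtain F' where F': "\<And>x. (F has_derivative F' x) (at x)"
      "\<And>v a b c. real_polynomial_function (\<lambda>x. form_of (F' x v) [a, b, c])" using main[OF Suc.prems] by blast
    have "frechet_derivative F (at x) = F' x" for x
      using frechet_derivative_at[OF F'(1)] by simp
    then show ?case
      using F' Suc.IH by (auto simp: differentiable_def)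
  qed
  then show ?thesis using assms by (simp add: smooth_on_def)
qed

text \<open>The infinitesimal action of an endomorphism as a derivation, that is, the derivative of
  \<open>pull\<close> at the identity in the direction \<open>M\<close>.\<close>

lift_definition act :: "('v::euclidean_space \<Rightarrow> 'v) \<Rightarrow> 'v form3 \<Rightarrow> 'v form3" is
  "\<lambda>M \<omega> vs. if linear M \<and> length vs = 3 then \<omega> [M (vs ! 0), vs ! 1, vs ! 2] +
     \<omega> [vs ! 0, M (vs ! 1), vs ! 2] + \<omega> [vs ! 0, vs ! 1, M (vs ! 2)] else 0"
proof -
  fix M :: "'v \<Rightarrow> 'v" and \<omega> :: "'v list \<Rightarrow> real"
  assume \<omega>: "kform 3 \<omega>"
  define \<Omega> where "\<Omega> = Form3 \<omega>"
  have \<Omega>: "form_of \<Omega> = \<omega>" using \<omega> by (simp add: \<Omega>_def Form3_inverse)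
  show "kform 3 (\<lambda>vs. if linear M \<and> length vs = 3 then \<omega> [M (vs ! 0), vs ! 1, vs ! 2] +
     \<omega> [vs ! 0, M (vs ! 1), vs ! 2] + \<omega> [vs ! 0, vs ! 1, M (vs ! 2)] else 0)"
  proof (cases "linear M")
    case True
    show ?thesis
      unfolding kform_def \<Omega>[symmetric]
    proof (intro conjI allI impI)
      fix vs :: "'v list" and i :: nat assume h: "length vs = 3 \<and> i < 3"
      then obtain x y z where "vs = [x, y, z]" by (auto simp: length_3_iff)
      moreover have "i = 0 \<or> i = 1 \<or> i = 2" using h by auto
      ultimately show "linear (\<lambda>u. if linear M \<and> length (vs[i := u]) = 3 then
          form_of \<Omega> [M (vs[i := u] ! 0), vs[i := u] ! 1, vs[i := u] ! 2] +
          form_of \<Omega> [vs[i := u] ! 0, M (vs[i := u] ! 1), vs[i := u] ! 2] +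
          form_of \<Omega> [vs[i := u] ! 0, vs[i := u] ! 1, M (vs[i := u] ! 2)] else 0)"
        using True by (auto simp: linear_iff algebra_simps numeral_2_eq_2)
    next
      fix vs :: "'v list" assume "length vs = 3 \<and> \<not> distinct vs"
      then obtain x y z where "vs = [x, y, z]" "x = y \<or> y = z \<or> x = z" by (auto simp: length_3_iff)
      then show "(if linear M \<and> length vs = 3 then form_of \<Omega> [M (vs ! 0), vs ! 1, vs ! 2] +
          form_of \<Omega> [vs ! 0, M (vs ! 1), vs ! 2] + form_of \<Omega> [vs ! 0, vs ! 1, M (vs ! 2)] else 0) = 0"
        using True form_of_swap(1)[of \<Omega> x "M x" z] form_of_swap(2)[of \<Omega> x "M y" y]
          form_of_rotate[of \<Omega> x y "M x"] form_of_swap(2)[of \<Omega> "M x" x y]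
        by (elim disjE) (simp_all add: length_3_iff)
    qed auto
  qed (simp add: kform_def linear_zero)
qed

lemma form_of_act:
  "linear M \<Longrightarrow> form_of (act M \<Omega>) [x, y, z] =
     form_of \<Omega> [M x, y, z] + form_of \<Omega> [x, M y, z] + form_of \<Omega> [x, y, M z]"
  by (simp add: act.rep_eq)

text \<open>At a point of the orbit \<open>K \<xi>\<close> is a multiple of \<open>P \<xi>\<close>, so its commutator with a fixed
  endomorphism \<open>T\<close> exchanges the two eigenspaces, and acting with it on \<open>\<xi>\<close> produces a
  form without components of type (3,0) and (0,3).\<close>

definition commutator_field ::
    "('v::euclidean_space form3 \<Rightarrow> 'v \<Rightarrow>\<^sub>L 'v) \<Rightarrow> ('v \<Rightarrow> 'v) \<Rightarrow> 'v form3 \<Rightarrow> 'v form3" where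
  "commutator_field K T \<xi> = act (\<lambda>x. K \<xi> (T x) - T (K \<xi> x)) \<xi>"

lemma linear_commutator:
  fixes f :: "'v::euclidean_space \<Rightarrow>\<^sub>L 'v"
  assumes "linear T"
  shows "linear (\<lambda>x. f (T x) - T (f x))"
  using linear_compose[OF assms bounded_linear.linear[OF blinfun.bounded_linear_right[of f]]]
    linear_compose[OF bounded_linear.linear[OF blinfun.bounded_linear_right[of f]] assms]
  by (intro linear_compose_sub) (simp_all add: o_def)

text \<open>Each value is bilinear in \<open>K \<xi>\<close> and \<open>\<xi>\<close>. The adjoint
  moves \<open>T\<close> onto the test vector, so that only matrix entries of \<open>K \<xi>\<close>
  occur.\<close>

lemma commutator_field_smooth:
  fixes K :: "'v::euclidean_space form3 \<Rightarrow> 'v \<Rightarrow>\<^sub>L 'v"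
  assumes T: "linear T" and K: "\<And>v u. real_polynomial_function (\<lambda>\<xi>. K \<xi> v \<bullet> u)"
  shows "smooth_on S (commutator_field K T)"
proof (rule smooth_on_if_polynomial)
  fix a b c
  let ?M = "\<lambda>\<xi> x. K \<xi> (T x) - T (K \<xi> x)"
  have M: "real_polynomial_function (\<lambda>\<xi>. ?M \<xi> x \<bullet> u)" for x u
    unfolding inner_diff_left adjoint_works[OF T, symmetric] by (intro real_polynomial_function_diff K)
  have ev: "real_polynomial_function (\<lambda>\<xi>::'v form3. form_of \<xi> vs)" for vs
    by (intro real_polynomial_function.intros(1) bounded_linear_form_of)
  have 1: "real_polynomial_function (\<lambda>\<xi>. form_of \<xi> [?M \<xi> x, y, z])" for x y z
  proof -
    have "form_of \<xi> [?M \<xi> x, y, z] = (\<Sum>b\<in>Basis. (?M \<xi> x \<bullet> b) * form_of \<xi> [b, y, z])" for \<xi>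
      using form_of_sum_arg(1)[of \<xi> "\<lambda>b. (?M \<xi> x \<bullet> b) *\<^sub>R b" Basis y z]
      by (simp only: euclidean_representation form_of_scale_arg real_scaleR_def)
    then show ?thesis
      by (simp only:) (intro real_polynomial_function_sum real_polynomial_function.intros(4) M ev finite_Basis)
  qed
  have "form_of (commutator_field K T \<xi>) [a, b, c] =
      form_of \<xi> [?M \<xi> a, b, c] + form_of \<xi> [?M \<xi> b, c, a] + form_of \<xi> [?M \<xi> c, a, b]" for \<xi>
    unfolding commutator_field_def form_of_act[OF linear_commutator[OF T]]
    using form_of_rotate[of \<xi> "?M \<xi> b" c a] form_of_rotate[of \<xi> a b "?M \<xi> c"] by linarith
  then show "real_polynomial_function (\<lambda>\<xi>. form_of (commutator_field K T \<xi>) [a, b, c])"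
    by (simp only:) (intro real_polynomial_function.intros(3) 1)
qed

lemma commutator_field_typed:
  assumes T: "linear T" and P: "para_structure W P" and \<xi>: "\<xi> \<in> W" and K: "K \<xi> = a *\<^sub>R P \<xi>"
  shows "commutator_field K T \<xi> \<in> typed_forms (P \<xi>) {1, 2}"
proof -
  let ?M = "\<lambda>x. K \<xi> (T x) - T (K \<xi> x)"
  have mixed: "form_of \<xi> [x, v, w] = 0" if "P \<xi> x = x" "P \<xi> v = - v" for x v w
    using para_structureD(3)[OF P \<xi>, of x v w] that by simp
  \<comment> \<open>Any commutator with an involution anticommutes with that involution.\<close>
  have M: "P \<xi> (?M x) = - ?M (P \<xi> x)" for x
    by (simp add: K blinfun.diff_right blinfun.scaleR_left blinfun.scaleR_right
        para_structureD(2)[OF P \<xi>] linear_scale[OF T])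
  have M1: "P \<xi> (?M x) = - ?M x" if "P \<xi> x = x" for x using M[of x] that by simp
  have M2: "P \<xi> (?M x) = ?M x" if "P \<xi> x = - x" for x
    using M[of x] linear_neg[OF linear_commutator[OF T, of "K \<xi>"], of x] that by simp
  have m2: "form_of \<xi> [v, x, w] = 0" if "P \<xi> x = x" "P \<xi> v = - v" for x v w
    using mixed[OF that, of w] form_of_swap(1)[of \<xi> x v w] by simp
  have C: "form_of (commutator_field K T \<xi>) [x, y, z] =
      form_of \<xi> [?M x, y, z] + form_of \<xi> [x, ?M y, z] + form_of \<xi> [x, y, ?M z]" for x y z
    unfolding commutator_field_def form_of_act[OF linear_commutator[OF T]] ..
  show ?thesis
    unfolding typed_forms_def
  proof (intro CollectI allI conjI impI)
    fix x y z
    { assume xyz: "P \<xi> x = x" "P \<xi> y = y" "P \<xi> z = z"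
      show "form_of (commutator_field K T \<xi>) [x, y, z] = 0"
        unfolding C mixed[OF xyz(1) M1[OF xyz(2)], of z] m2[OF xyz(2) M1[OF xyz(1)], of z]
        using mixed[OF xyz(2) M1[OF xyz(3)], of x] form_of_rotate[of \<xi> y "?M z" x] by linarith }
    { assume xyz: "P \<xi> x = - x" "P \<xi> y = - y" "P \<xi> z = - z"
      show "form_of (commutator_field K T \<xi>) [x, y, z] = 0"
        unfolding C m2[OF M2[OF xyz(2)] xyz(1), of z] mixed[OF M2[OF xyz(1)] xyz(2), of z]
        using m2[OF M2[OF xyz(3)] xyz(2), of x] form_of_rotate[of \<xi> y x "?M z"]
          form_of_rotate[of \<xi> x "?M z" y] form_of_rotate[of \<xi> y "?M z" x] by linarith }
  qed auto
qed

text \<open>At \<open>\<zeta>\<close> the field built from \<open>T\<close> has no part of type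
  (1,2), so \<open>P\<close> restricted to the +1 eigenspace is stationary along it. Along the field
  built from \<open>S\<close> that eigenspace tilts \<open>e1\<close> towards \<open>f1\<close>, and
  the (2,1) part of the first field detects this. On \<open>e1, e2, e3\<close> the bracket is
  \<open>4 * a * a\<close> times the square of \<open>form_of \<zeta> [e1, e2, e3]\<close> times
  \<open>form_of \<zeta> [f1, f2, f3]\<close>. The factor \<open>a\<close> may be negative so that
  the lemma applies to \<open>-P\<close> with the same \<open>K\<close>.\<close>

lemma not_integrable_typed:
  fixes P K :: "'v::euclidean_space form3 \<Rightarrow> 'v \<Rightarrow>\<^sub>L 'v"
  assumes P: "para_structure W P" and W: "open W" "W \<subseteq> U" and \<zeta>: "\<zeta> \<in> W"
    and K: "\<And>v u. real_polynomial_function (\<lambda>\<xi>. K \<xi> v \<bullet> u)"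
    and KP: "\<And>\<xi>. \<xi> \<in> W \<Longrightarrow> \<exists>a. a \<noteq> 0 \<and> K \<xi> = a *\<^sub>R P \<xi>"
    and e: "P \<zeta> e1 = e1" "P \<zeta> e2 = e2" "P \<zeta> e3 = e3" "form_of \<zeta> [e1, e2, e3] \<noteq> 0"
    and f: "P \<zeta> f1 = - f1" "P \<zeta> f2 = - f2" "P \<zeta> f3 = - f3" "form_of \<zeta> [f1, f2, f3] \<noteq> 0"
    and J: "{1, 2} \<subseteq> J" "3 \<notin> J"
    and D: "\<And>\<xi>. \<xi> \<in> W \<Longrightarrow> D \<xi> = typed_forms (P \<xi>) J"
  shows "\<not> integrable_distribution U D"
proof
  assume int: "integrable_distribution U D"
  \<comment> \<open>Since \<open>\<zeta>\<close> has no mixed components, \<open>T\<close> kills the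
    +1 eigenspace and sends \<open>f1\<close> to a nonzero multiple of \<open>e1\<close>;
    \<open>S\<close> does the opposite, and by alternation it also kills \<open>e2\<close> and
    \<open>e3\<close>.\<close>
  define T S where "T x = form_of \<zeta> [x, f2, f3] *\<^sub>R e1" and "S x = form_of \<zeta> [x, e2, e3] *\<^sub>R f1" for x
  have T: "linear T" and S: "linear S"
    unfolding T_def[abs_def] S_def[abs_def] by (intro linear_scaleR_const form_of_linear)+
  let ?X = "commutator_field K T" and ?Y = "commutator_field K S"
  have sec: "commutator_field K R \<xi> \<in> typed_forms (P \<xi>) {1, 2}" if "linear R" "\<xi> \<in> W" for R \<xi>
    using commutator_field_typed[OF that(1) P that(2)] KP[OF that(2)] by blast
  have "local_section D W (commutator_field K R)" if "linear R" for R
    unfolding local_section_def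
    using commutator_field_smooth[OF that K] sec[OF that] typed_forms_mono[OF J(1)] D by blast
  then have "lie_bracket ?X ?Y \<zeta> \<in> D \<zeta>"
    using int W \<zeta> T S unfolding integrable_distribution_def by blast
  then have "form_of (lie_bracket ?X ?Y \<zeta>) [e1, e2, e3] = 0"
    using typed_formsD(1) D[OF \<zeta>] J(2) e(1-3) by blast
  obtain P' where P': "(P has_derivative P') (at \<zeta>)"
    using para_structureD(1)[OF P \<zeta>] by (auto simp: differentiable_def)
  have *: "2 * form_of (frechet_derivative (commutator_field K R) (at \<zeta>) h) [e1, e2, e3] =
      - form_of (commutator_field K R \<zeta>) [P' h e1, e2, e3]
      - form_of (commutator_field K R \<zeta>) [e1, P' h e2, e3]
      - form_of (commutator_field K R \<zeta>) [e1, e2, P' h e3]" if "linear R" for R h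
    using section_deriv[OF P W(1) \<zeta> P'
        smooth_on_differentiable[OF commutator_field_smooth[OF that K] \<zeta>], of 1 1 1 e1 e2 e3 h]
      typed_formsD(1)[OF sec[OF that]] e by simp
  obtain a where a: "a \<noteq> 0" "K \<zeta> = a *\<^sub>R P \<zeta>" using KP[OF \<zeta>] by blast
  have mixed: "form_of \<zeta> [x, v, w] = 0" if "P \<zeta> x = x" "P \<zeta> v = - v" for x v w
    using para_structureD(3)[OF P \<zeta>, of x v w] that by simp
  let ?MT = "\<lambda>x. K \<zeta> (T x) - T (K \<zeta> x)" and ?MS = "\<lambda>x. K \<zeta> (S x) - S (K \<zeta> x)"
  have Tv: "T x = 0" if "P \<zeta> x = x" for x using mixed[OF that f(2)] by (simp add: T_def)
  have MT1: "?MT x = 0" if "P \<zeta> x = x" for x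
    using Tv[OF that] that by (simp add: a blinfun.scaleR_left linear_scale[OF T])
  have MT2: "?MT x = (2 * a) *\<^sub>R T x" if "P \<zeta> x = - x" for x
    using that e(1) by (simp add: a blinfun.scaleR_left linear_scale[OF T] linear_neg[OF T] T_def
        blinfun.scaleR_right algebra_simps flip: scaleR_2)
  have Sv: "S x = 0" if "P \<zeta> x = - x" for x
    using mixed[OF e(2) that, of e3] form_of_swap(1)[of \<zeta> x e2 e3] by (simp add: S_def)
  have MS2: "?MS x = 0" if "P \<zeta> x = - x" for x
    using Sv[OF that] that by (simp add: a blinfun.scaleR_left linear_scale[OF S] linear_neg[OF S])
  have MS1: "?MS x = - ((2 * a) *\<^sub>R S x)" if "P \<zeta> x = x" for x
    using that f(1) by (simp add: a blinfun.scaleR_left linear_scale[OF S] S_def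
        blinfun.scaleR_right algebra_simps flip: scaleR_2)
  note rel = para_structure_deriv(2)[OF P W(1) \<zeta> P']
  have X1: "form_of (?X \<zeta>) [x, v, w] = 0" if "P \<zeta> x = x" "P \<zeta> v = - v" "P \<zeta> w = - w" for x v w
    unfolding commutator_field_def form_of_act[OF linear_commutator[OF T]]
    using MT1[OF that(1)] MT2[OF that(2)] MT2[OF that(3)] mixed[OF that(1,3), of e1] mixed[OF that(1,2)]
      form_of_swap(2)[of \<zeta> x e1 w]
    by (simp add: T_def)
  have anti: "P \<zeta> (P' h x) = - P' h x" if "P \<zeta> x = x" for h x
    using para_structure_deriv(1)[OF P W(1) \<zeta> P', of h x] that by simp
  have E2: "2 * form_of h [x, v, w] = - form_of \<zeta> [P' h x, v, w]"
    if "P \<zeta> x = x" "P \<zeta> v = - v" "P \<zeta> w = - w" for h x v w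
  proof -
    have "form_of \<zeta> [x, P' h v, w] = 0"
      using mixed[OF that(1,3), of "P' h v"] form_of_swap(2)[of \<zeta> x w "P' h v"] by simp
    then show ?thesis using rel[of h x v w] that by simp
  qed
  have PX: "P' (?X \<zeta>) x = 0" if x: "P \<zeta> x = x" for x
    by (rule para_structureD(5)[OF P \<zeta> anti[OF x]]) (use E2[OF x, of _ _ "?X \<zeta>"] X1[OF x] in simp)
  \<comment> \<open>The factor 4 combines the -2 from \<open>E2\<close> with the
    \<open>-2 * a\<close> from \<open>MS1\<close>.\<close>
  have PY: "P' (?Y \<zeta>) x = (4 * a) *\<^sub>R S x" if x: "P \<zeta> x = x" for x
  proof -
    have "P' (?Y \<zeta>) x - (4 * a) *\<^sub>R S x = 0"
    proof (rule para_structureD(5)[OF P \<zeta>])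
      show "P \<zeta> (P' (?Y \<zeta>) x - (4 * a) *\<^sub>R S x) = - (P' (?Y \<zeta>) x - (4 * a) *\<^sub>R S x)"
        using anti[OF x] f(1) by (simp add: blinfun.diff_right blinfun.scaleR_right S_def)
      fix v w assume vw: "P \<zeta> v = - v" "P \<zeta> w = - w"
      have "form_of (?Y \<zeta>) [x, v, w] = form_of \<zeta> [?MS x, v, w]"
        unfolding commutator_field_def form_of_act[OF linear_commutator[OF S]]
        unfolding MS2[OF vw(1)] MS2[OF vw(2)] by simp
      then show "form_of \<zeta> [P' (?Y \<zeta>) x - (4 * a) *\<^sub>R S x, v, w] = 0"
        using E2[OF x vw, of "?Y \<zeta>"] unfolding MS1[OF x] by simp
    qed
    then show ?thesis by simp
  qed
  have Se: "S e1 = form_of \<zeta> [e1, e2, e3] *\<^sub>R f1" "S e2 = 0" "S e3 = 0" by (simp_all add: S_def)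
  have Xf: "form_of (?X \<zeta>) [f1, e2, e3] = 2 * a * form_of \<zeta> [f1, f2, f3] * form_of \<zeta> [e1, e2, e3]"
    unfolding commutator_field_def form_of_act[OF linear_commutator[OF T]]
      MT1[OF e(2)] MT1[OF e(3)] MT2[OF f(1)]
    by (simp add: T_def)
  have "2 * form_of (lie_bracket ?X ?Y \<zeta>) [e1, e2, e3] =
      4 * a * form_of \<zeta> [e1, e2, e3] * form_of (?X \<zeta>) [f1, e2, e3]"
    using *[OF S, of "?X \<zeta>"] *[OF T, of "?Y \<zeta>"]
    by (simp add: lie_bracket_def PX[OF e(1)] PX[OF e(2)] PX[OF e(3)] PY[OF e(1)] PY[OF e(2)] PY[OF e(3)] Se)
  then show False
    using Xf a(1) e(4) f(4) \<open>form_of (lie_bracket ?X ?Y \<zeta>) [e1, e2, e3] = 0\<close> by simp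
qed

subsection \<open>The para-complex structure on the orbit\<close>

text \<open>By nondegeneracy the six contractions of \<open>\<theta>\<close> against all basis
  vectors but one separate points. The vectors \<open>n i\<close> recover \<open>x\<close> linearly
  from them, which allows the defining equation of \<open>P\<close> to be solved by a formula
  polynomial in the form.\<close>

lemma kform_6_reconstruct:
  fixes e :: "nat \<Rightarrow> 'v::euclidean_space"
  assumes \<theta>: "kform 6 \<theta>" "\<theta> \<noteq> (\<lambda>_. 0)" and e: "basis6 \<beta> e"
  shows "\<exists>n. \<forall>x. (\<Sum>i<6. \<theta> (x # map e (filter (\<lambda>j. j \<noteq> i) [0..<6])) *\<^sub>R n i) = x"
proof -
  let ?t = "\<lambda>i x. \<theta> (x # map e (filter (\<lambda>j. j \<noteq> i) [0..<6]))"
  define N where "N x = (\<Sum>i<6. ?t i x *\<^sub>R e i)" for x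
  have lin: "linear (?t i)" for i
    using kform_linear_first[of 5 \<theta>] \<theta>(1) by simp
  have N: "linear N"
    unfolding N_def[abs_def] by (intro linear_compose_sum ballI linear_scaleR_const lin)
  have "inj N"
    unfolding linear_injective_0[OF N]
  proof (intro allI impI)
    fix x assume "N x = 0"
    show "x = 0"
    proof (rule kform_6_nondegenerate[OF \<theta> e])
      fix i :: nat assume i: "i < 6"
      have "\<beta> i (N x) = ?t i x"
        using i by (simp add: N_def linear_sum[OF basis6D(1)[OF e]] linear_scale[OF basis6D(1)[OF e]]
            basis6D(2)[OF e] mult_delta)
      then show "?t i x = 0" using \<open>N x = 0\<close> linear_0[OF basis6D(1)[OF e i]] by simp
    qed
  qed
  then obtain g where g: "linear g" "g \<circ> N = id"
    using linear_injective_left_inverse[OF N] by blast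
  have "(\<Sum>i<6. ?t i x *\<^sub>R g (e i)) = g (N x)" for x
    unfolding N_def by (simp add: linear_sum[OF g(1)] linear_scale[OF g(1)])
  moreover have "g (N x) = x" for x using fun_cong[OF g(2), of x] by simp
  ultimately show ?thesis by (intro exI[of _ "\<lambda>i. g (e i)"]) simp
qed

lemma reflection6_fixed:
  assumes e: "basis6 \<beta> e"
  shows "i < 6 \<Longrightarrow> reflection6 \<beta> e (e i) = (if i < 3 then e i else - e i)"
    and "reflection6 \<beta> e x = x \<Longrightarrow> i < 6 \<Longrightarrow> 3 \<le> i \<Longrightarrow> \<beta> i x = 0"
    and "reflection6 \<beta> e x = - x \<Longrightarrow> i < 3 \<Longrightarrow> \<beta> i x = 0"
proof -
  show "reflection6 \<beta> e (e i) = (if i < 3 then e i else - e i)" if "i < 6"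
  proof -
    have "reflection6 \<beta> e (e i) = (\<Sum>j<6. if j = i then (if i < 3 then e i else - e i) else 0)"
      unfolding reflection6_def using that by (intro sum.cong) (auto simp: basis6D(2)[OF e])
    then show ?thesis using that by simp
  qed
  show "\<beta> i x = 0" if "reflection6 \<beta> e x = x" "i < 6" "3 \<le> i"
    using reflection6(2)[OF e that(2), of x] that by simp
  show "\<beta> i x = 0" if "reflection6 \<beta> e x = - x" "i < 3"
    using reflection6(2)[OF e, of i x] that linear_neg[OF basis6D(1)[OF e], of i x] by simp
qed

lemma adapted_nondegenerate:
  assumes \<zeta>: "adapted \<beta> e \<zeta>"
  defines "R \<equiv> reflection6 \<beta> e"
  shows "R x = x \<Longrightarrow> (\<And>u w. R u = u \<Longrightarrow> R w = w \<Longrightarrow> form_of \<zeta> [x, u, w] = 0) \<Longrightarrow> x = 0"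
    and "R x = - x \<Longrightarrow> (\<And>u w. R u = - u \<Longrightarrow> R w = - w \<Longrightarrow> form_of \<zeta> [x, u, w] = 0) \<Longrightarrow> x = 0"
    and "form_of \<zeta> [R u, v, w] = form_of \<zeta> [u, R v, w]"
proof -
  have e: "basis6 \<beta> e" using \<zeta> by (simp add: adapted_def)
  have x0: "x = 0" if "\<And>i. i < 6 \<Longrightarrow> \<beta> i x = 0" for x
    using basis6D(3)[OF e, of x] that by simp
  show "x = 0" if x: "R x = x" and z: "\<And>u w. R u = u \<Longrightarrow> R w = w \<Longrightarrow> form_of \<zeta> [x, u, w] = 0"
  proof (rule x0)
    fix i :: nat assume "i < 6"
    have "form_of \<zeta> [x, e 1, e 2] = 0" "form_of \<zeta> [x, e 2, e 0] = 0" "form_of \<zeta> [x, e 0, e 1] = 0"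
      by (intro z; simp add: R_def reflection6_fixed(1)[OF e])+
    then have "\<beta> 0 x = 0" "\<beta> 1 x = 0" "\<beta> 2 x = 0"
      by (simp_all add: form_of_adapted_basis[OF \<zeta>] det3_def basis6D(2)[OF e])
    moreover have "3 \<le> i \<Longrightarrow> \<beta> i x = 0"
      using reflection6_fixed(2)[OF e _ \<open>i < 6\<close>, of x] x by (simp add: R_def)
    ultimately show "\<beta> i x = 0" using less_6_cases[OF \<open>i < 6\<close>] by auto
  qed
  show "x = 0" if x: "R x = - x" and z: "\<And>u w. R u = - u \<Longrightarrow> R w = - w \<Longrightarrow> form_of \<zeta> [x, u, w] = 0"
  proof (rule x0)
    fix i :: nat assume "i < 6"
    have "form_of \<zeta> [x, e 4, e 5] = 0" "form_of \<zeta> [x, e 5, e 3] = 0" "form_of \<zeta> [x, e 3, e 4] = 0"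
      by (intro z; simp add: R_def reflection6_fixed(1)[OF e])+
    then have "\<beta> 3 x = 0" "\<beta> 4 x = 0" "\<beta> 5 x = 0"
      by (simp_all add: form_of_adapted_basis[OF \<zeta>] det3_def basis6D(2)[OF e])
    moreover have "i < 3 \<Longrightarrow> \<beta> i x = 0"
      using reflection6_fixed(3)[OF e, of x i] x by (simp add: R_def)
    ultimately show "\<beta> i x = 0" using less_6_cases[OF \<open>i < 6\<close>] by auto
  qed
  have A: "form_of \<zeta> [x, y, z] = det3 (\<beta> 0) (\<beta> 1) (\<beta> 2) x y z + det3 (\<beta> 3) (\<beta> 4) (\<beta> 5) x y z" for x y z
    using \<zeta> by (simp add: adapted_def)
  show "form_of \<zeta> [R u, v, w] = form_of \<zeta> [u, R v, w]"
    unfolding A by (simp add: R_def reflection6(2)[OF e] det3_def algebra_simps)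
qed

lemma linear_wedge_interior: "linear (\<lambda>v. (\<iota> v (form_of \<xi>) \<and>\<^sub>f form_of \<xi>) vs)"
proof -
  have "linear (\<lambda>v. c * form_of \<xi> (v # us) * d)" for c d us
    using linear_compose_scale_right[OF kform_linear_first[of 2 "form_of \<xi>" us], of "c * d"] kform_form_of[of \<xi>]
    by (simp add: mult_ac)
  then show ?thesis
    unfolding wedge_def interior_product_def by (intro linear_compose_sum ballI)
qed

lemma polynomial_wedge_interior:
  fixes v :: "'v::euclidean_space"
  shows "real_polynomial_function (\<lambda>\<xi>. (\<iota> v (form_of \<xi>) \<and>\<^sub>f form_of \<xi>) vs)"
  unfolding wedge_def interior_product_def
  by (intro real_polynomial_function_sum real_polynomial_function.intros(4)
      real_polynomial_function.intros(2) real_polynomial_function.intros(1) bounded_linear_form_of) simp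

lemma differentiable_if_polynomial:
  "real_polynomial_function p \<Longrightarrow> p differentiable (at x)"
  using real_polynomial_function_has_derivative[of p] by (auto simp: differentiable_def)

text \<open>\<open>K \<xi> v\<close> solves the defining equation with \<open>\<theta>\<close>
  itself as volume form, for every \<open>\<xi>\<close>. On the orbit it is
  \<open>a *\<^sub>R P_map \<theta> \<xi> v\<close>, where \<open>a\<close> is the volume factor
  from the definition of \<open>P_map\<close>, and only this scalar has to be divided out.\<close>

lemma orbit_para_structure:
  fixes \<alpha> :: "nat \<Rightarrow> 'v::euclidean_space \<Rightarrow>\<^sub>L real"
  assumes dim: "DIM('v) = 6" and \<alpha>: "dual_basis \<alpha>" and \<theta>: "kform 6 \<theta>" "\<theta> \<noteq> (\<lambda>_. 0)"
  shows "\<exists>K P. (\<forall>v u. real_polynomial_function (\<lambda>\<xi>. blinfun_apply (K \<xi>) v \<bullet> u)) \<and>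
    (\<forall>\<xi>\<in>U_plus \<alpha>. (\<exists>a>0. K \<xi> = a *\<^sub>R P \<xi>) \<and> blinfun_apply (P \<xi>) = P_map \<theta> \<xi>) \<and>
    para_structure (U_plus \<alpha>) P"
proof -
  obtain d where d: "basis6 (\<lambda>i. \<alpha> (Suc i)) d" by (rule basis6_dual[OF dim \<alpha>])
  let ?L = "\<lambda>i. map d (filter (\<lambda>j. j \<noteq> i) [0..<6])"
  obtain n where n: "\<And>x. (\<Sum>i<6. \<theta> (x # ?L i) *\<^sub>R n i) = x"
    using kform_6_reconstruct[OF \<theta> d] by blast
  let ?w = "\<lambda>\<xi> v i. (\<iota> v (form_of \<xi>) \<and>\<^sub>f form_of \<xi>) (?L i)"
  define K :: "'v form3 \<Rightarrow> 'v \<Rightarrow>\<^sub>L 'v" where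
    "K \<xi> = (\<Sum>b\<in>Basis. \<Sum>i<6. ?w \<xi> b i *\<^sub>R (blinfun_scaleR_left (n i) o\<^sub>L blinfun_inner_left b))" for \<xi>
  have Kv: "K \<xi> v = (\<Sum>i<6. ?w \<xi> v i *\<^sub>R n i)" for \<xi> v
  proof -
    have "?w \<xi> v i = (\<Sum>b\<in>Basis. (v \<bullet> b) * ?w \<xi> b i)" for i
    proof -
      have "?w \<xi> v i = ?w \<xi> (\<Sum>b\<in>Basis. (v \<bullet> b) *\<^sub>R b) i" by (simp only: euclidean_representation)
      then show ?thesis
        by (simp only: linear_sum[OF linear_wedge_interior] linear_scale[OF linear_wedge_interior]
          real_scaleR_def)
    qed
    then have "(\<Sum>i<6. ?w \<xi> v i *\<^sub>R n i) = (\<Sum>i<6. \<Sum>b\<in>Basis. ((v \<bullet> b) * ?w \<xi> b i) *\<^sub>R n i)"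
      by (simp add: scaleR_sum_left)
    also have "\<dots> = (\<Sum>b\<in>Basis. \<Sum>i<6. ((v \<bullet> b) * ?w \<xi> b i) *\<^sub>R n i)" by (rule sum.swap)
    also have "\<dots> = K \<xi> v"
      by (simp add: K_def blinfun.sum_left blinfun.scaleR_left mult.commute)
    finally show ?thesis by simp
  qed
  have Kpoly: "real_polynomial_function (\<lambda>\<xi>. K \<xi> v \<bullet> u)" for v u
    unfolding Kv inner_sum_left inner_scaleR_left
    by (intro real_polynomial_function_sum real_polynomial_function.intros(4)
      real_polynomial_function.intros(2) polynomial_wedge_interior) simp
  obtain b :: 'v where b: "b \<in> Basis" using nonempty_Basis by blast
  \<comment> \<open>On the orbit \<open>K \<xi>\<close> squares to \<open>a * a\<close> times the
    identity and \<open>b\<close> is a unit vector, so \<open>g \<xi> = a * a\<close>. This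
    expresses the factor without choosing an adapted basis, which would not depend visibly smoothly
    on \<open>\<xi>\<close>.\<close>
  define g where "g \<xi> = K \<xi> (K \<xi> b) \<bullet> b" for \<xi>
  define P where "P \<xi> = (g \<xi> powr (-1/2)) *\<^sub>R K \<xi>" for \<xi>
  have gpoly: "real_polynomial_function g"
  proof -
    have "K \<xi> (K \<xi> b) = K \<xi> (\<Sum>c\<in>Basis. (K \<xi> b \<bullet> c) *\<^sub>R c)" for \<xi>
      by (simp only: euclidean_representation)
    then have "g = (\<lambda>\<xi>. \<Sum>c\<in>Basis. (K \<xi> b \<bullet> c) * (K \<xi> c \<bullet> b))"
      by (simp add: g_def fun_eq_iff blinfun.sum_right blinfun.scaleR_right inner_sum_left)
    then show ?thesis
      by (simp only:) (intro real_polynomial_function_sum real_polynomial_function.intros(4) Kpoly finite_Basis)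
  qed
  have Kdiff: "K differentiable (at \<xi>)" for \<xi>
    unfolding K_def[abs_def]
    by (intro differentiable_sum ballI differentiable_scaleR differentiable_const
        differentiable_if_polynomial polynomial_wedge_interior) simp_all
  have main: "\<exists>a>0. K \<xi> = a *\<^sub>R P \<xi> \<and> blinfun_apply (P \<xi>) = P_map \<theta> \<xi> \<and> g \<xi> > 0 \<and>
      (\<exists>\<beta> e. adapted \<beta> e \<xi> \<and> P_map \<theta> \<xi> = reflection6 \<beta> e)" if U: "\<xi> \<in> U_plus \<alpha>" for \<xi>
  proof -
    obtain \<beta>' e' where "adapted \<beta>' e' \<xi>" by (rule adapted_if_U_plus[OF dim \<alpha> U])
    then obtain \<beta> e where ad: "adapted \<beta> e \<xi>" and pos: "\<theta> (map e [0..<6]) > 0"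
      by (rule adapted_positive[OF _ \<theta>])
    have e: "basis6 \<beta> e" using ad by (simp add: adapted_def)
    define a where "a = 1 / \<theta> (map e [0..<6])"
    have "a > 0" using pos by (simp add: a_def)
    let ?R = "reflection6 \<beta> e"
    have KR: "K \<xi> v = a *\<^sub>R ?R v" for v
    proof -
      have "?w \<xi> v i = a * \<theta> (?R v # ?L i)" for i
        unfolding P_map_adapted(2)[OF ad \<theta>(1) pos] by (simp add: interior_product_def a_def)
      then have "K \<xi> v = (\<Sum>i<6. (a * \<theta> (?R v # ?L i)) *\<^sub>R n i)"
        by (simp only: Kv)
      also have "\<dots> = a *\<^sub>R (\<Sum>i<6. \<theta> (?R v # ?L i) *\<^sub>R n i)"
        by (simp add: scaleR_sum_right)
      finally show ?thesis by (simp only: n)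
    qed
    have "g \<xi> = a * a"
      using b by (simp add: g_def KR linear_scale[OF reflection6(1)[OF e]] reflection6(3)[OF e] inner_Basis)
    then have "g \<xi> powr (-1/2) = 1 / a"
      using \<open>a > 0\<close> by (simp add: powr_minus_divide powr_half_sqrt flip: power2_eq_square)
    then have PR: "P \<xi> v = ?R v" for v
      using \<open>a > 0\<close> by (simp add: P_def blinfun.scaleR_left KR)
    then have "K \<xi> = a *\<^sub>R P \<xi>"
      by (intro blinfun_eqI) (simp add: KR blinfun.scaleR_left)
    moreover have "blinfun_apply (P \<xi>) = P_map \<theta> \<xi>"
      using PR by (simp add: P_map_adapted(1)[OF ad \<theta>(1) pos] fun_eq_iff)
    ultimately show ?thesis
      using \<open>a > 0\<close> \<open>g \<xi> = a * a\<close> ad P_map_adapted(1)[OF ad \<theta>(1) pos] by (intro exI[of _ a]) auto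
  qed
  have "para_structure (U_plus \<alpha>) P"
    unfolding para_structure_def
  proof (rule ballI)
    fix \<xi> assume "\<xi> \<in> U_plus \<alpha>"
    then obtain \<beta> e where ad: "adapted \<beta> e \<xi>" and PR: "blinfun_apply (P \<xi>) = reflection6 \<beta> e" and "g \<xi> > 0"
      using main by fastforce
    have e: "basis6 \<beta> e" using ad by (simp add: adapted_def)
    obtain g' where g': "(g has_derivative g') (at \<xi>)"
      using differentiable_if_polynomial[OF gpoly] by (auto simp: differentiable_def)
    have "((\<lambda>t. t powr (-1/2)) has_derivative (*) ((-1/2) * g \<xi> powr (-1/2 - 1))) (at (g \<xi>))"
      using has_real_derivative_powr[OF \<open>g \<xi> > 0\<close>, of "-1/2"] by (simp only: has_field_derivative_def)
    from has_derivative_compose[OF g' this]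
    have "(\<lambda>\<xi>. g \<xi> powr (-1/2)) differentiable (at \<xi>)" by (auto simp: differentiable_def)
    then have "P differentiable (at \<xi>)"
      unfolding P_def[abs_def] by (intro differentiable_scaleR Kdiff)
    then show "P differentiable (at \<xi>) \<and> (\<forall>x. P \<xi> (P \<xi> x) = x) \<and>
     (\<forall>u v w. form_of \<xi> [P \<xi> u, v, w] = form_of \<xi> [u, P \<xi> v, w]) \<and>
     (\<forall>x. P \<xi> x = x \<longrightarrow> (\<forall>u w. P \<xi> u = u \<longrightarrow> P \<xi> w = w \<longrightarrow> form_of \<xi> [x, u, w] = 0) \<longrightarrow> x = 0) \<and>
     (\<forall>x. P \<xi> x = - x \<longrightarrow> (\<forall>u w. P \<xi> u = - u \<longrightarrow> P \<xi> w = - w \<longrightarrow> form_of \<xi> [x, u, w] = 0) \<longrightarrow> x = 0)"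
      unfolding PR using reflection6(3)[OF e] adapted_nondegenerate[OF ad] by blast
  qed
  then show ?thesis
    using Kpoly main by blast
qed

subsection \<open>The orbit has interior points\<close>

lemma linear_blinfun: "linear (blinfun_apply f)"
  by (rule bounded_linear.linear[OF blinfun.bounded_linear_right])

lemma inj_if_near_id:
  fixes g :: "'v::real_normed_vector \<Rightarrow>\<^sub>L 'v"
  assumes "norm (id_blinfun - g) < 1"
  shows "inj g"
  unfolding linear_injective_0[OF linear_blinfun]
proof (intro allI impI)
  fix x assume "g x = 0"
  then have "norm x \<le> norm (id_blinfun - g) * norm x"
    using norm_blinfun[of "id_blinfun - g" x] by (simp add: blinfun.diff_left)
  then show "x = 0"
    using assms mult_strict_right_mono[of "norm (id_blinfun - g)" 1 "norm x"] by fastforce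
qed

lemma sorted_3_below_6:
  assumes "length is = 3" "sorted is" "distinct is" "set is \<subseteq> {..<6::nat}"
  shows "is \<in> {[0,1,2],[0,1,3],[0,1,4],[0,1,5],[0,2,3],[0,2,4],[0,2,5],[0,3,4],[0,3,5],[0,4,5],
    [1,2,3],[1,2,4],[1,2,5],[1,3,4],[1,3,5],[1,4,5],[2,3,4],[2,3,5],[2,4,5],[3,4,5]}"
proof -
  obtain i j k where ijk: "is = [i, j, k]" using assms(1) by (auto simp: length_3_iff)
  then have "i < j" "j < k" "k < 6" using assms by auto
  then have "i \<in> {0,1,2,3}" "j \<in> {1,2,3,4}" "k \<in> {2,3,4,5}" by auto
  then show ?thesis
    using \<open>i < j\<close> \<open>j < k\<close> unfolding ijk by (elim insertE emptyE) simp_all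
qed

text \<open>This makes the orbit map a submersion at the standard form.\<close>

lemma act_right_inverse:
  fixes b :: "nat \<Rightarrow> 'v::euclidean_space"
  assumes b: "bij_betw b {..<6} Basis"
  shows "\<exists>G :: 'v form3 \<Rightarrow> 'v \<Rightarrow>\<^sub>L 'v. linear G \<and>
    (\<forall>\<Omega>. act (blinfun_apply (G \<Omega>)) (det_form (b 0) (b 1) (b 2) + det_form (b 3) (b 4) (b 5)) = \<Omega>)"
proof -
  define E where "E c d = (blinfun_scaleR_left (b d) o\<^sub>L blinfun_inner_left (b c))" for c d
  have bb: "i < 6 \<Longrightarrow> j < 6 \<Longrightarrow> b i \<bullet> b j = (if i = j then 1 else 0)" for i j
    by (rule inner_enum_Basis[OF b])
  have E: "E c d x = (x \<bullet> b c) *\<^sub>R b d" for c d x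
    by (simp add: E_def)
  let ?o = "\<lambda>\<Omega> i j k. form_of \<Omega> [b i, b j, b k]"
  \<comment> \<open>As a derivation, \<open>E c d\<close> replaces the covector dual to
    \<open>b d\<close> by the one dual to \<open>b c\<close>. Each of the 20 increasing triples
    arises once: 2 by rescaling a summand, 9 from each summand by replacing one factor. The minus
    signs occur where the new covector passes an odd number of factors on its way to increasing
    order.\<close>
  define G where "G \<Omega> = ?o \<Omega> 0 1 2 *\<^sub>R E 0 0 + ?o \<Omega> 3 4 5 *\<^sub>R E 3 3
    + (\<Sum>c\<in>{3,4,5}. ?o \<Omega> 1 2 c *\<^sub>R E c 0 + ?o \<Omega> 0 2 c *\<^sub>R (- E c 1) + ?o \<Omega> 0 1 c *\<^sub>R E c 2)
    + (\<Sum>c\<in>{0,1,2}. ?o \<Omega> c 4 5 *\<^sub>R E c 3 + ?o \<Omega> c 3 5 *\<^sub>R (- E c 4) + ?o \<Omega> c 3 4 *\<^sub>R E c 5)" for \<Omega>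
  have "linear G"
    unfolding G_def[abs_def]
    by (intro linear_compose_add linear_compose_sum ballI linear_scaleR_const
        bounded_linear.linear[OF bounded_linear_form_of])
  moreover have "act (blinfun_apply (G \<Omega>)) (det_form (b 0) (b 1) (b 2) + det_form (b 3) (b 4) (b 5)) = \<Omega>" (is "?A = \<Omega>") for \<Omega>
  proof -
    have e: "basis6 (\<lambda>i x. x \<bullet> b i) b"
    proof -
      have "x = (\<Sum>i<6. (x \<bullet> b i) *\<^sub>R b i)" for x
        using sum.reindex_bij_betw[OF b, of "\<lambda>c. (x \<bullet> c) *\<^sub>R c"] euclidean_representation[of x] by simp
      then show ?thesis
        unfolding basis6_def using bb by (auto simp: linear_iff inner_add_left)
    qed
    have "form_of (?A - \<Omega>) vs = 0" for vs
    proof (rule kform_eq_0_basis6[OF kform_form_of e])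
      fix "is" :: "nat list"
      assume "length is = 3" "sorted is" "distinct is" "set is \<subseteq> {..<6}"
      from sorted_3_below_6[OF this]
      show "form_of (?A - \<Omega>) (map b is) = 0"
        by (elim insertE emptyE) (simp_all add: form_of_act[OF linear_blinfun] form_of_det_form bb
          G_def blinfun.add_left blinfun.scaleR_left blinfun.minus_left blinfun.diff_left E inner_add_left
          inner_diff_left del: One_nat_def)
    qed
    then show ?thesis using form3_eqI[of ?A \<Omega>] by simp
  qed
  ultimately show ?thesis by blast
qed

lemma pull_standard_in_U_plus:
  fixes \<alpha> :: "nat \<Rightarrow> 'v::euclidean_space \<Rightarrow>\<^sub>L real"
  assumes dim: "DIM('v) = 6" and \<alpha>: "dual_basis \<alpha>" and b: "bij_betw b {..<6::nat} Basis"
    and g: "linear (g :: 'v \<Rightarrow> 'v)" "inj g"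
  shows "pull g (det_form (b 0) (b 1) (b 2) + det_form (b 3) (b 4) (b 5)) \<in> U_plus \<alpha>"
proof (rule U_plus_if_adapted[OF dim \<alpha>])
  have gi: "g (inv g x) = x" for x
    using linear_injective_imp_surjective[OF g] by (simp add: surj_f_inv_f)
  have "x = (\<Sum>i<6::nat. (g x \<bullet> b i) *\<^sub>R inv g (b i))" for x
  proof -
    have "g (\<Sum>i<6. (g x \<bullet> b i) *\<^sub>R inv g (b i)) = (\<Sum>i<6. (g x \<bullet> b i) *\<^sub>R b i)"
      by (simp add: linear_sum[OF g(1)] linear_scale[OF g(1)] gi)
    also have "\<dots> = g x"
      using sum.reindex_bij_betw[OF b, of "\<lambda>c. (g x \<bullet> c) *\<^sub>R c"] euclidean_representation[of "g x"] by simp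
    finally show ?thesis using injD[OF g(2)] by metis
  qed
  moreover have "linear (\<lambda>x. g x \<bullet> b i)" for i
    using g(1) by (simp add: linear_iff inner_add_left)
  ultimately have "basis6 (\<lambda>i x. g x \<bullet> b i) (\<lambda>i. inv g (b i))"
    unfolding basis6_def gi
    by (intro conjI allI impI) (auto simp: inner_enum_Basis[OF b])
  then show "adapted (\<lambda>i x. g x \<bullet> b i) (\<lambda>i. inv g (b i))
      (pull g (det_form (b 0) (b 1) (b 2) + det_form (b 3) (b 4) (b 5)))"
    by (simp add: adapted_def g(1) form_of_det_form det3_def)
qed

text \<open>The open mapping theorem needs a Euclidean target, so the space of 3-forms is embedded by
  \<open>L\<close> as a retract (with retraction \<open>R\<close>) of a coordinate space, and the second factor
  of the domain covers the complementary directions.\<close>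

lemma U_plus_interior:
  fixes \<alpha> :: "nat \<Rightarrow> 'v::euclidean_space \<Rightarrow>\<^sub>L real"
  assumes dim: "DIM('v) = 6" and \<alpha>: "dual_basis \<alpha>"
  obtains W \<zeta> where "open W" "W \<subseteq> U_plus \<alpha>" "\<zeta> \<in> W"
proof -
  obtain b :: "nat \<Rightarrow> 'v" where b: "bij_betw b {..<6} Basis"
    using ex_bij_betw_nat_finite[of "Basis :: 'v set"] dim by (auto simp: atLeast0LessThan)
  obtain c :: "6 \<Rightarrow> 'v" where c: "bij_betw c UNIV Basis"
    using finite_same_card_bij[of "UNIV :: 6 set" "Basis :: 'v set"] dim by auto
  define \<omega> where "\<omega> = det_form (b 0) (b 1) (b 2) + det_form (b 3) (b 4) (b 5)"
  obtain G :: "'v form3 \<Rightarrow> 'v \<Rightarrow>\<^sub>L 'v" where G: "linear G" "\<And>\<Omega>. act (blinfun_apply (G \<Omega>)) \<omega> = \<Omega>"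
    using act_right_inverse[OF b] unfolding \<omega>_def by blast
  define L :: "'v form3 \<Rightarrow> real^6^6^6" where "L \<Omega> = (\<chi> i j k. form_of \<Omega> [c i, c j, c k])" for \<Omega>
  define R :: "real^6^6^6 \<Rightarrow> 'v form3" where
    "R y = (\<Sum>i\<in>UNIV. \<Sum>j\<in>UNIV. \<Sum>k\<in>UNIV. (y $ i $ j $ k / 6) *\<^sub>R det_form (c i) (c j) (c k))" for y
  have RL: "R (L \<Omega>) = \<Omega>" for \<Omega>
  proof -
    have "\<Omega> = (\<Sum>p\<in>Basis. \<Sum>q\<in>Basis. \<Sum>r\<in>Basis. (form_of \<Omega> [p, q, r] / 6) *\<^sub>R det_form p q r)"
      by (rule form3_expand)
    then show ?thesis
      by (simp add: R_def L_def sum.reindex_bij_betw[OF c, symmetric])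
  qed
  have L: "bounded_linear L"
    by (rule linear_form3_bounded) (simp add: linear_iff L_def vec_eq_iff)
  have R: "linear R"
    unfolding R_def[abs_def]
    by (intro linear_compose_sum ballI linear_scaleR_const) (simp add: linear_iff add_divide_distrib)
  note Ll = bounded_linear.linear[OF L]
  define \<Phi> where "\<Phi> g = pull (blinfun_apply g) \<omega>" for g :: "'v \<Rightarrow>\<^sub>L 'v"
  have \<Phi>: "form_of (\<Phi> g) [x, y, z] = form_of \<omega> [g x, g y, g z]" for g x y z
    by (simp add: \<Phi>_def linear_blinfun)
  have dev: "((\<lambda>g. form_of (\<Phi> g) [x, y, z]) has_derivative
      (\<lambda>h. form_of 0 [g x, g y, g z] + form_of \<omega> [blinfun_apply h x, g y, g z] + form_of \<omega> [g x, h y, g z]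
        + form_of \<omega> [g x, g y, h z])) (at g)" for g :: "'v \<Rightarrow>\<^sub>L 'v" and x y z
    unfolding \<Phi>
    by (intro has_derivative_form_of has_derivative_const has_derivative_blinfun_apply has_derivative_ident)
  have \<Phi>': "(\<Phi> has_derivative (\<lambda>h. act (blinfun_apply h) \<omega>)) (at id_blinfun)"
    by (rule has_derivative_form3) (use dev[where g=id_blinfun] in \<open>simp add: form_of_act linear_blinfun\<close>)
  define F where "F p = L (\<Phi> (fst p)) + (snd p - L (R (snd p)))" for p :: "('v \<Rightarrow>\<^sub>L 'v) \<times> (real^6^6^6)"
  define F' where "F' p = L (act (blinfun_apply (fst p)) \<omega>) + (snd p - L (R (snd p)))"
    for p :: "('v \<Rightarrow>\<^sub>L 'v) \<times> (real^6^6^6)"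
  have LR: "bounded_linear (\<lambda>y. L (R y))"
    using linear_compose[OF R Ll] by (simp add: linear_conv_bounded_linear o_def)
  have \<Phi>fst: "((\<lambda>p. \<Phi> (fst p)) has_derivative (\<lambda>p. act (blinfun_apply (fst p)) \<omega>))
      (at (id_blinfun, 0 :: real^6^6^6))"
    by (rule has_derivative_compose[OF has_derivative_fst[OF has_derivative_ident]]) (simp add: \<Phi>')
  have F': "(F has_derivative F') (at (id_blinfun, 0))"
    unfolding F_def[abs_def] F'_def[abs_def]
    by (intro has_derivative_add has_derivative_diff bounded_linear.has_derivative[OF L]
      bounded_linear.has_derivative[OF LR] has_derivative_snd has_derivative_ident \<Phi>fst)
  have cont: "continuous_on UNIV F"
  proof -
    have "continuous_on UNIV (\<lambda>g. L (\<Phi> g))"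
      unfolding L_def
      by (intro continuous_on_vec_lambda continuous_at_imp_continuous_on ballI has_derivative_continuous[OF dev])
    then have "continuous_on UNIV (\<lambda>p. L (\<Phi> (fst p)))"
      by (rule continuous_on_compose2) (auto intro: continuous_intros)
    moreover have "continuous_on UNIV (\<lambda>p. L (R (snd p)))"
      by (intro bounded_linear.continuous_on[OF LR] continuous_on_snd continuous_on_id)
    ultimately show ?thesis
      unfolding F_def[abs_def] by (intro continuous_intros)
  qed
  \<comment> \<open>A right inverse of \<open>F'\<close>: since \<open>act\<close> undoes
    \<open>G\<close>, the first part contributes \<open>L (R y)\<close>, which the second completes
    to \<open>y\<close>.\<close>
  define g' where "g' y = (G (R y), y)" for y
  have g': "bounded_linear g'"
    unfolding linear_conv_bounded_linear[symmetric] g'_def[abs_def]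
    using linear_compose[OF R G(1)] by (simp add: linear_iff)
  have "F' \<circ> g' = id"
    by (simp add: fun_eq_iff F'_def g'_def G(2))
  \<comment> \<open>The unit ball around the identity keeps the first component injective, so its
    pullback stays in the orbit.\<close>
  let ?T = "ball id_blinfun 1 \<times> (UNIV :: (real^6^6^6) set)"
  have "F (id_blinfun, 0) \<in> interior (F ` ?T)"
    by (rule sussmann_open_mapping[OF open_UNIV cont _ F' g' \<open>F' \<circ> g' = id\<close>])
      (auto simp: interior_Times)
  moreover have "F (id_blinfun, 0) = L (\<Phi> id_blinfun)"
    by (simp add: F_def linear_0[OF R] linear_0[OF Ll])
  moreover have "open (L -` interior (F ` ?T))"
    by (intro open_vimage open_interior bounded_linear.continuous_on[OF L] continuous_on_id)
  moreover have "L -` interior (F ` ?T) \<subseteq> U_plus \<alpha>"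
  proof
    fix \<xi> assume "\<xi> \<in> L -` interior (F ` ?T)"
    then obtain g y where g: "dist id_blinfun g < 1" and "L \<xi> = F (g, y)"
      using interior_subset by fastforce
    \<comment> \<open>\<open>R\<close> annihilates the complementary term because
      \<open>R (L \<Omega>) = \<Omega>\<close>; applying it therefore leaves only
      \<open>\<Phi> g\<close>.\<close>
    then have "R (L \<xi>) = R (F (g, y))" by simp
    then have "\<xi> = \<Phi> g"
      by (simp add: F_def RL linear_add[OF R] linear_diff[OF R])
    moreover have "inj g" by (rule inj_if_near_id) (use g in \<open>simp add: dist_norm\<close>)
    ultimately show "\<xi> \<in> U_plus \<alpha>"
      using pull_standard_in_U_plus[OF dim \<alpha> b linear_blinfun] by (simp add: \<Phi>_def \<omega>_def)
  qed
  ultimately show thesis using that[of "L -` interior (F ` ?T)" "\<Phi> id_blinfun"] by simp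
qed

subsection \<open>Integrability\<close>

text \<open>If \<open>J\<close> contains 2, it omits 1, and passing to \<open>-P\<close> gives an
  index set that omits 2. The inclusion in \<open>{..3}\<close> makes this flip undo itself.\<close>

lemma integrable_typed:
  assumes P: "para_structure U P" and J: "2 \<notin> J \<or> 1 \<notin> J" "J \<subseteq> {..3}"
    and D: "\<And>\<xi>. \<xi> \<in> U \<Longrightarrow> D \<xi> = typed_forms (P \<xi>) J"
  shows "integrable_distribution U D"
proof -
  have main: "integrable_distribution U D"
    if P: "para_structure U P" and J: "2 \<notin> J" and D: "\<And>\<xi>. \<xi> \<in> U \<Longrightarrow> D \<xi> = typed_forms (P \<xi>) J" for P J
    unfolding integrable_distribution_def local_section_def
  proof (intro allI impI ballI)
    fix W X Y \<xi>
    assume h: "open W \<and> W \<subseteq> U \<and> (smooth_on W X \<and> (\<forall>\<zeta>\<in>W. X \<zeta> \<in> D \<zeta>)) \<and> (smooth_on W Y \<and> (\<forall>\<zeta>\<in>W. Y \<zeta> \<in> D \<zeta>))"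
      and \<xi>: "\<xi> \<in> W"
    have DW: "D \<xi> = typed_forms (P \<xi>) J" if "\<xi> \<in> W" for \<xi> using D h that by blast
    have "para_structure W P" using P h unfolding para_structure_def by blast
    then have "lie_bracket X Y \<xi> \<in> typed_forms (P \<xi>) J"
      by (rule bracket_typed[OF _ _ _ _ _ _ J \<xi>]) (use h DW in auto)
    then show "lie_bracket X Y \<xi> \<in> D \<xi>" using DW[OF \<xi>] by simp
  qed
  show ?thesis
  proof (cases "2 \<in> J")
    case False
    show ?thesis by (rule main[OF P False D])
  next
    case True
    let ?J = "{i. i \<le> 3 \<and> 3 - i \<in> J}"
    have "{i. i \<le> 3 \<and> 3 - i \<in> ?J} = J" using J(2) by (auto simp: diff_diff_cancel)
    then have "typed_forms (- P \<xi>) ?J = typed_forms (P \<xi>) J" for \<xi>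
      using typed_forms_neg[of "P \<xi>" ?J] by (simp add: blinfun.minus_left[abs_def] fun_Compl_def)
    moreover have "2 \<notin> ?J" using J(1) True by simp
    ultimately show ?thesis
      using main[OF para_structure_neg[OF P], of ?J] D by simp
  qed
qed

theorem proposition4p13:
  fixes \<alpha> :: "nat \<Rightarrow> 'v::euclidean_space \<Rightarrow>\<^sub>L real"
    and \<theta>0 :: "'v list \<Rightarrow> real"
  assumes "DIM('v) = 6"
    and "dual_basis \<alpha>"
    and "kform 6 \<theta>0"
    and "\<theta>0 \<noteq> (\<lambda>_. 0)"
  shows "let U = U_plus \<alpha>;
             D30 = type_distribution \<theta>0 3 0;
             D21 = type_distribution \<theta>0 2 1;
             D12 = type_distribution \<theta>0 1 2;
             D03 = type_distribution \<theta>0 0 3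
         in (\<forall>D \<in> {D30, D21, D12, D03,
                   D30 \<oplus> D21, D30 \<oplus> D12, D30 \<oplus> D03, D21 \<oplus> D03, D12 \<oplus> D03,
                   D30 \<oplus> D21 \<oplus> D03, D30 \<oplus> D12 \<oplus> D03}. integrable_distribution U D) \<and>
            (\<forall>D \<in> {D21 \<oplus> D12, D30 \<oplus> D21 \<oplus> D12, D21 \<oplus> D12 \<oplus> D03}.
               \<not> integrable_distribution U D)"
proof -
  obtain K P :: "'v form3 \<Rightarrow> 'v \<Rightarrow>\<^sub>L 'v" where K: "\<And>v u. real_polynomial_function (\<lambda>\<xi>. K \<xi> v \<bullet> u)"
    and KP: "\<And>\<xi>. \<xi> \<in> U_plus \<alpha> \<Longrightarrow> \<exists>a>0. K \<xi> = a *\<^sub>R P \<xi>"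
    and P: "\<And>\<xi>. \<xi> \<in> U_plus \<alpha> \<Longrightarrow> blinfun_apply (P \<xi>) = P_map \<theta>0 \<xi>"
    and para: "para_structure (U_plus \<alpha>) P"
    using orbit_para_structure[OF assms] by blast
  \<comment> \<open>Only over the orbit does \<open>P\<close> agree with \<open>P_map\<close>. There
    every distribution of the claim is given by a subset of {0, 1, 2, 3}, and two criteria on
    subsets settle all fourteen.\<close>
  define typed where "typed D J \<longleftrightarrow> (\<forall>\<xi>\<in>U_plus \<alpha>. D \<xi> = typed_forms (P \<xi>) J)" for D J
  have single: "typed (type_distribution \<theta>0 r s) {r}" if "r + s = 3" for r s
    unfolding typed_def using type_distribution_eq[OF that, of \<theta>0] P by simp
  have sum: "typed (D \<oplus> E) (J \<union> J')" if "typed D J" "typed E J'" for D E J J'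
    unfolding typed_def
  proof
    fix \<xi> assume \<xi>: "\<xi> \<in> U_plus \<alpha>"
    show "(D \<oplus> E) \<xi> = typed_forms (P \<xi>) (J \<union> J')"
      by (rule distribution_sum_typed[OF linear_blinfun para_structureD(2)[OF para \<xi>]])
        (use that \<xi> in \<open>auto simp: typed_def\<close>)
  qed
  have pos: "integrable_distribution (U_plus \<alpha>) D" if "typed D J" "2 \<notin> J \<or> 1 \<notin> J" "J \<subseteq> {..3}" for D J
    by (rule integrable_typed[OF para that(2,3)]) (use that(1) in \<open>simp add: typed_def\<close>)
  obtain W \<zeta> where W: "open W" "W \<subseteq> U_plus \<alpha>" "\<zeta> \<in> W"
    by (rule U_plus_interior[OF assms(1,2)])
  have paraW: "para_structure W P" using para W(2) unfolding para_structure_def by blast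
  obtain \<beta>' e' where "adapted \<beta>' e' \<zeta>" using adapted_if_U_plus[OF assms(1,2)] W(2,3) by blast
  then obtain \<beta> e where ad: "adapted \<beta> e \<zeta>" and \<theta>pos: "\<theta>0 (map e [0..<6]) > 0"
    by (rule adapted_positive[OF _ assms(3,4)])
  have e: "basis6 \<beta> e" using ad by (simp add: adapted_def)
  have Pe: "P \<zeta> (e i) = (if i < 3 then e i else - e i)" if "i < 6" for i
    using P[of \<zeta>] W(2,3) P_map_adapted(1)[OF ad assms(3) \<theta>pos] reflection6_fixed(1)[OF e that] by auto
  have \<zeta>e: "form_of \<zeta> [e 0, e 1, e 2] = 1" "form_of \<zeta> [e 3, e 4, e 5] = 1"
    by (simp_all add: form_of_adapted_basis[OF ad] det3_def basis6D(2)[OF e])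
  have neg: "\<not> integrable_distribution (U_plus \<alpha>) D"
    if D: "typed D J" and J: "{1, 2} \<subseteq> J" "J \<subseteq> {..3}" "3 \<notin> J \<or> 0 \<notin> J" for D J
  proof (cases "3 \<in> J")
    case False
    show ?thesis
    proof (rule not_integrable_typed[of W P "U_plus \<alpha>" \<zeta> K "e 0" "e 1" "e 2" "e 3" "e 4" "e 5" J D,
        OF paraW W K])
      show "\<exists>a. a \<noteq> 0 \<and> K \<xi> = a *\<^sub>R P \<xi>" if \<xi>: "\<xi> \<in> W" for \<xi>
      proof -
        obtain a where "a > 0" "K \<xi> = a *\<^sub>R P \<xi>" using KP[of \<xi>] W(2) \<xi> by blast
        then show ?thesis by (intro exI[of _ a]) simp
      qed
      show "D \<xi> = typed_forms (P \<xi>) J" if "\<xi> \<in> W" for \<xi>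
        using D W(2) that unfolding typed_def by blast
    qed (use \<open>{1, 2} \<subseteq> J\<close> False in \<open>simp_all add: Pe \<zeta>e del: One_nat_def\<close>)
  next
    \<comment> \<open>Now (0,3) is the missing type. For \<open>-P\<close> it becomes the missing
      type (3,0), with the two triples of the adapted basis exchanged and a negative factor between
      \<open>K\<close> and \<open>-P\<close>.\<close>
    case True
    let ?J = "{i. i \<le> 3 \<and> 3 - i \<in> J}"
    have "{i. i \<le> 3 \<and> 3 - i \<in> ?J} = J" using J(2) by (auto simp: diff_diff_cancel)
    then have flip: "typed_forms (- P \<xi>) ?J = typed_forms (P \<xi>) J" for \<xi>
      using typed_forms_neg[of "P \<xi>" ?J] by (simp add: blinfun.minus_left[abs_def] fun_Compl_def)
    show ?thesis
    proof (rule not_integrable_typed[of W "\<lambda>\<xi>. - P \<xi>" "U_plus \<alpha>" \<zeta> K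
        "e 3" "e 4" "e 5" "e 0" "e 1" "e 2" ?J D, OF para_structure_neg[OF paraW] W K])
      show "\<exists>a. a \<noteq> 0 \<and> K \<xi> = a *\<^sub>R - P \<xi>" if \<xi>: "\<xi> \<in> W" for \<xi>
      proof -
        obtain a where "a > 0" "K \<xi> = a *\<^sub>R P \<xi>" using KP[of \<xi>] W(2) \<xi> by blast
        then show ?thesis by (intro exI[of _ "- a"]) simp
      qed
      show "D \<xi> = typed_forms (- P \<xi>) ?J" if "\<xi> \<in> W" for \<xi>
        using D W(2) that unfolding typed_def flip by blast
      have "1 \<in> ?J" "2 \<in> ?J" "3 \<notin> ?J" using J True by auto
      then show "{1, 2} \<subseteq> ?J" "3 \<notin> ?J" by blast+
    qed (simp_all add: blinfun.minus_left Pe \<zeta>e del: One_nat_def)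
  qed
  let ?D30 = "type_distribution \<theta>0 3 0" and ?D21 = "type_distribution \<theta>0 2 1"
    and ?D12 = "type_distribution \<theta>0 1 2" and ?D03 = "type_distribution \<theta>0 0 3"
  have t: "typed ?D30 {3}" "typed ?D21 {2}" "typed ?D12 {1}" "typed ?D03 {0}"
    by (rule single, simp)+
  note s2 = sum[OF t(1,2)] sum[OF t(1,3)] sum[OF t(1,4)] sum[OF t(2,4)] sum[OF t(3,4)] sum[OF t(2,3)]
  note s3 = sum[OF s2(1) t(4)] sum[OF s2(2) t(4)] sum[OF s2(1) t(3)] sum[OF s2(6) t(4)]
  show ?thesis
    unfolding Let_def
    using t[THEN pos] s2(1-5)[THEN pos] s3(1,2)[THEN pos] s2(6)[THEN neg] s3(3,4)[THEN neg] by simp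
qed

end
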